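(* Let $P(M,C,\psi,e)$ be a copointed coalgebra bundle over a field $k$ with $\psi$ bijective, let $\omega$ be (the connection form of) a strong connection on it, and let $V$ be a left $C$-comodule. Then there is a covariant derivative $$\bar D:\mathrm{Hom}_0(V,P\Omega^nM)\to\mathrm{Hom}_0(V,P\Omega^{n+1}M),\qquad \bar D\phi(v)=\mathrm d\phi(v)+\omega(v_{(1)})\phi(v_{(\infty)}).$$ In particular, if $V$ and $\theta:V\to P(\Omega^1M)$ give a coalgebra frame resolution of $M$ and $P$ is flat as a right $M$-module, then the torsion $T=\mathrm d-\nabla:\Omega^1M\to\Omega^2M$, viewed as a map $V\to P(\Omega^2M)$, is $T=\bar D\theta$; that is, $T(s_\theta(\sum_iu^i\otimes v^i))=\sum_iu^i\,\bar D\theta(v^i)$ for all $\sum_i u^i\otimes v^i\in E=P\Box_CV$.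
   Context: Algebras are unital over $k$. An entwining structure $(P,C,\psi)$: algebra $P$, coalgebra $C$, linear $\psi:C\otimes P\to P\otimes C$ with $\psi\circ(\mathrm{id}\otimes\cdot)=(\cdot\otimes\mathrm{id})(\mathrm{id}\otimes\psi)(\psi\otimes\mathrm{id})$, $\psi(c\otimes1)=1\otimes c$, $(\mathrm{id}\otimes\Delta)\psi=(\psi\otimes\mathrm{id})(\mathrm{id}\otimes\psi)(\Delta\otimes\mathrm{id})$, $(\mathrm{id}\otimes\epsilon)\psi=\epsilon\otimes\mathrm{id}$. A copointed coalgebra bundle $P(M,C,\psi,e)$: an entwining structure and a group-like $e\in C$ such that, with the coaction $\Delta_P(u)=\psi(e\otimes u)=u_{(0)}\otimes u_{(1)}$ and $M=\{u\in P\mid\Delta_P(u)=u\otimes e\}$, the map $\chi:P\otimes_MP\to P\otimes C$, $u\otimes_M v\mapsto u\Delta_P(v)$ is bijective. Put $\tilde\chi:P\otimes P\to P\otimes C$, $u\otimes v\mapsto u\Delta_P(v)$, and $\psi^n=\psi_{n,n+1}\cdots\psi_{12}:C\otimes P^{\otimes n}\to P^{\otimes n}\otimes C$. Universal forms: $\Omega^nP\subset P^{\otimes(n+1)}$ is the subspace on which all products of adjacent factors vanish, $\mathrm d(u_1\otimes\cdots\otimes u_n)=\sum_{k=1}^{n+1}(-1)^{k-1}u_1\otimes\cdots\otimes u_{k-1}\otimes1\otimes u_k\otimes\cdots\otimes u_n$ (so $\mathrm du=1\otimes u-u\otimes1$), and the product in $\Omega P$ is juxtaposition with multiplication of the adjoining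 factors; similarly for $\Omega M\subset\Omega P$. Connection: a left $P$-module projection $\Pi:\Omega^1P\to\Omega^1P$ with $\ker\Pi=P(\Omega^1M)P$ and $\Pi\circ\mathrm d$ commuting with the right coactions $\Delta_P$ and $w\mapsto\psi^2(e\otimes w)$. Its connection form is the corresponding linear map $\omega:C\to\Omega^1P$ with $\omega(e)=0$, $\tilde\chi(\omega(c))=1\otimes c-\epsilon(c)1\otimes e$, $\psi^2(c_{(1)}\otimes\omega(c_{(2)}))=\omega(c_{(1)})\otimes c_{(2)}$, and $\Pi(u\,\mathrm dv)=uv_{(0)}\omega(v_{(1)})$. It is strong if $D=(\mathrm{id}-\Pi)\circ\mathrm d$ maps $P$ into $(\Omega^1M)P$. ${}_V\Delta(v)=v_{(1)}\otimes v_{(\infty)}$ is the left coaction. $\mathrm{Hom}_0(V,P\Omega^nM)$ is the space of linear $\phi:V\to P(\Omega^nM)$ with $\psi^{n+1}\circ(\mathrm{id}\otimes\phi)\circ{}_V\Delta=\phi\otimes e$. $E=P\Box_CV=\ker(\Delta_P\otimes\mathrm{id}-\mathrm{id}\otimes{}_V\Delta)\subseteq P\otimes V$. A (coalgebra) frame resolution of $M$ consists of a copointed coalgebra bundle $P(M,C,\psi,e)$ with bijective $\psi$, a left $C$-comodule $V$ with its left associated bundle $E=P\Box_CV$, and a map $\theta\in\mathrm{Hom}_0(V,P\Omega^1M)$ such that $s_\theta:E\to\Omega^1M$, $\sum u^i\otimes v^i\mapsto\sum u^i\theta(v^i)$, is an isomorphism of left $M$-modules. It induces $\mathrm{id}\otimes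 s_\theta:(\Omega^1M)P\Box_CV\cong\Omega^1M\otimes_M\Omega^1M=\Omega^2M$, $w\otimes v\mapsto w\theta(v)$ (with coaction $w\mapsto\psi^2(e\otimes w)$ on $(\Omega^1M)P$), and the covariant derivative is $\nabla=(\mathrm{id}\otimes s_\theta)\circ(D\Box_C\mathrm{id})\circ s_\theta^{-1}:\Omega^1M\to\Omega^2M$. *)

theory Defs
  imports Complex_Main "HOL-Library.Poly_Mapping" "HOL-Library.FuncSet" "HOL-Algebra.Module"
begin

section \<open>Tensor products over the ground field\<close>

text \<open>
  All tensor products over the field \<open>k\<close> of copies of an algebra \<open>P\<close>, a coalgebra \<open>C\<close> and a comodule
  \<open>V\<close> live in one space: the quotient of the free vector space on words with letters from
  \<open>P\<close>, \<open>C\<close> and \<open>V\<close> by the relations of multilinearity in each letter.  These relations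
  are homogeneous in the shape of a word, so the span of the classes of all words of a given shape,
  say a letter from \<open>P\<close> followed by one from \<open>C\<close>, is the usual quotient \<open>P \<otimes> C\<close>.
  Concatenation of words is a strictly associative and unital tensor product, and words make it
  possible to form tensor powers with a variable number of factors.

  The vector spaces are the whole types \<open>'p\<close>, \<open>'c\<close>, \<open>'v\<close> with explicit scalar multiplications.
  The sort \<open>{ring,monoid_mult}\<close> is that of unital rings in which \<open>1 = 0\<close> is not excluded.
\<close>

datatype ('p, 'c, 'v) letter = LP 'p | LC 'c | LV 'v

type_synonym ('k, 'p, 'c, 'v) tensor = "('p, 'c, 'v) letter list \<Rightarrow>\<^sub>0 'k"

record (overloaded) ('k, 'p, 'c, 'v) bundle_data =
  scaleP :: "'k::field \<Rightarrow> 'p \<Rightarrow> 'p"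
  scaleC :: "'k \<Rightarrow> 'c \<Rightarrow> 'c"
  scaleV :: "'k \<Rightarrow> 'v \<Rightarrow> 'v"
  comult :: "'c \<Rightarrow> ('p, 'c, 'v) letter list \<Rightarrow>\<^sub>0 'k"
  counit :: "'c \<Rightarrow> 'k"
  entwine :: "'c \<Rightarrow> 'p \<Rightarrow> ('p, 'c, 'v) letter list \<Rightarrow>\<^sub>0 'k"
  grouplike :: 'c
  coact :: "'v \<Rightarrow> ('p, 'c, 'v) letter list \<Rightarrow>\<^sub>0 'k"

definition tscale :: "'k::field \<Rightarrow> ('a \<Rightarrow>\<^sub>0 'k) \<Rightarrow> ('a \<Rightarrow>\<^sub>0 'k)" where
  "tscale a x = Poly_Mapping.map ((*) a) x"

lemma lookup_tscale [simp]: "Poly_Mapping.lookup (tscale a x) w = a * Poly_Mapping.lookup x w"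
  by (simp add: tscale_def Poly_Mapping.map.rep_eq when_def)

global_interpretation tvec: vector_space "tscale :: 'k::field \<Rightarrow> ('a \<Rightarrow>\<^sub>0 'k) \<Rightarrow> ('a \<Rightarrow>\<^sub>0 'k)"
  by unfold_locales (auto intro!: poly_mapping_eqI simp: lookup_add algebra_simps)

abbreviation tspan :: "('a \<Rightarrow>\<^sub>0 'k::field) set \<Rightarrow> ('a \<Rightarrow>\<^sub>0 'k) set" where
  "tspan \<equiv> tvec.span"

abbreviation word :: "('p, 'c, 'v) letter list \<Rightarrow> ('k::field, 'p, 'c, 'v) tensor" where
  "word w \<equiv> Poly_Mapping.single w 1"

inductive_set multilinear_rels ::
  "('k::field, 'p::ab_group_add, 'c::ab_group_add, 'v::ab_group_add) bundle_data
   \<Rightarrow> ('k, 'p, 'c, 'v) tensor set"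
  for B where
  addP: "word (u @ LP (p + q) # w) - word (u @ LP p # w) - word (u @ LP q # w) \<in> multilinear_rels B"
| addC: "word (u @ LC (c + d) # w) - word (u @ LC c # w) - word (u @ LC d # w) \<in> multilinear_rels B"
| addV: "word (u @ LV (x + y) # w) - word (u @ LV x # w) - word (u @ LV y # w) \<in> multilinear_rels B"
| scaleP: "word (u @ LP (scaleP B a p) # w) - tscale a (word (u @ LP p # w)) \<in> multilinear_rels B"
| scaleC: "word (u @ LC (scaleC B a c) # w) - tscale a (word (u @ LC c # w)) \<in> multilinear_rels B"
| scaleV: "word (u @ LV (scaleV B a x) # w) - tscale a (word (u @ LV x # w)) \<in> multilinear_rels B"

text \<open>
  The quotient of the free vector space by the span of these relations is modelled inside the free
  vector space: \<open>cls B\<close> is a linear idempotent with kernel exactly that span, chosen once and for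
  all.  Its range is a copy of the quotient and \<open>cls B\<close> is the quotient map (see
  \<open>cls_eq_iff\<close> below).
\<close>

definition is_quotient_map where
  "is_quotient_map B \<pi> \<longleftrightarrow> Vector_Spaces.linear tscale tscale \<pi> \<and> (\<forall>x. \<pi> (\<pi> x) = \<pi> x) \<and>
     {x. \<pi> x = 0} = tspan (multilinear_rels B)"

definition cls ::
  "('k::field, 'p::ab_group_add, 'c::ab_group_add, 'v::ab_group_add) bundle_data
   \<Rightarrow> ('k, 'p, 'c, 'v) tensor \<Rightarrow> ('k, 'p, 'c, 'v) tensor" where
  "cls B = (SOME \<pi>. is_quotient_map B \<pi>)"

lemma is_quotient_map_cls:
  fixes B :: "('k::field, 'p::ab_group_add, 'c::ab_group_add, 'v::ab_group_add) bundle_data"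
  shows "is_quotient_map B (cls B)"
proof -
  interpret vp: vector_space_pair
    "tscale :: 'k \<Rightarrow> ('k, 'p, 'c, 'v) tensor \<Rightarrow> ('k, 'p, 'c, 'v) tensor"
    "tscale :: 'k \<Rightarrow> ('k, 'p, 'c, 'v) tensor \<Rightarrow> ('k, 'p, 'c, 'v) tensor"
    by unfold_locales
  let ?N = "tspan (multilinear_rels B)"
  obtain A where A: "A \<subseteq> ?N" "tvec.independent A" "?N \<subseteq> tspan A"
    using tvec.basis_exists by metis
  then have NA: "?N = tspan A"
    by (metis tvec.span_mono tvec.span_span subset_antisym)
  define E where "E = tvec.extend_basis A"
  have E: "A \<subseteq> E" "tvec.independent E" "tspan E = UNIV"
    using tvec.extend_basis_superset tvec.independent_extend_basis tvec.span_extend_basis A(2)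
    unfolding E_def by auto
  define p where "p = vp.construct E (\<lambda>b. if b \<in> A then 0 else b)"
  have lin: "Vector_Spaces.linear tscale tscale p"
    unfolding p_def by (rule vp.linear_construct[OF E(2)])
  interpret p: Vector_Spaces.linear tscale tscale p by (rule lin)
  have pb: "p b = (if b \<in> A then 0 else b)" if "b \<in> E" for b
    unfolding p_def by (rule vp.construct_basis[OF E(2) that])
  have pA: "p x = 0" if "x \<in> tspan A" for x
  proof (rule vp.linear_eq_0_on_span[OF lin _ that])
    show "p b = 0" if "b \<in> A" for b
      using that pb[of b] E(1) by (simp add: subsetD)
  qed
  have diff: "x - p x \<in> tspan A" for x
  proof -
    have "x \<in> tspan E" by (simp add: E(3))
    then show ?thesis
    proof (induction rule: tvec.span_induct_alt)
      case base then show ?case by (simp add: p.zero tvec.span_zero)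
    next
      case (step a b y)
      have "b - p b \<in> tspan A"
        using pb[OF step(1)] by (cases "b \<in> A") (simp_all add: tvec.span_base tvec.span_zero)
      then have "tscale a (b - p b) + (y - p y) \<in> tspan A"
        using step(2) by (rule tvec.span_add[OF tvec.span_scale])
      moreover have "tscale a b + y - p (tscale a b + y) = tscale a (b - p b) + (y - p y)"
        unfolding p.add p.scale tvec.scale_right_diff_distrib by (rule add_diff_add)
      ultimately show ?case by (simp only:)
    qed
  qed
  have "is_quotient_map B p"
    unfolding is_quotient_map_def
  proof (intro conjI allI lin)
    fix x
    have "p (x - p x) = 0" using pA diff by blast
    then show "p (p x) = p x" by (simp add: p.diff)
  next
    have "x \<in> tspan A" if "p x = 0" for x
      using diff[of x] that by simp
    then show "{x. p x = 0} = ?N"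
      unfolding NA using pA by blast
  qed
  then show ?thesis unfolding cls_def by (rule someI[of "is_quotient_map B"])
qed

lemma linear_cls: "Vector_Spaces.linear tscale tscale (cls B)"
  using is_quotient_map_cls unfolding is_quotient_map_def by blast

lemma cls_eq_iff: "cls B x = cls B y \<longleftrightarrow> x - y \<in> tspan (multilinear_rels B)"
proof -
  interpret c: Vector_Spaces.linear tscale tscale "cls B" by (rule linear_cls)
  have "{z. cls B z = 0} = tspan (multilinear_rels B)"
    using is_quotient_map_cls[of B] unfolding is_quotient_map_def by blast
  then have "x - y \<in> tspan (multilinear_rels B) \<longleftrightarrow> cls B (x - y) = 0"
    by blast
  then show ?thesis by (simp add: c.diff)
qed

definition pure ::
  "('k::field, 'p::ab_group_add, 'c::ab_group_add, 'v::ab_group_add) bundle_data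
   \<Rightarrow> ('p, 'c, 'v) letter list \<Rightarrow> ('k, 'p, 'c, 'v) tensor" where
  "pure B w = cls B (word w)"

text \<open>
  Maps on tensors are given by multilinear prescriptions on words.  Prescriptions that concern only
  one shape are extended by \<open>0\<close> to words of other shapes, which keeps them multilinear and hence
  compatible with \<open>cls B\<close>.
\<close>

definition lin_ext :: "('a \<Rightarrow> ('b \<Rightarrow>\<^sub>0 'k)) \<Rightarrow> ('a \<Rightarrow>\<^sub>0 'k) \<Rightarrow> ('b \<Rightarrow>\<^sub>0 'k::field)" where
  "lin_ext F x = (\<Sum>w\<in>Poly_Mapping.keys x. tscale (Poly_Mapping.lookup x w) (F w))"

definition tens ::
  "('k::field, 'p::ab_group_add, 'c::ab_group_add, 'v::ab_group_add) bundle_data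
   \<Rightarrow> ('k, 'p, 'c, 'v) tensor \<Rightarrow> ('k, 'p, 'c, 'v) tensor \<Rightarrow> ('k, 'p, 'c, 'v) tensor"
  (infixl \<open>\<otimes>\<^sub>k\<index>\<close> 70) where
  "x \<otimes>\<^sub>k\<^bsub>B\<^esub> y = lin_ext (\<lambda>u. lin_ext (\<lambda>w. pure B (u @ w)) y) x"

definition tens_set ::
  "('k::field, 'p::ab_group_add, 'c::ab_group_add, 'v::ab_group_add) bundle_data
   \<Rightarrow> ('k, 'p, 'c, 'v) tensor set \<Rightarrow> ('k, 'p, 'c, 'v) tensor set \<Rightarrow> ('k, 'p, 'c, 'v) tensor set"
  where
  "tens_set B X Y = tspan {x \<otimes>\<^sub>k\<^bsub>B\<^esub> y | x y. x \<in> X \<and> y \<in> Y}"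

abbreviation elP where "elP B p \<equiv> pure B [LP p]"
abbreviation elC where "elC B c \<equiv> pure B [LC c]"
abbreviation elV where "elV B v \<equiv> pure B [LV v]"

definition spP where "spP B = range (elP B)"
definition spC where "spC B = range (elC B)"
definition spV where "spV B = range (elV B)"

text \<open>
  \<open>at_slot B i f\<close> is \<open>id\<^sup>i \<otimes> f \<otimes> id\<close> for a map \<open>f\<close> defined on single letters; the maps
  \<open>on_P\<close>, \<open>on_C\<close>, \<open>on_V\<close> turn maps on \<open>P\<close>, \<open>C\<close>, \<open>V\<close> into such \<open>f\<close>.
\<close>

definition on_P :: "('p \<Rightarrow> 'a::zero) \<Rightarrow> ('p, 'c, 'v) letter \<Rightarrow> 'a" where
  "on_P f l = (case l of LP p \<Rightarrow> f p | _ \<Rightarrow> 0)"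

definition on_C :: "('c \<Rightarrow> 'a::zero) \<Rightarrow> ('p, 'c, 'v) letter \<Rightarrow> 'a" where
  "on_C f l = (case l of LC c \<Rightarrow> f c | _ \<Rightarrow> 0)"

definition on_V :: "('v \<Rightarrow> 'a::zero) \<Rightarrow> ('p, 'c, 'v) letter \<Rightarrow> 'a" where
  "on_V f l = (case l of LV v \<Rightarrow> f v | _ \<Rightarrow> 0)"

definition at_slot where
  "at_slot B i f t = lin_ext (\<lambda>w. if i < length w
     then pure B (take i w) \<otimes>\<^sub>k\<^bsub>B\<^esub> f (w ! i) \<otimes>\<^sub>k\<^bsub>B\<^esub> pure B (drop (Suc i) w) else 0) t"

text \<open>The map \<open>\<psi>\<close> applied to the factors \<open>i\<close> and \<open>i + 1\<close> (counted from \<open>0\<close>), and \<open>\<psi>\<^sup>n\<close>.\<close>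

definition psi_at where
  "psi_at B i t = lin_ext (\<lambda>w. case drop i w of
     LC c # LP p # r \<Rightarrow> pure B (take i w) \<otimes>\<^sub>k\<^bsub>B\<^esub> entwine B c p \<otimes>\<^sub>k\<^bsub>B\<^esub> pure B r | _ \<Rightarrow> 0) t"

fun psi_pow where
  "psi_pow B 0 t = t"
| "psi_pow B (Suc n) t = psi_at B n (psi_pow B n t)"

text \<open>
  \<open>juxt\<close> multiplies the adjoining factors, \<open>(\<dots> \<otimes> a)(b \<otimes> \<dots>) = \<dots> \<otimes> ab \<otimes> \<dots>\<close>.  It is the product of
  universal forms and also the left and right \<open>P\<close>-action on tensors beginning or ending with a
  factor in \<open>P\<close>.
\<close>

definition mult_at where
  "mult_at B i t = lin_ext (\<lambda>w. case drop i w of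
     LP a # LP b # r \<Rightarrow> pure B (take i w @ LP (a * b) # r) | _ \<Rightarrow> 0) t"

definition juxt (infixl \<open>\<star>\<index>\<close> 70) where
  "x \<star>\<^bsub>B\<^esub> y = lin_ext (\<lambda>u. lin_ext (\<lambda>w. case (rev u, w) of
     (LP a # u', LP b # w') \<Rightarrow> pure B (rev u' @ LP (a * b) # w') | _ \<Rightarrow> 0) y) x"


section \<open>Copointed coalgebra bundles\<close>

definition k_algebra ::
  "('k::field, 'p::{ring,monoid_mult}, 'c::ab_group_add, 'v::ab_group_add) bundle_data \<Rightarrow> bool"
  where
  "k_algebra B \<longleftrightarrow> vector_space (scaleP B) \<and>
     (\<forall>a p q. scaleP B a (p * q) = scaleP B a p * q \<and> scaleP B a (p * q) = p * scaleP B a q)"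

definition k_coalgebra where
  "k_coalgebra B \<longleftrightarrow> vector_space (scaleC B) \<and>
     Vector_Spaces.linear (scaleC B) tscale (comult B) \<and>
     Vector_Spaces.linear (scaleC B) (*) (counit B) \<and>
     (\<forall>c. comult B c \<in> tens_set B (spC B) (spC B)) \<and>
     (\<forall>c. at_slot B 0 (on_C (comult B)) (comult B c) = at_slot B 1 (on_C (comult B)) (comult B c)) \<and>
     (\<forall>c. at_slot B 0 (on_C (\<lambda>d. tscale (counit B d) (pure B []))) (comult B c) = elC B c) \<and>
     (\<forall>c. at_slot B 1 (on_C (\<lambda>d. tscale (counit B d) (pure B []))) (comult B c) = elC B c)"

text \<open>The linear map \<open>\<psi> : C \<otimes> P \<rightarrow> P \<otimes> C\<close> is given by the bilinear map \<open>entwine B\<close>.\<close>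

definition entwining_structure where
  "entwining_structure B \<longleftrightarrow> k_algebra B \<and> k_coalgebra B \<and>
     (\<forall>p. Vector_Spaces.linear (scaleC B) tscale (\<lambda>c. entwine B c p)) \<and>
     (\<forall>c. Vector_Spaces.linear (scaleP B) tscale (entwine B c)) \<and>
     (\<forall>c p. entwine B c p \<in> tens_set B (spP B) (spC B)) \<and>
     (\<forall>c p q. entwine B c (p * q) =
        mult_at B 0 (psi_at B 1 (psi_at B 0 (pure B [LC c, LP p, LP q])))) \<and>
     (\<forall>c. entwine B c 1 = pure B [LP 1, LC c]) \<and>
     (\<forall>c p. at_slot B 1 (on_C (comult B)) (entwine B c p) =
        psi_at B 0 (psi_at B 1 (comult B c \<otimes>\<^sub>k\<^bsub>B\<^esub> elP B p))) \<and>
     (\<forall>c p. at_slot B 1 (on_C (\<lambda>d. tscale (counit B d) (pure B []))) (entwine B c p) =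
        tscale (counit B c) (elP B p))"

definition psi_bijective where
  "psi_bijective B \<longleftrightarrow>
     bij_betw (psi_at B 0) (tens_set B (spC B) (spP B)) (tens_set B (spP B) (spC B))"

definition coactP where
  "coactP B u = entwine B (grouplike B) u"

definition base_alg where
  "base_alg B = {u. coactP B u = pure B [LP u, LC (grouplike B)]}"

definition chi_tilde where
  "chi_tilde B t = lin_ext (\<lambda>w. case w of [LP u, LP v] \<Rightarrow> elP B u \<star>\<^bsub>B\<^esub> coactP B v | _ \<Rightarrow> 0) t"

text \<open>\<open>P \<otimes>\<^sub>M P\<close> is the quotient of \<open>P \<otimes> P\<close> by the span of all \<open>um \<otimes> v - u \<otimes> mv\<close>.\<close>

definition balanced_rels where
  "balanced_rels B = tspan {pure B [LP (u * m), LP v] - pure B [LP u, LP (m * v)] | u m v. m \<in> base_alg B}"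

definition balanced_square where
  "balanced_square B = tens_set B (spP B) (spP B) //
     {(x, y). x \<in> tens_set B (spP B) (spP B) \<and> y \<in> tens_set B (spP B) (spP B) \<and>
              x - y \<in> balanced_rels B}"

definition chi where
  "chi B X = the_elem (chi_tilde B ` X)"

definition copointed_coalgebra_bundle where
  "copointed_coalgebra_bundle B \<longleftrightarrow> entwining_structure B \<and>
     comult B (grouplike B) = pure B [LC (grouplike B), LC (grouplike B)] \<and>
     counit B (grouplike B) = 1 \<and>
     bij_betw (chi B) (balanced_square B) (tens_set B (spP B) (spC B))"


section \<open>Universal differential forms\<close>

definition Omega_P where
  "Omega_P B n = {x \<in> tspan {pure B (map LP us) | us. length us = Suc n}.
     \<forall>i<n. mult_at B i x = 0}"

definition Omega_M where
  "Omega_M B n = {x \<in> tspan {pure B (map LP ms) | ms. length ms = Suc n \<and> set ms \<subseteq> base_alg B}.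
     \<forall>i<n. mult_at B i x = 0}"

definition dif where
  "dif B t = lin_ext (\<lambda>w. \<Sum>k\<le>length w. tscale ((-1) ^ k) (pure B (take k w @ LP 1 # drop k w))) t"

definition P_Omega_M where
  "P_Omega_M B n = tspan {elP B p \<star>\<^bsub>B\<^esub> x | p x. x \<in> Omega_M B n}"

definition Omega1_M_P where
  "Omega1_M_P B = tspan {x \<star>\<^bsub>B\<^esub> elP B p | x p. x \<in> Omega_M B 1}"

definition P_Omega1_M_P where
  "P_Omega1_M_P B = tspan {elP B p \<star>\<^bsub>B\<^esub> x \<star>\<^bsub>B\<^esub> elP B q | p x q. x \<in> Omega_M B 1}"


section \<open>Connections\<close>

definition connection where
  "connection B Pr \<longleftrightarrow> Pr \<in> Omega_P B 1 \<rightarrow> Omega_P B 1 \<and>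
     (\<forall>x\<in>Omega_P B 1. \<forall>y\<in>Omega_P B 1. Pr (x + y) = Pr x + Pr y) \<and>
     (\<forall>p. \<forall>x\<in>Omega_P B 1. Pr (elP B p \<star>\<^bsub>B\<^esub> x) = elP B p \<star>\<^bsub>B\<^esub> Pr x) \<and>
     (\<forall>x\<in>Omega_P B 1. Pr (Pr x) = Pr x) \<and>
     {x \<in> Omega_P B 1. Pr x = 0} = P_Omega1_M_P B \<and>
     (\<forall>u. psi_pow B 2 (elC B (grouplike B) \<otimes>\<^sub>k\<^bsub>B\<^esub> Pr (dif B (elP B u))) =
        at_slot B 0 (on_P (\<lambda>v. Pr (dif B (elP B v)))) (coactP B u))"

definition connection_form where
  "connection_form B Pr \<omega> \<longleftrightarrow> Vector_Spaces.linear (scaleC B) tscale \<omega> \<and>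
     (\<forall>c. \<omega> c \<in> Omega_P B 1) \<and>
     \<omega> (grouplike B) = 0 \<and>
     (\<forall>c. chi_tilde B (\<omega> c) =
        pure B [LP 1, LC c] - tscale (counit B c) (pure B [LP 1, LC (grouplike B)])) \<and>
     (\<forall>c. psi_pow B 2 (at_slot B 1 (on_C \<omega>) (comult B c)) = at_slot B 0 (on_C \<omega>) (comult B c)) \<and>
     (\<forall>u v. Pr (elP B u \<star>\<^bsub>B\<^esub> dif B (elP B v)) =
        elP B u \<star>\<^bsub>B\<^esub> lin_ext (\<lambda>w. case w of [LP p, LC c] \<Rightarrow> elP B p \<star>\<^bsub>B\<^esub> \<omega> c | _ \<Rightarrow> 0) (coactP B v))"

definition covP where
  "covP B Pr u = dif B (elP B u) - Pr (dif B (elP B u))"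

definition strong_connection where
  "strong_connection B Pr \<longleftrightarrow> connection B Pr \<and> (\<forall>u. covP B Pr u \<in> Omega1_M_P B)"


section \<open>Associated bundles, covariant derivatives and frame resolutions\<close>

definition left_comodule where
  "left_comodule B \<longleftrightarrow> vector_space (scaleV B) \<and>
     Vector_Spaces.linear (scaleV B) tscale (coact B) \<and>
     (\<forall>v. coact B v \<in> tens_set B (spC B) (spV B)) \<and>
     (\<forall>v. at_slot B 0 (on_C (comult B)) (coact B v) = at_slot B 1 (on_V (coact B)) (coact B v)) \<and>
     (\<forall>v. at_slot B 0 (on_C (\<lambda>c. tscale (counit B c) (pure B []))) (coact B v) = elV B v)"

definition Hom0 where
  "Hom0 B n = {\<phi>. Vector_Spaces.linear (scaleV B) tscale \<phi> \<and>
     (\<forall>v. \<phi> v \<in> P_Omega_M B n) \<and>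
     (\<forall>v. psi_pow B (Suc n) (at_slot B 1 (on_V \<phi>) (coact B v)) =
        \<phi> v \<otimes>\<^sub>k\<^bsub>B\<^esub> elC B (grouplike B))}"

definition Dbar where
  "Dbar B \<omega> \<phi> v = dif B (\<phi> v) +
     lin_ext (\<lambda>w. case w of [LC c, LV x] \<Rightarrow> \<omega> c \<star>\<^bsub>B\<^esub> \<phi> x | _ \<Rightarrow> 0) (coact B v)"

definition assoc_bundle where
  "assoc_bundle B = {t \<in> tens_set B (spP B) (spV B).
     at_slot B 0 (on_P (coactP B)) t = at_slot B 1 (on_V (coact B)) t}"

text \<open>
  \<open>contract B \<theta>\<close> is \<open>w \<otimes> v \<mapsto> w\<theta>(v)\<close>.  On \<open>P \<box>\<^sub>C V\<close> it is \<open>s\<^sub>\<theta>\<close>, and on \<open>(\<Omega>\<^sup>1M)P \<box>\<^sub>C V\<close> it is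
  \<open>id \<otimes> s\<^sub>\<theta>\<close>.
\<close>

definition contract where
  "contract B \<theta> t = lin_ext (\<lambda>w. case rev w of LV v # r \<Rightarrow> pure B (rev r) \<star>\<^bsub>B\<^esub> \<theta> v | _ \<Rightarrow> 0) t"

definition frame_resolution where
  "frame_resolution B \<theta> \<longleftrightarrow> copointed_coalgebra_bundle B \<and> psi_bijective B \<and> left_comodule B \<and>
     \<theta> \<in> Hom0 B 1 \<and>
     bij_betw (contract B \<theta>) (assoc_bundle B) (Omega_M B 1) \<and>
     (\<forall>x\<in>assoc_bundle B. \<forall>y\<in>assoc_bundle B.
        contract B \<theta> (x + y) = contract B \<theta> x + contract B \<theta> y) \<and>
     (\<forall>m\<in>base_alg B. \<forall>x\<in>assoc_bundle B.
        contract B \<theta> (elP B m \<star>\<^bsub>B\<^esub> x) = elP B m \<star>\<^bsub>B\<^esub> contract B \<theta> x)"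

definition nabla where
  "nabla B Pr \<theta> x =
     contract B \<theta> (at_slot B 0 (on_P (covP B Pr)) (inv_into (assoc_bundle B) (contract B \<theta>) x))"

definition torsion where
  "torsion B Pr \<theta> x = dif B x - nabla B Pr \<theta> x"


section \<open>Flatness\<close>

text \<open>
  For a unital subring \<open>M\<close> of \<open>P\<close> and a left \<open>M\<close>-module \<open>N\<close>, the group \<open>P \<otimes>\<^sub>M N\<close> is the quotient of
  the free abelian group on \<open>P \<times> N\<close> by the subgroup \<open>balanced M N\<close>.
\<close>

definition left_module :: "'p::{ring,monoid_mult} set \<Rightarrow> ('p, 'n) module \<Rightarrow> bool" where
  "left_module M N \<longleftrightarrow> abelian_group N \<and>
     (\<forall>m\<in>M. \<forall>x\<in>carrier N. m \<odot>\<^bsub>N\<^esub> x \<in> carrier N) \<and>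
     (\<forall>m\<in>M. \<forall>x\<in>carrier N. \<forall>y\<in>carrier N. m \<odot>\<^bsub>N\<^esub> (x \<oplus>\<^bsub>N\<^esub> y) = m \<odot>\<^bsub>N\<^esub> x \<oplus>\<^bsub>N\<^esub> m \<odot>\<^bsub>N\<^esub> y) \<and>
     (\<forall>m\<in>M. \<forall>l\<in>M. \<forall>x\<in>carrier N. (m + l) \<odot>\<^bsub>N\<^esub> x = m \<odot>\<^bsub>N\<^esub> x \<oplus>\<^bsub>N\<^esub> l \<odot>\<^bsub>N\<^esub> x) \<and>
     (\<forall>m\<in>M. \<forall>l\<in>M. \<forall>x\<in>carrier N. (m * l) \<odot>\<^bsub>N\<^esub> x = m \<odot>\<^bsub>N\<^esub> (l \<odot>\<^bsub>N\<^esub> x)) \<and>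
     (\<forall>x\<in>carrier N. 1 \<odot>\<^bsub>N\<^esub> x = x)"

definition left_module_hom ::
  "'p::{ring,monoid_mult} set \<Rightarrow> ('p, 'n) module \<Rightarrow> ('p, 'n) module \<Rightarrow> ('n \<Rightarrow> 'n) \<Rightarrow> bool" where
  "left_module_hom M N N' f \<longleftrightarrow> f \<in> carrier N \<rightarrow> carrier N' \<and>
     (\<forall>x\<in>carrier N. \<forall>y\<in>carrier N. f (x \<oplus>\<^bsub>N\<^esub> y) = f x \<oplus>\<^bsub>N'\<^esub> f y) \<and>
     (\<forall>m\<in>M. \<forall>x\<in>carrier N. f (m \<odot>\<^bsub>N\<^esub> x) = m \<odot>\<^bsub>N'\<^esub> f x)"

inductive_set balanced ::
  "'p::{ring,monoid_mult} set \<Rightarrow> ('p, 'n) module \<Rightarrow> ('p \<times> 'n \<Rightarrow>\<^sub>0 int) set" for M N where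
  zero: "0 \<in> balanced M N"
| diff: "s \<in> balanced M N \<Longrightarrow> t \<in> balanced M N \<Longrightarrow> s - t \<in> balanced M N"
| add_left: "x \<in> carrier N \<Longrightarrow>
    Poly_Mapping.single (p + q, x) 1 - Poly_Mapping.single (p, x) 1 - Poly_Mapping.single (q, x) 1
      \<in> balanced M N"
| add_right: "x \<in> carrier N \<Longrightarrow> y \<in> carrier N \<Longrightarrow>
    Poly_Mapping.single (p, x \<oplus>\<^bsub>N\<^esub> y) 1 - Poly_Mapping.single (p, x) 1 - Poly_Mapping.single (p, y) 1
      \<in> balanced M N"
| middle: "m \<in> M \<Longrightarrow> x \<in> carrier N \<Longrightarrow>
    Poly_Mapping.single (p * m, x) 1 - Poly_Mapping.single (p, m \<odot>\<^bsub>N\<^esub> x) 1 \<in> balanced M N"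

text \<open>
  \<open>P\<close> is flat as a right \<open>M\<close>-module iff \<open>P \<otimes>\<^sub>M N \<rightarrow> P \<otimes>\<^sub>M N'\<close> is injective for every injective
  homomorphism \<open>N \<rightarrow> N'\<close> of left \<open>M\<close>-modules.  HOL cannot quantify over types here, so the modules
  have carriers of elements of type \<open>(nat \<Rightarrow> 'p) set\<close>.  This is no restriction: flatness can be
  tested on finitely generated modules, each of which is isomorphic to a quotient of some
  \<open>M\<^sup>n\<close>, whose elements are cosets, that is, subsets of \<open>nat \<Rightarrow> 'p\<close>.
\<close>

definition flat_right :: "'p::{ring,monoid_mult} set \<Rightarrow> bool" where
  "flat_right M \<longleftrightarrow>
     (\<forall>(N :: ('p, (nat \<Rightarrow> 'p) set) module) N' f.
        left_module M N \<and> left_module M N' \<and> left_module_hom M N N' f \<and> inj_on f (carrier N) \<longrightarrow>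
        (\<forall>t. Poly_Mapping.keys t \<subseteq> UNIV \<times> carrier N \<and>
             (\<Sum>(p, x)\<in>Poly_Mapping.keys t. Poly_Mapping.single (p, f x) (Poly_Mapping.lookup t (p, x))) \<in> balanced M N'
             \<longrightarrow> t \<in> balanced M N))"

end

theory Submission
  imports Defs
begin

text \<open>
  Sweedler notation is used throughout: \<open>u\<^sub>0 \<otimes> u\<^sub>1\<close> for the coaction of \<open>u \<in> P\<close>, \<open>v\<^sub>1 \<otimes> v\<^sub>\<infinity>\<close> for that of
  \<open>v \<in> V\<close>, and \<open>p\<^sub>1 \<otimes> p\<^sub>\<infinity> = \<psi>\<^sup>-\<^sup>1(p \<otimes> e)\<close> for the left coaction on \<open>P\<close> that a bijective \<open>\<psi>\<close> induces.

  Membership of \<open>dp + \<omega>(p\<^sub>1) p\<^sub>\<infinity>\<close> in \<open>P(\<Omega>\<^sup>1M)\<close> is the heart of the matter (\<open>dif_plus_form\<close>).  In terms of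
  \<open>lift(c) = \<omega>(c) + \<epsilon>(c) 1 \<otimes> 1\<close> it says that \<open>lift(p\<^sub>1) p\<^sub>\<infinity>\<close> lies in \<open>P \<otimes> M\<close>, whereas strongness says
  that \<open>u\<^sub>0 lift(u\<^sub>1)\<close> lies in \<open>M \<otimes> P\<close>.  To pass from one to the other, the factor \<open>u\<^sub>0\<close> is cancelled from the
  invariance of \<open>u\<^sub>0 lift(u\<^sub>1)\<close>, which is possible because \<open>lift\<close> lifts \<open>c \<mapsto> 1 \<otimes> c\<close> through the canonical
  map (\<open>comult_lift_left\<close>).  Together with the equivariance of \<open>\<omega>\<close> this shows that the coaction on the second
  factor of \<open>lift(c)\<close> is \<open>lift(c\<^sub>1) \<otimes> c\<^sub>2\<close> (\<open>lift_coaction_right\<close>), and then coassociativity of the left coaction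
  makes the last factor of \<open>lift(p\<^sub>1) p\<^sub>\<infinity>\<close> invariant.  Over a field an invariant factor lies in \<open>M\<close>
  (\<open>invariant_right_factor\<close>).

  For \<open>\<phi> \<in> Hom\<^sub>0(V, P\<Omega>\<^sup>nM)\<close> write \<open>\<phi>(v) = \<Sum> p x\<close> with \<open>x \<in> \<Omega>\<^sup>nM\<close>.  Equivariance of \<open>\<phi>\<close> and injectivity of
  \<open>\<psi>\<close> give \<open>v\<^sub>1 \<otimes> \<phi>(v\<^sub>\<infinity>) = \<Sum> p\<^sub>1 \<otimes> p\<^sub>\<infinity> x\<close>, because \<open>e\<close> passes through elements of \<open>M\<close>.  Hence the covariant
  derivative of \<open>\<phi>\<close> at \<open>v\<close> is \<open>\<Sum> (dp + \<omega>(p\<^sub>1) p\<^sub>\<infinity>) x + p dx\<close>, a form in \<open>P(\<Omega>\<^sup>n\<^sup>+\<^sup>1M)\<close> (\<open>transport\<close>, \<open>Dbar_mem\<close>).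
  It is equivariant because \<open>\<psi>\<close> respects units, hence the differential, and products, hence \<open>\<omega>(v\<^sub>1) \<phi>(v\<^sub>\<infinity>)\<close>
  (\<open>Dbar_Hom0\<close>).

  For the torsion, \<open>d(u \<theta>(v)) - Du \<theta>(v) = u d\<theta>(v) + u\<^sub>0 \<omega>(u\<^sub>1) \<theta>(v)\<close>, and on the cotensor product
  \<open>u\<^sub>0 \<otimes> u\<^sub>1 \<otimes> v\<close> may be replaced by \<open>u \<otimes> v\<^sub>1 \<otimes> v\<^sub>\<infinity>\<close>; the result is \<open>u\<close> times the covariant derivative of \<open>\<theta>\<close> at \<open>v\<close>
  (\<open>torsion_formula\<close>).  It lies in \<open>P \<otimes> M \<otimes> M\<close> by the first part and in \<open>M \<otimes> P \<otimes> M\<close> by strongness, hence in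
  \<open>\<Omega>\<^sup>2M\<close> (\<open>torsion_form_mem\<close>).

  Every map involved is a composite of operators that act on a few adjacent factors of a tensor.  Operators on
  disjoint factors commute up to a shift of position (\<open>loc_commute\<close>), so that the arguments above become
  rewriting with the axioms, each of them valid at every position.
\<close>


section \<open>Linear maps between spaces of tensors\<close>

abbreviation linT :: "(('a \<Rightarrow>\<^sub>0 'k::field) \<Rightarrow> ('b \<Rightarrow>\<^sub>0 'k)) \<Rightarrow> bool" where
  "linT \<equiv> Vector_Spaces.linear tscale tscale"

lemma tscale_vector_space: "vector_space (tscale :: 'k::field \<Rightarrow> ('a \<Rightarrow>\<^sub>0 'k) \<Rightarrow> _)"
  by unfold_locales

lemma
  assumes "Vector_Spaces.linear s t f"
  shows linear_addD: "f (x + y) = f x + f y"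
    and linear_scaleD: "f (s a x) = t a (f x)"
    and linear_zeroD: "f 0 = 0"
    and linear_diffD: "f (x - y) = f x - f y"
    and linear_sumD: "f (sum g S) = (\<Sum>i\<in>S. f (g i))"
proof -
  interpret Vector_Spaces.linear s t f by fact
  show "f (x + y) = f x + f y" "f (s a x) = t a (f x)" "f 0 = 0" "f (x - y) = f x - f y"
    "f (sum g S) = (\<Sum>i\<in>S. f (g i))"
    by (simp_all add: add scale zero diff sum)
qed

lemma linear_tscaleI:
  assumes "vector_space s"
    and "\<And>x y. f (x + y) = f x + f y" and "\<And>a x. f (s a x) = tscale a (f x)"
  shows "Vector_Spaces.linear s tscale f"
  using assms tscale_vector_space by (auto simp: Vector_Spaces.linear_iff)

lemma linear_source: "Vector_Spaces.linear s t f \<Longrightarrow> vector_space s"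
  by (simp add: Vector_Spaces.linear_iff)

lemma linear_eq_on_span:
  assumes "linT f" "linT g" "\<And>y. y \<in> S \<Longrightarrow> f y = g y" "x \<in> tspan S"
  shows "f x = g x"
  using assms(4)
  by (induction rule: tvec.span_induct_alt)
    (simp_all add: assms(3) linear_zeroD[OF assms(1)] linear_zeroD[OF assms(2)]
      linear_addD[OF assms(1)] linear_addD[OF assms(2)] linear_scaleD[OF assms(1)] linear_scaleD[OF assms(2)])

lemma linear_span_into:
  assumes "linT f" "\<And>y. y \<in> S \<Longrightarrow> f y \<in> tspan S'" "x \<in> tspan S"
  shows "f x \<in> tspan S'"
  using assms(3)
  by (induction rule: tvec.span_induct_alt)
    (simp_all add: assms(2) linear_zeroD[OF assms(1)] linear_addD[OF assms(1)] linear_scaleD[OF assms(1)]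
      tvec.span_zero tvec.span_add tvec.span_scale)

lemma in_span_words: "(x :: 'a \<Rightarrow>\<^sub>0 'k::field) \<in> tspan (range (\<lambda>w. Poly_Mapping.single w 1))"
proof -
  have "x = (\<Sum>w\<in>Poly_Mapping.keys x. tscale (Poly_Mapping.lookup x w) (Poly_Mapping.single w 1))"
    by (rule poly_mapping_eqI)
      (simp add: lookup_sum lookup_single when_def if_distrib[of "\<lambda>c. _ * c"] in_keys_iff cong: if_cong)
  also have "\<dots> \<in> tspan (range (\<lambda>w. Poly_Mapping.single w 1))"
    by (intro tvec.span_sum tvec.span_scale tvec.span_base) auto
  finally show ?thesis .
qed

lemma linear_eq_on_words:
  assumes "linT f" "linT g" "\<And>w. f (Poly_Mapping.single w 1) = g (Poly_Mapping.single w 1)"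
  shows "f x = g x"
  by (rule linear_eq_on_span[OF assms(1,2) _ in_span_words]) (auto simp: assms(3))

lemma lin_ext_superset:
  assumes "finite S" "Poly_Mapping.keys x \<subseteq> S"
  shows "lin_ext F x = (\<Sum>w\<in>S. tscale (Poly_Mapping.lookup x w) (F w))"
  unfolding lin_ext_def
  by (rule sum.mono_neutral_left) (use assms in \<open>auto simp: in_keys_iff\<close>)

lemma linear_lin_ext: "linT (lin_ext F)"
proof (rule linear_tscaleI[OF tscale_vector_space])
  show "lin_ext F (x + y) = lin_ext F x + lin_ext F y" for x y
  proof -
    let ?S = "Poly_Mapping.keys x \<union> Poly_Mapping.keys y"
    have "Poly_Mapping.keys (x + y) \<subseteq> ?S" by (rule Poly_Mapping.keys_add)
    then show ?thesis
      by (simp add: lin_ext_superset[of ?S] lookup_add tvec.scale_left_distrib sum.distrib)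
  qed
  show "lin_ext F (tscale a x) = tscale a (lin_ext F x)" for a x
  proof -
    have "Poly_Mapping.keys (tscale a x) \<subseteq> Poly_Mapping.keys x" by (auto simp: in_keys_iff)
    then show ?thesis
      by (simp add: lin_ext_superset[of "Poly_Mapping.keys x"] tvec.scale_sum_right)
  qed
qed

lemma lin_ext_word [simp]: "lin_ext F (Poly_Mapping.single w 1) = F w"
  by (simp add: lin_ext_def)

lemmas lin_ext_linear_rules =
  linear_addD[OF linear_lin_ext] linear_scaleD[OF linear_lin_ext] linear_zeroD[OF linear_lin_ext]
  linear_diffD[OF linear_lin_ext] linear_sumD[OF linear_lin_ext]

lemma lin_ext_eqI: "(\<And>w. F w = G w) \<Longrightarrow> lin_ext F x = lin_ext G x"
  by (rule linear_eq_on_words[OF linear_lin_ext linear_lin_ext]) simp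

lemma linear_comp:
  assumes "Vector_Spaces.linear s t f" "Vector_Spaces.linear t r g"
  shows "Vector_Spaces.linear s r (\<lambda>x. g (f x))"
  using assms by (auto simp: Vector_Spaces.linear_iff)

lemma linear_id: "vector_space s \<Longrightarrow> Vector_Spaces.linear s s (\<lambda>x. x)"
  by (auto simp: Vector_Spaces.linear_iff)

lemma linear_const_zero: "vector_space s \<Longrightarrow> Vector_Spaces.linear s tscale (\<lambda>x. 0)"
  by (auto intro: linear_tscaleI)

lemma linear_plus:
  "Vector_Spaces.linear s tscale f \<Longrightarrow> Vector_Spaces.linear s tscale g
    \<Longrightarrow> Vector_Spaces.linear s tscale (\<lambda>x. f x + g x)"
  by (auto simp: Vector_Spaces.linear_iff tvec.scale_right_distrib)

lemma linear_minus:
  "Vector_Spaces.linear s tscale f \<Longrightarrow> Vector_Spaces.linear s tscale g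
    \<Longrightarrow> Vector_Spaces.linear s tscale (\<lambda>x. f x - g x)"
  by (auto simp: Vector_Spaces.linear_iff tvec.scale_right_diff_distrib)

lemma linear_scaled:
  "Vector_Spaces.linear s tscale f \<Longrightarrow> Vector_Spaces.linear s tscale (\<lambda>x. tscale a (f x))"
  by (auto simp: Vector_Spaces.linear_iff tvec.scale_right_distrib mult.commute)

lemma linear_sum:
  assumes "vector_space s" "\<And>i. i \<in> I \<Longrightarrow> Vector_Spaces.linear s tscale (f i)"
  shows "Vector_Spaces.linear s tscale (\<lambda>x. \<Sum>i\<in>I. f i x)"
  by (rule linear_tscaleI[OF assms(1)])
    (simp_all add: sum.distrib linear_addD[OF assms(2)] linear_scaleD[OF assms(2)] tvec.scale_sum_right)

lemma linear_lin_ext_comp: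
  "Vector_Spaces.linear s tscale f \<Longrightarrow> Vector_Spaces.linear s tscale (\<lambda>x. lin_ext F (f x))"
  by (rule linear_comp[OF _ linear_lin_ext])

lemma linear_lin_ext_param:
  assumes "vector_space s" "\<And>w. Vector_Spaces.linear s tscale (\<lambda>x. F x w)"
  shows "Vector_Spaces.linear s tscale (\<lambda>x. lin_ext (F x) y)"
  unfolding lin_ext_def by (intro linear_sum linear_scaled assms)

text \<open>
  Bijectivity of a structure map cannot be applied to some factors of a longer tensor, but
  a linear left inverse can. Over a field every linear map that is injective on a subspace
  has one.
\<close>

lemma left_inverse_on:
  assumes "Vector_Spaces.linear s t f" "module.subspace s S"
    and "\<And>x. x \<in> S \<Longrightarrow> f x = 0 \<Longrightarrow> x = 0"
  obtains g where "Vector_Spaces.linear t s g" "\<And>y. g y \<in> S" "\<And>x. x \<in> S \<Longrightarrow> g (f x) = x"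
proof -
  interpret l: Vector_Spaces.linear s t f by fact
  interpret vector_space_pair s t by unfold_locales
  have "inj_on f S"
  proof (rule inj_onI)
    fix x y assume "x \<in> S" "y \<in> S" "f x = f y"
    then have "x - y \<in> S" "f (x - y) = 0"
      using assms(2) by (auto simp: l.diff l.vs1.subspace_diff)
    then show "x = y" using assms(3) by fastforce
  qed
  with linear_exists_left_inverse_on[OF assms(1,2)] that show ?thesis by blast
qed

section \<open>Multilinear prescriptions\<close>

text \<open>
  One relation between letters covers additivity and homogeneity in all three kinds of letters.
\<close>

inductive letter_comb ::
  "('k::field, 'p::ab_group_add, 'c::ab_group_add, 'v::ab_group_add) bundle_data
   \<Rightarrow> 'k \<Rightarrow> ('p, 'c, 'v) letter \<Rightarrow> ('p, 'c, 'v) letter \<Rightarrow> ('p, 'c, 'v) letter \<Rightarrow> bool"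
  for B where
  "letter_comb B a (LP p) (LP q) (LP (scaleP B a p + q))"
| "letter_comb B a (LC c) (LC d) (LC (scaleC B a c + d))"
| "letter_comb B a (LV x) (LV y) (LV (scaleV B a x + y))"

text \<open>
  The length \<open>n\<close> is a parameter because an operator on \<open>k\<close> adjacent factors is only
  evaluated on words of length \<open>k\<close>. A prescription on all words descends to tensors if it is
  multilinear for every \<open>n\<close>.
\<close>

definition multilinear ::
  "('k::field, 'p::ab_group_add, 'c::ab_group_add, 'v::ab_group_add) bundle_data
   \<Rightarrow> nat \<Rightarrow> (('p, 'c, 'v) letter list \<Rightarrow> ('b \<Rightarrow>\<^sub>0 'k)) \<Rightarrow> bool" where
  "multilinear B n F \<longleftrightarrow> (\<forall>u w a l l' l''. length u + Suc (length w) = n \<longrightarrow> letter_comb B a l l' l'' \<longrightarrow>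
     F (u @ l'' # w) = tscale a (F (u @ l # w)) + F (u @ l' # w))"

lemma multilinearI:
  assumes "\<And>u w a l l' l''. length u + Suc (length w) = n \<Longrightarrow> letter_comb B a l l' l'' \<Longrightarrow>
     F (u @ l'' # w) = tscale a (F (u @ l # w)) + F (u @ l' # w)"
  shows "multilinear B n F"
  using assms by (auto simp: multilinear_def)

lemma multilinearD:
  "multilinear B n F \<Longrightarrow> length u + Suc (length w) = n \<Longrightarrow> letter_comb B a l l' l'' \<Longrightarrow>
     F (u @ l'' # w) = tscale a (F (u @ l # w)) + F (u @ l' # w)"
  by (auto simp: multilinear_def)

lemma multilinear_comp:
  assumes "multilinear B n F" "linT G"
  shows "multilinear B n (\<lambda>w. G (F w))"
  by (rule multilinearI)
    (simp add: multilinearD[OF assms(1)] linear_addD[OF assms(2)] linear_scaleD[OF assms(2)])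

lemma multilinear_lin_ext_param:
  fixes F :: "('b::ab_group_add, 'c::ab_group_add, 'd::ab_group_add) letter list \<Rightarrow> _"
  assumes "\<And>w. multilinear B n (\<lambda>u. F u w)"
  shows "multilinear B n (\<lambda>u. lin_ext (F u) y)"
proof (rule multilinearI)
  fix u w :: "('b, 'c, 'd) letter list" and a l l' l''
  assume l: "length u + Suc (length w) = n" "letter_comb B a l l' l''"
  show "lin_ext (F (u @ l'' # w)) y = tscale a (lin_ext (F (u @ l # w)) y) + lin_ext (F (u @ l' # w)) y"
    unfolding lin_ext_def multilinearD[OF assms l]
    by (simp add: tvec.scale_right_distrib sum.distrib tvec.scale_sum_right mult.commute)
qed

locale tensor_calculus =
  fixes B :: "('k::field, 'p::{ring,monoid_mult}, 'c::ab_group_add, 'v::ab_group_add) bundle_data"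
    (structure)
  assumes vsP: "vector_space (scaleP B)"
    and vsC: "vector_space (scaleC B)"
    and vsV: "vector_space (scaleV B)"
begin

lemma lin_ext_cls:
  fixes F :: "('p, 'c, 'v) letter list \<Rightarrow> ('b \<Rightarrow>\<^sub>0 'k)"
  assumes F: "\<And>n. multilinear B n F"
  shows "lin_ext F (cls B x) = lin_ext F x"
proof -
  interpret sP: vector_space "scaleP B" by (rule vsP)
  interpret sC: vector_space "scaleC B" by (rule vsC)
  interpret sV: vector_space "scaleV B" by (rule vsV)
  have comb: "F (u @ l'' # w) = tscale a (F (u @ l # w)) + F (u @ l' # w)"
    if "letter_comb B a l l' l''" for u w a l l' l''
    using multilinearD[OF F refl that] .
  have zero: "F (u @ LP 0 # w) = 0" "F (u @ LC 0 # w) = 0" "F (u @ LV 0 # w) = 0" for u w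
    using comb[OF letter_comb.intros(1)[of B 1 0 0], of u w]
      comb[OF letter_comb.intros(2)[of B 1 0 0], of u w]
      comb[OF letter_comb.intros(3)[of B 1 0 0], of u w] by simp_all
  have "lin_ext F r = 0" if "r \<in> multilinear_rels B" for r
    using that
  proof cases
    case (addP u p q w)
    then show ?thesis
      using comb[OF letter_comb.intros(1)[of B 1 p q], of u w] by (simp add: lin_ext_linear_rules)
  next
    case (addC u p q w)
    then show ?thesis
      using comb[OF letter_comb.intros(2)[of B 1 p q], of u w] by (simp add: lin_ext_linear_rules)
  next
    case (addV u p q w)
    then show ?thesis
      using comb[OF letter_comb.intros(3)[of B 1 p q], of u w] by (simp add: lin_ext_linear_rules)
  next
    case (scaleP u a p w)
    then show ?thesis
      using comb[OF letter_comb.intros(1)[of B a p 0], of u w] by (simp add: lin_ext_linear_rules zero)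
  next
    case (scaleC u a p w)
    then show ?thesis
      using comb[OF letter_comb.intros(2)[of B a p 0], of u w] by (simp add: lin_ext_linear_rules zero)
  next
    case (scaleV u a p w)
    then show ?thesis
      using comb[OF letter_comb.intros(3)[of B a p 0], of u w] by (simp add: lin_ext_linear_rules zero)
  qed
  then have *: "lin_ext F y = 0" if "y \<in> tspan (multilinear_rels B)" for y
    using linear_eq_on_span[OF linear_lin_ext linear_const_zero[OF tscale_vector_space] _ that] by blast
  have "cls B (cls B x) = cls B x"
    using is_quotient_map_cls[of B] unfolding is_quotient_map_def by blast
  then have "cls B x - x \<in> tspan (multilinear_rels B)"
    by (simp add: cls_eq_iff)
  from *[OF this] show ?thesis by (simp add: lin_ext_linear_rules)
qed

lemma cls_cls [simp]: "cls B (cls B x) = cls B x"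
  using is_quotient_map_cls[of B] unfolding is_quotient_map_def by blast

lemma lin_ext_pure: "(\<And>n. multilinear B n F) \<Longrightarrow> lin_ext F (pure B w) = F w"
  by (simp add: pure_def lin_ext_cls)

lemma lin_ext_pure_cls: "lin_ext (pure B) x = cls B x"
  by (rule linear_eq_on_words[OF linear_lin_ext linear_cls]) (simp add: pure_def)

lemma multilinear_pure: "multilinear B n (pure B)"
proof (rule multilinearI)
  fix u w :: "('p, 'c, 'v) letter list" and a l l' l''
  assume "letter_comb B a l l' l''"
  then have "word (u @ l'' # w) - (tscale a (word (u @ l # w)) + word (u @ l' # w))
      \<in> tspan (multilinear_rels B)"
  proof cases
    case (1 p q)
    have "word (u @ LP (scaleP B a p + q) # w) - word (u @ LP (scaleP B a p) # w) - word (u @ LP q # w)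
        + (word (u @ LP (scaleP B a p) # w) - tscale a (word (u @ LP p # w))) \<in> tspan (multilinear_rels B)"
      by (intro tvec.span_add tvec.span_base multilinear_rels.intros)
    then show ?thesis by (simp add: 1 algebra_simps)
  next
    case (2 p q)
    have "word (u @ LC (scaleC B a p + q) # w) - word (u @ LC (scaleC B a p) # w) - word (u @ LC q # w)
        + (word (u @ LC (scaleC B a p) # w) - tscale a (word (u @ LC p # w))) \<in> tspan (multilinear_rels B)"
      by (intro tvec.span_add tvec.span_base multilinear_rels.intros)
    then show ?thesis by (simp add: 2 algebra_simps)
  next
    case (3 p q)
    have "word (u @ LV (scaleV B a p + q) # w) - word (u @ LV (scaleV B a p) # w) - word (u @ LV q # w)
        + (word (u @ LV (scaleV B a p) # w) - tscale a (word (u @ LV p # w))) \<in> tspan (multilinear_rels B)"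
      by (intro tvec.span_add tvec.span_base multilinear_rels.intros)
    then show ?thesis by (simp add: 3 algebra_simps)
  qed
  then show "pure B (u @ l'' # w) = tscale a (pure B (u @ l # w)) + pure B (u @ l' # w)"
    unfolding cls_eq_iff[symmetric] pure_def
    by (simp add: linear_addD[OF linear_cls] linear_scaleD[OF linear_cls])
qed

lemma multilinear_pure_append: "multilinear B n (\<lambda>w. pure B (u @ w @ v))"
proof (rule multilinearI)
  fix x y :: "('p, 'c, 'v) letter list" and a l l' l''
  assume "letter_comb B a l l' l''"
  from multilinearD[OF multilinear_pure refl this, of "u @ x" "y @ v"]
  show "pure B (u @ (x @ l'' # y) @ v) = tscale a (pure B (u @ (x @ l # y) @ v)) + pure B (u @ (x @ l' # y) @ v)"
    by simp
qed

lemma linear_elP: "Vector_Spaces.linear (scaleP B) tscale (elP B)"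
proof (rule linear_tscaleI[OF vsP])
  interpret sP: vector_space "scaleP B" by (rule vsP)
  have *: "elP B (scaleP B a p + q) = tscale a (elP B p) + elP B q" for a p q
    using multilinearD[OF multilinear_pure refl letter_comb.intros(1)[of B a p q], of "[]" "[]"] by simp
  show add: "elP B (x + y) = elP B x + elP B y" for x y
    using *[of 1 x y] by simp
  have "elP B 0 = 0" using add[of 0 0] by simp
  then show "elP B (scaleP B a x) = tscale a (elP B x)" for a x
    using *[of a x 0] by simp
qed

section \<open>The tensor product\<close>

lemma linear_tens_left:
  "Vector_Spaces.linear s tscale f \<Longrightarrow> Vector_Spaces.linear s tscale (\<lambda>x. f x \<otimes>\<^sub>k y)"
  unfolding tens_def by (rule linear_lin_ext_comp)

lemma linear_tens_right:
  "Vector_Spaces.linear s tscale f \<Longrightarrow> Vector_Spaces.linear s tscale (\<lambda>x. y \<otimes>\<^sub>k f x)"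
  unfolding tens_def
  by (rule linear_lin_ext_param[OF linear_source linear_lin_ext_comp]) auto

lemma tens_words: "word u \<otimes>\<^sub>k word w = pure B (u @ w)"
  by (simp add: tens_def)

lemma tens_pure_word: "pure B u \<otimes>\<^sub>k word w = pure B (u @ w)"
  unfolding tens_def using multilinear_pure_append[of _ "[]" w]
  by (subst lin_ext_pure) simp_all

lemma multilinear_tens_left: "multilinear B n (\<lambda>u. lin_ext (\<lambda>w. pure B (u @ w)) y)"
proof (rule multilinear_lin_ext_param)
  show "multilinear B n (\<lambda>u. pure B (u @ w))" for w
    using multilinear_pure_append[of n "[]" w] by simp
qed

lemma tens_cls_right: "x \<otimes>\<^sub>k cls B y = x \<otimes>\<^sub>k y"
proof -
  have "linT (\<lambda>x. x \<otimes>\<^sub>k cls B y)" "linT (\<lambda>x. x \<otimes>\<^sub>k y)"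
    by (intro linear_tens_left linear_id tscale_vector_space)+
  moreover have "word u \<otimes>\<^sub>k cls B y = word u \<otimes>\<^sub>k y" for u
    unfolding tens_def
    using multilinear_pure_append[of _ u "[]"] by (simp add: lin_ext_cls)
  ultimately show ?thesis by (rule linear_eq_on_words)
qed

lemma tens_pure [simp]: "pure B u \<otimes>\<^sub>k pure B w = pure B (u @ w)"
  by (metis pure_def tens_cls_right tens_pure_word)

lemma tens_assoc: "(x \<otimes>\<^sub>k y) \<otimes>\<^sub>k z = x \<otimes>\<^sub>k (y \<otimes>\<^sub>k z)"
proof -
  have "(word u \<otimes>\<^sub>k word v) \<otimes>\<^sub>k word w = word u \<otimes>\<^sub>k (word v \<otimes>\<^sub>k word w)" for u v w
    unfolding tens_words tens_pure_word
    by (metis append_assoc pure_def tens_cls_right tens_words)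
  then have "(word u \<otimes>\<^sub>k word v) \<otimes>\<^sub>k z = word u \<otimes>\<^sub>k (word v \<otimes>\<^sub>k z)" for u v
    by - (rule linear_eq_on_words; (intro linear_tens_right linear_id tscale_vector_space)?)
  then have "(word u \<otimes>\<^sub>k y) \<otimes>\<^sub>k z = word u \<otimes>\<^sub>k (y \<otimes>\<^sub>k z)" for u
    by - (rule linear_eq_on_words; (intro linear_tens_right linear_tens_left linear_id tscale_vector_space)?)
  then show ?thesis
    by - (rule linear_eq_on_words; (intro linear_tens_left linear_id tscale_vector_space)?)
qed

lemma pure_Nil_tens: "pure B [] \<otimes>\<^sub>k x = cls B x"
  unfolding tens_def
  by (subst lin_ext_pure[OF multilinear_tens_left]) (simp add: lin_ext_pure_cls)

section \<open>Shapes of tensors\<close>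

text \<open>
  A tensor has shape \<open>[L\<^sub>1, \<dots>, L\<^sub>n]\<close> if it is a combination of words with letters from
  these sets. With letter sets \<open>UNIV\<close> this is the degree, with the sets of all letters of
  one kind it is a tensor product such as \<open>P \<otimes> C\<close>, and with the letters of a subspace of
  \<open>P\<close> it is the corresponding subspace.
\<close>

definition shaped :: "('p, 'c, 'v) letter set list \<Rightarrow> ('k, 'p, 'c, 'v) tensor set" where
  "shaped Ls = tspan {pure B w | w. list_all2 (\<in>) w Ls}"

definition homog where "homog n = shaped (replicate n UNIV)"

lemma list_all2_UNIV [simp]: "list_all2 (\<in>) w (replicate n UNIV) \<longleftrightarrow> length w = n"
  by (auto simp: list_all2_conv_all_nth)

lemma pure_shaped: "list_all2 (\<in>) w Ls \<Longrightarrow> pure B w \<in> shaped Ls"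
  unfolding shaped_def by (rule tvec.span_base) blast

lemma pure_homog: "length w = n \<Longrightarrow> pure B w \<in> homog n"
  by (simp add: pure_shaped homog_def)

lemma shaped_zero [simp]: "0 \<in> shaped Ls"
  and shaped_add: "x \<in> shaped Ls \<Longrightarrow> y \<in> shaped Ls \<Longrightarrow> x + y \<in> shaped Ls"
  and shaped_diff: "x \<in> shaped Ls \<Longrightarrow> y \<in> shaped Ls \<Longrightarrow> x - y \<in> shaped Ls"
  and shaped_scale: "x \<in> shaped Ls \<Longrightarrow> tscale a x \<in> shaped Ls"
  and shaped_sum: "(\<And>i. i \<in> I \<Longrightarrow> h i \<in> shaped Ls) \<Longrightarrow> sum h I \<in> shaped Ls"
  unfolding shaped_def
  by (simp_all add: tvec.span_zero tvec.span_add tvec.span_diff tvec.span_scale tvec.span_sum)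

lemma homog_zero [simp]: "0 \<in> homog n"
  and homog_diff: "x \<in> homog n \<Longrightarrow> y \<in> homog n \<Longrightarrow> x - y \<in> homog n"
  and homog_scale: "x \<in> homog n \<Longrightarrow> tscale a x \<in> homog n"
  and homog_sum: "(\<And>i. i \<in> I \<Longrightarrow> h i \<in> homog n) \<Longrightarrow> sum h I \<in> homog n"
  unfolding homog_def by (simp_all add: shaped_add shaped_diff shaped_scale shaped_sum)

lemma shaped_eqI:
  assumes "linT f" "linT g" "x \<in> shaped Ls" "\<And>w. list_all2 (\<in>) w Ls \<Longrightarrow> f (pure B w) = g (pure B w)"
  shows "f x = g x"
  by (rule linear_eq_on_span[OF assms(1,2) _ assms(3)[unfolded shaped_def]]) (auto simp: assms(4))

lemma homog_eqI:
  assumes "linT f" "linT g" "x \<in> homog n" "\<And>w. length w = n \<Longrightarrow> f (pure B w) = g (pure B w)"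
  shows "f x = g x"
  by (rule shaped_eqI[OF assms(1,2) assms(3)[unfolded homog_def]]) (simp add: assms(4))

lemma shaped_into:
  assumes "linT f" "x \<in> shaped Ls" "\<And>w. list_all2 (\<in>) w Ls \<Longrightarrow> f (pure B w) \<in> tspan S"
  shows "f x \<in> tspan S"
  by (rule linear_span_into[OF assms(1) _ assms(2)[unfolded shaped_def]]) (auto simp: assms(3))

lemma shaped_mono: "x \<in> shaped Ls \<Longrightarrow> list_all2 (\<subseteq>) Ls Ls' \<Longrightarrow> x \<in> shaped Ls'"
  unfolding shaped_def
  by (erule set_mp[rotated], rule tvec.span_mono)
    (force simp: list_all2_conv_all_nth)

lemma shaped_homog: "x \<in> shaped Ls \<Longrightarrow> n = length Ls \<Longrightarrow> x \<in> homog n"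
  unfolding homog_def by (erule shaped_mono) (simp add: list_all2_conv_all_nth)

lemma cls_shaped: "x \<in> shaped Ls \<Longrightarrow> cls B x = x"
  by (rule shaped_eqI[OF linear_cls linear_id[OF tscale_vector_space]]) (auto simp: pure_def)

lemma cls_homog: "x \<in> homog n \<Longrightarrow> cls B x = x"
  unfolding homog_def by (rule cls_shaped)

lemma tens_shaped: "x \<in> shaped Ls \<Longrightarrow> y \<in> shaped Ls' \<Longrightarrow> x \<otimes>\<^sub>k y \<in> shaped (Ls @ Ls')"
  unfolding shaped_def[of "Ls @ Ls'"]
  by (rule shaped_into[where x = x], intro linear_tens_left linear_id tscale_vector_space, assumption,
      rule shaped_into[where x = y], intro linear_tens_right linear_id tscale_vector_space, assumption,
      rule tvec.span_base) (auto intro: list_all2_appendI)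

lemma tens_homog: "x \<in> homog n \<Longrightarrow> y \<in> homog m \<Longrightarrow> x \<otimes>\<^sub>k y \<in> homog (n + m)"
  using tens_shaped[of x "replicate n UNIV" y "replicate m UNIV"] by (simp add: replicate_add homog_def)

lemma tens_set_shaped:
  assumes "X = (\<lambda>l. pure B [l]) ` L" "Y = (\<lambda>l. pure B [l]) ` L'"
  shows "tens_set B X Y = shaped [L, L']"
  unfolding tens_set_def shaped_def assms
  by (rule arg_cong[of _ _ tspan]) (force simp: list_all2_Cons2)

lemma spP_letters: "spP B = (\<lambda>l. pure B [l]) ` range LP"
  and spC_letters: "spC B = (\<lambda>l. pure B [l]) ` range LC"
  and spV_letters: "spV B = (\<lambda>l. pure B [l]) ` range LV"
  by (auto simp: spP_def spC_def spV_def)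

section \<open>Operators on adjacent factors\<close>

lemmas linear_tens_left' = linear_tens_left[OF linear_id[OF tscale_vector_space]]
lemmas linear_tens_right' = linear_tens_right[OF linear_id[OF tscale_vector_space]]

lemmas tens_linear =
  linear_addD[OF linear_tens_left'] linear_diffD[OF linear_tens_left']
  linear_zeroD[OF linear_tens_left'] linear_scaleD[OF linear_tens_left'] linear_sumD[OF linear_tens_left']
  linear_addD[OF linear_tens_right'] linear_diffD[OF linear_tens_right']
  linear_zeroD[OF linear_tens_right'] linear_scaleD[OF linear_tens_right'] linear_sumD[OF linear_tens_right']

text \<open>
  The map \<open>id\<^sup>i \<otimes> f \<otimes> id\<close> for a multilinear \<open>f\<close> on words of length \<open>k\<close>. For \<open>k = 0\<close> it
  inserts a fixed tensor. The structure maps, the product of forms, the differential and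
  the contractions are all composed of such operators. The value \<open>0\<close> on words that are too
  short makes the exchange laws below hold on all tensors, so that they can be used as
  equations without typing the argument.
\<close>

definition loc_word :: "nat \<Rightarrow> nat \<Rightarrow> (('p, 'c, 'v) letter list \<Rightarrow> ('k, 'p, 'c, 'v) tensor)
    \<Rightarrow> ('p, 'c, 'v) letter list \<Rightarrow> ('k, 'p, 'c, 'v) tensor" where
  "loc_word i k f w = (if i + k \<le> length w
     then pure B (take i w) \<otimes>\<^sub>k f (take k (drop i w)) \<otimes>\<^sub>k pure B (drop (i + k) w) else 0)"

definition loc where "loc i k f t = lin_ext (loc_word i k f) t"

text \<open>
  The target degree \<open>m\<close> is recorded since it determines by how much later positions shift.
\<close>

definition operator where
  "operator k m f \<longleftrightarrow> multilinear B k f \<and> (\<forall>w. length w = k \<longrightarrow> f w \<in> homog m)"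

lemma loc_word_append:
  "length u = i \<Longrightarrow> length b = k \<Longrightarrow> loc_word i k f (u @ b @ r) = pure B u \<otimes>\<^sub>k f b \<otimes>\<^sub>k pure B r"
  by (simp add: loc_word_def)

lemma loc_word_short: "length w < i + k \<Longrightarrow> loc_word i k f w = 0"
  by (simp add: loc_word_def)

lemma word_split3:
  assumes "i + k \<le> length w"
  obtains u b r where "w = u @ b @ r" "length u = i" "length b = k"
proof
  show "w = take i w @ take k (drop i w) @ drop (i + k) w"
    by (metis add.commute append_take_drop_id drop_drop)
qed (use assms in auto)

lemma multilinear_loc_word:
  assumes f: "multilinear B k f"
  shows "multilinear B n (loc_word i k f)"
proof (rule multilinearI)
  fix x y :: "('p, 'c, 'v) letter list" and a l l' l''
  assume comb: "letter_comb B a l l' l''"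
  have lin: "(tscale a s + t) \<otimes>\<^sub>k z = tscale a (s \<otimes>\<^sub>k z) + t \<otimes>\<^sub>k z"
       "z \<otimes>\<^sub>k (tscale a s + t) = tscale a (z \<otimes>\<^sub>k s) + z \<otimes>\<^sub>k t" for s t z
    by (simp_all add: tens_linear)
  show "loc_word i k f (x @ l'' # y) = tscale a (loc_word i k f (x @ l # y)) + loc_word i k f (x @ l' # y)"
  proof (cases "i + k \<le> length (x @ l # y)")
    case False
    then show ?thesis by (simp add: loc_word_short)
  next
    case True
    consider "length x < i" | "i \<le> length x" "length x < i + k" | "i + k \<le> length x" by linarith
    then show ?thesis
    proof cases
      case 1
      then have "(i - Suc (length x)) + k \<le> length y" using True by simp
      then obtain u b r where y: "y = u @ b @ r" "length u = i - Suc (length x)" "length b = k"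
        by (rule word_split3)
      have "loc_word i k f ((x @ m # u) @ b @ r) = pure B (x @ m # u) \<otimes>\<^sub>k f b \<otimes>\<^sub>k pure B r" for m
        using y 1 by (intro loc_word_append) auto
      then show ?thesis
        using multilinearD[OF multilinear_pure refl comb, of x u] by (simp add: y(1) lin)
    next
      case 2
      define u v where "u = take i x" and "v = drop i x"
      have x: "x = u @ v" "length u = i" "length v = length x - i" using 2 by (auto simp: u_def v_def)
      have "i + k - Suc (length x) + 0 \<le> length y" using True by simp
      then obtain b r where y: "y = b @ r" "length b = i + k - Suc (length x)"
        by (metis add_0_right append_take_drop_id length_take min_absorb2)
      have "loc_word i k f (u @ (v @ m # b) @ r) = pure B u \<otimes>\<^sub>k f (v @ m # b) \<otimes>\<^sub>k pure B r" for m
        using x y 2 by (intro loc_word_append) auto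
      moreover have "length v + Suc (length b) = k" using x y 2 by simp
      ultimately show ?thesis
        using multilinearD[OF f _ comb, of v b] by (simp add: x(1) y(1) lin)
    next
      case 3
      then obtain u b r where x: "x = u @ b @ r" "length u = i" "length b = k"
        by (rule word_split3)
      have "loc_word i k f (u @ b @ (r @ m # y)) = pure B u \<otimes>\<^sub>k f b \<otimes>\<^sub>k pure B (r @ m # y)" for m
        using x by (intro loc_word_append) auto
      then show ?thesis
        using multilinearD[OF multilinear_pure refl comb, of r y] by (simp add: x(1) lin)
    qed
  qed
qed

lemma linear_loc: "Vector_Spaces.linear s tscale g \<Longrightarrow> Vector_Spaces.linear s tscale (\<lambda>x. loc i k f (g x))"
  unfolding loc_def by (rule linear_lin_ext_comp)

lemmas linear_loc' = linear_loc[OF linear_id[OF tscale_vector_space]]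
lemmas lin_intros = linear_loc linear_tens_left linear_tens_right linear_plus linear_minus
  linear_scaled linear_id tscale_vector_space linear_const_zero

lemmas loc_linear = linear_addD[OF linear_loc'] linear_diffD[OF linear_loc']
  linear_zeroD[OF linear_loc'] linear_scaleD[OF linear_loc'] linear_sumD[OF linear_loc']

lemma operator_multilinear: "operator k m f \<Longrightarrow> multilinear B k f"
  by (simp add: operator_def)

lemma operator_homog: "operator k m f \<Longrightarrow> length w = k \<Longrightarrow> f w \<in> homog m"
  by (simp add: operator_def)

lemma loc_word_arg: "loc i k f (word w) = loc_word i k f w"
  by (simp add: loc_def)

lemma loc_pure: "multilinear B k f \<Longrightarrow> loc i k f (pure B w) = loc_word i k f w"
  unfolding loc_def by (rule lin_ext_pure[OF multilinear_loc_word])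

lemma loc_pure_append:
  "multilinear B k f \<Longrightarrow> length u = i \<Longrightarrow> length b = k \<Longrightarrow>
    loc i k f (pure B (u @ b @ r)) = pure B u \<otimes>\<^sub>k f b \<otimes>\<^sub>k pure B r"
  by (simp add: loc_pure loc_word_append)

lemma loc_short:
  assumes "multilinear B k f" "x \<in> homog n" "n < i + k"
  shows "loc i k f x = 0"
  by (rule homog_eqI[OF _ _ assms(2)], (intro lin_intros)+)
    (use assms in \<open>simp add: loc_pure loc_word_short\<close>)

lemma tens_zero [simp]: "0 \<otimes>\<^sub>k x = 0" "x \<otimes>\<^sub>k 0 = 0"
  by (simp_all add: tens_linear)

lemma tens_word_right: "x \<otimes>\<^sub>k word w = x \<otimes>\<^sub>k pure B w"
  by (metis pure_def tens_cls_right)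

lemma tens_pure_assoc [simp]: "x \<otimes>\<^sub>k pure B u \<otimes>\<^sub>k pure B w = x \<otimes>\<^sub>k pure B (u @ w)"
  by (simp add: tens_assoc)

lemma pure_tens_assoc: "pure B u \<otimes>\<^sub>k (pure B v \<otimes>\<^sub>k x) = pure B (u @ v) \<otimes>\<^sub>k x"
  by (simp flip: tens_assoc)

lemma loc_tens_right:
  assumes f: "multilinear B k f" and x: "x \<in> homog i"
  shows "loc (i + j) k f (x \<otimes>\<^sub>k y) = x \<otimes>\<^sub>k loc j k f y"
proof (rule homog_eqI[OF _ _ x], (intro lin_intros)+)
  fix u :: "('p, 'c, 'v) letter list" assume u: "length u = i"
  show "loc (i + j) k f (pure B u \<otimes>\<^sub>k y) = pure B u \<otimes>\<^sub>k loc j k f y"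
  proof (rule linear_eq_on_words[of _ _ y], (intro lin_intros)+)
    fix w :: "('p, 'c, 'v) letter list"
    show "loc (i + j) k f (pure B u \<otimes>\<^sub>k word w) = pure B u \<otimes>\<^sub>k loc j k f (word w)"
    proof (cases "j + k \<le> length w")
      case True
      then obtain a b r where w: "w = a @ b @ r" "length a = j" "length b = k" by (rule word_split3)
      have "loc (i + j) k f (pure B ((u @ a) @ b @ r)) = pure B (u @ a) \<otimes>\<^sub>k f b \<otimes>\<^sub>k pure B r"
        using u w by (intro loc_pure_append f) auto
      then show ?thesis
        using u w by (simp add: tens_pure_word loc_word_arg loc_word_append pure_tens_assoc tens_assoc)
    next
      case False
      then show ?thesis
        using u by (simp add: tens_pure_word loc_word_arg loc_pure[OF f] loc_word_short)
    qed
  qed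
qed

lemma loc_tens_left:
  assumes f: "multilinear B k f" and y: "y \<in> homog m" and m: "j + k \<le> m"
  shows "loc j k f (y \<otimes>\<^sub>k z) = loc j k f y \<otimes>\<^sub>k z"
proof (rule homog_eqI[OF _ _ y], (intro lin_intros)+)
  fix w :: "('p, 'c, 'v) letter list" assume "length w = m"
  then have "j + k \<le> length w" using m by simp
  then obtain a b r where w: "w = a @ b @ r" "length a = j" "length b = k" by (rule word_split3)
  show "loc j k f (pure B w \<otimes>\<^sub>k z) = loc j k f (pure B w) \<otimes>\<^sub>k z"
  proof (rule linear_eq_on_words[of _ _ z], (intro lin_intros)+)
    fix v :: "('p, 'c, 'v) letter list"
    have "loc j k f (pure B (a @ b @ (r @ v))) = pure B a \<otimes>\<^sub>k f b \<otimes>\<^sub>k pure B (r @ v)"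
      using w by (intro loc_pure_append f) auto
    then show "loc j k f (pure B w \<otimes>\<^sub>k word v) = loc j k f (pure B w) \<otimes>\<^sub>k word v"
      using w by (simp add: tens_word_right loc_pure[OF f] loc_word_append)
  qed
qed

lemma loc_tens_mid:
  assumes "multilinear B k f" "x \<in> homog i" "y \<in> homog m" "j + k \<le> m"
  shows "loc (i + j) k f (x \<otimes>\<^sub>k y \<otimes>\<^sub>k z) = x \<otimes>\<^sub>k loc j k f y \<otimes>\<^sub>k z"
  using assms by (simp add: tens_assoc loc_tens_right loc_tens_left)

lemma loc_exact:
  assumes "operator k m f" "length b = k"
  shows "loc 0 k f (pure B b) = f b"
proof -
  have "pure B [] \<otimes>\<^sub>k f b = f b"
    using operator_homog[OF assms] by (simp add: pure_Nil_tens cls_homog)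
  moreover have "f b \<otimes>\<^sub>k pure B [] = f b"
    by (rule homog_eqI[OF _ _ operator_homog[OF assms]], (intro lin_intros)+) simp
  ultimately show ?thesis
    using loc_pure_append[OF operator_multilinear[OF assms(1)], of "[]" 0 b "[]"] assms(2) by simp
qed

lemma tens_Nil: "x \<in> shaped Ls \<Longrightarrow> x \<otimes>\<^sub>k pure B [] = x" "x \<in> shaped Ls \<Longrightarrow> pure B [] \<otimes>\<^sub>k x = x"
proof -
  assume x: "x \<in> shaped Ls"
  show "x \<otimes>\<^sub>k pure B [] = x" by (rule shaped_eqI[OF _ _ x], (intro lin_intros)+) simp
  show "pure B [] \<otimes>\<^sub>k x = x" using x by (simp add: pure_Nil_tens cls_shaped)
qed

lemma loc_shaped:
  assumes f: "multilinear B k f" and k: "k = length Ls2" and i: "i = length Ls1"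
    and t: "t \<in> shaped (Ls1 @ Ls2 @ Ls3)"
    and into: "\<And>b. list_all2 (\<in>) b Ls2 \<Longrightarrow> f b \<in> shaped Ls2'"
  shows "loc i k f t \<in> shaped (Ls1 @ Ls2' @ Ls3)"
  unfolding shaped_def[of "Ls1 @ Ls2' @ Ls3"]
proof (rule shaped_into[OF linear_loc' t])
  fix w :: "('p, 'c, 'v) letter list"
  assume "list_all2 (\<in>) w (Ls1 @ Ls2 @ Ls3)"
  then obtain u b r where w: "w = u @ b @ r" "list_all2 (\<in>) u Ls1" "list_all2 (\<in>) b Ls2" "list_all2 (\<in>) r Ls3"
    by (auto simp: list_all2_append2)
  then have "pure B u \<otimes>\<^sub>k f b \<otimes>\<^sub>k pure B r \<in> shaped (Ls1 @ Ls2' @ Ls3)"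
    using tens_shaped[OF tens_shaped[OF pure_shaped into] pure_shaped] by auto
  then show "loc i k f (pure B w) \<in> tspan {pure B w |w. list_all2 (\<in>) w (Ls1 @ Ls2' @ Ls3)}"
    using w loc_pure_append[OF f, of u i b r] list_all2_lengthD[OF w(2)] list_all2_lengthD[OF w(3)] k i
    by (simp add: shaped_def)
qed

lemma loc_homog:
  assumes f: "operator k m f" and t: "t \<in> homog n" and "i + k \<le> n" "n' = n - k + m"
  shows "loc i k f t \<in> homog n'"
proof -
  obtain r where r: "n = i + k + r" using assms(3) le_Suc_ex by auto
  have "loc i k f t \<in> shaped (replicate i UNIV @ replicate m UNIV @ replicate r UNIV)"
    by (rule loc_shaped[OF operator_multilinear[OF f], of "replicate k UNIV"])
      (use t operator_homog[OF f] in \<open>simp_all add: homog_def r replicate_add\<close>)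
  moreover have "n' = i + m + r" using assms(4) r by simp
  ultimately show ?thesis by (simp add: homog_def replicate_add)
qed

text \<open>
  Operators on disjoint groups of factors commute. The one on the right is moved by the
  change of length \<open>m - k\<close> that the one on the left causes.
\<close>

lemma loc_commute:
  assumes f: "operator k m f" and g: "operator l n g"
    and le: "i + k \<le> j" and j': "j' + k = j + m"
  shows "loc i k f (loc j l g t) = loc j' l g (loc i k f t)"
proof (rule linear_eq_on_words[of _ _ t], (intro lin_intros)+)
  define d where "d = j - (i + k)"
  have ij: "j = i + k + d" "j' = i + m + d" using le j' by (auto simp: d_def)
  fix w :: "('p, 'c, 'v) letter list"
  note fm = operator_multilinear[OF f] and gm = operator_multilinear[OF g]
  consider "length w < i + k" | "i + k \<le> length w" "length w < j + l" | "j + l \<le> length w" by linarith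
  then show "loc i k f (loc j l g (word w)) = loc j' l g (loc i k f (word w))"
  proof cases
    case 1
    then show ?thesis using ij by (simp add: loc_word_arg loc_word_short loc_linear)
  next
    case 2
    have "loc i k f (word w) = loc i k f (pure B w)" by (simp add: loc_word_arg loc_pure[OF fm])
    also have "\<dots> \<in> homog (length w - k + m)"
      by (rule loc_homog[OF f pure_homog]) (use 2 in auto)
    finally have "loc j' l g (loc i k f (word w)) = 0"
      by (rule loc_short[OF gm]) (use 2 ij in auto)
    then show ?thesis using 2 by (simp add: loc_word_arg loc_word_short loc_linear)
  next
    case 3
    then obtain v c e where w: "w = v @ c @ e" "length v = j" "length c = l" by (rule word_split3)
    then have "i + k \<le> length v" using ij by simp
    then obtain a b r where v: "v = a @ b @ r" "length a = i" "length b = k" by (rule word_split3)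
    have r: "length r = d" using w v ij by simp
    have "loc j l g (word w) = pure B (a @ b @ r) \<otimes>\<^sub>k g c \<otimes>\<^sub>k pure B e"
      unfolding w(1) loc_word_arg loc_word_append[OF w(2,3)] unfolding v(1) by (rule refl)
    also have "loc i k f \<dots> = loc i k f (pure B (a @ b @ r)) \<otimes>\<^sub>k g c \<otimes>\<^sub>k pure B e"
      unfolding tens_assoc
      by (rule loc_tens_left[OF fm pure_homog]) (use v in auto)
    also have "\<dots> = pure B a \<otimes>\<^sub>k f b \<otimes>\<^sub>k pure B r \<otimes>\<^sub>k g c \<otimes>\<^sub>k pure B e"
      using v by (simp add: loc_pure_append[OF fm])
    finally have 1: "loc i k f (loc j l g (word w)) = \<dots>" .
    have "loc i k f (word w) = pure B a \<otimes>\<^sub>k f b \<otimes>\<^sub>k pure B (r @ c @ e)"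
      using w v by (simp add: loc_word_arg loc_word_append)
    also have "\<dots> = (pure B a \<otimes>\<^sub>k f b \<otimes>\<^sub>k pure B r) \<otimes>\<^sub>k pure B (c @ e)" by simp
    also have "loc (i + m + d + 0) l g \<dots> = (pure B a \<otimes>\<^sub>k f b \<otimes>\<^sub>k pure B r) \<otimes>\<^sub>k loc 0 l g (pure B (c @ e))"
      by (rule loc_tens_right[OF gm], intro tens_homog pure_homog operator_homog[OF f]) (use v r in auto)
    also have "loc 0 l g (pure B (c @ e)) = g c \<otimes>\<^sub>k pure B e"
      using w loc_pure_append[OF gm, of "[]" 0 c e] operator_homog[OF g, of c]
      by (simp add: tens_Nil homog_def)
    finally show ?thesis using 1 ij by (simp add: tens_assoc)
  qed
qed

text \<open>
  An operator applied inside the result of another one: this turns statements about maps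
  of a single letter, written in Sweedler notation, into compositions of operators.
\<close>

lemma loc_comp:
  assumes f: "operator k m f" and g: "multilinear B l g" and "j + l \<le> m"
  shows "loc i k (\<lambda>w. loc j l g (f w)) t = loc (i + j) l g (loc i k f t)"
proof (rule linear_eq_on_words[of _ _ t], (intro lin_intros)+)
  fix w :: "('p, 'c, 'v) letter list"
  show "loc i k (\<lambda>w. loc j l g (f w)) (word w) = loc (i + j) l g (loc i k f (word w))"
  proof (cases "i + k \<le> length w")
    case True
    then obtain a b r where w: "w = a @ b @ r" "length a = i" "length b = k" by (rule word_split3)
    then show ?thesis
      by (simp add: loc_word_arg loc_word_append loc_tens_mid[OF g pure_homog operator_homog[OF f] assms(3)])
  qed (simp add: loc_word_arg loc_word_short loc_linear)
qed

text \<open>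
  The same for an arbitrary linear map \<open>G\<close>, such as a left inverse obtained from
  injectivity, which is not composed of operators.
\<close>

lemma loc_linear_comp:
  assumes f: "operator k m f" and G: "linT G"
  shows "loc i k (\<lambda>w. G (f w)) t = loc i m (\<lambda>w. G (pure B w)) (loc i k f t)"
proof (rule linear_eq_on_words[of _ _ t], (intro lin_intros)+)
  fix w :: "('p, 'c, 'v) letter list"
  let ?G = "\<lambda>w. G (pure B w)"
  have Gm: "multilinear B m ?G" by (rule multilinear_comp[OF multilinear_pure G])
  show "loc i k (\<lambda>w. G (f w)) (word w) = loc i m ?G (loc i k f (word w))"
  proof (cases "i + k \<le> length w")
    case True
    then obtain a b r where w: "w = a @ b @ r" "length a = i" "length b = k" by (rule word_split3)
    have "loc i m ?G (pure B a \<otimes>\<^sub>k y \<otimes>\<^sub>k pure B r) = pure B a \<otimes>\<^sub>k G y \<otimes>\<^sub>k pure B r" if "y \<in> homog m" for y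
      by (rule homog_eqI[OF _ _ that], (intro lin_intros linear_comp[OF linear_id G])+)
        (use w in \<open>simp add: loc_pure_append[OF Gm]\<close>)
    with w operator_homog[OF f, of b] show ?thesis by (simp add: loc_word_arg loc_word_append)
  qed (simp add: loc_word_arg loc_word_short loc_linear)
qed

lemma loc_eq_on_shape:
  assumes "multilinear B k f" "multilinear B k g" "t \<in> shaped (Ls1 @ Ls2 @ Ls3)"
    and "length Ls1 = i" "length Ls2 = k"
    and "\<And>b. list_all2 (\<in>) b Ls2 \<Longrightarrow> f b = g b"
  shows "loc i k f t = loc i k g t"
proof (rule shaped_eqI[OF linear_loc' linear_loc' assms(3)])
  fix w :: "('p, 'c, 'v) letter list"
  assume "list_all2 (\<in>) w (Ls1 @ Ls2 @ Ls3)"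
  then obtain u b r where w: "w = u @ b @ r" "list_all2 (\<in>) u Ls1" "list_all2 (\<in>) b Ls2"
    by (auto simp: list_all2_append2)
  then have "length u = i" "length b = k" using assms(4,5) by (auto dest: list_all2_lengthD)
  then show "loc i k f (pure B w) = loc i k g (pure B w)"
    using w by (simp add: loc_pure_append assms)
qed

lemma loc_pure_id: "t \<in> homog n \<Longrightarrow> i + k \<le> n \<Longrightarrow> loc i k (pure B) t = t"
proof (rule homog_eqI[of "loc i k (pure B)" "\<lambda>x. x"], (intro lin_intros)+, assumption)
  fix w :: "('p, 'c, 'v) letter list"
  assume "i + k \<le> n" "length w = n"
  then have "i + k \<le> length w" by simp
  then obtain a b r where w: "w = a @ b @ r" "length a = i" "length b = k" by (rule word_split3)
  then show "loc i k (pure B) (pure B w) = pure B w"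
    by (simp add: loc_pure_append[OF multilinear_pure])
qed

end

section \<open>The structure maps of an entwining structure as operators\<close>

locale entwined =
  fixes B :: "('k::field, 'p::{ring,monoid_mult}, 'c::ab_group_add, 'v::ab_group_add) bundle_data"
    (structure)
  assumes entw: "entwining_structure B"
    and comod: "left_comodule B"
begin

lemma k_alg: "k_algebra B" and k_coalg: "k_coalgebra B"
  using entw by (simp_all add: entwining_structure_def)

sublocale tensor_calculus B
  using k_alg k_coalg comod
  by (intro tensor_calculus.intro) (simp_all add: k_algebra_def k_coalgebra_def left_comodule_def)

definition psi_word :: "('p, 'c, 'v) letter list \<Rightarrow> ('k, 'p, 'c, 'v) tensor" where
  "psi_word w = (case w of [LC c, LP p] \<Rightarrow> entwine B c p | _ \<Rightarrow> 0)"

definition mult_word :: "('p, 'c, 'v) letter list \<Rightarrow> ('k, 'p, 'c, 'v) tensor" where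
  "mult_word w = (case w of [LP a, LP b] \<Rightarrow> elP B (a * b) | _ \<Rightarrow> 0)"

abbreviation psi where "psi i \<equiv> loc i 2 psi_word"
abbreviation mu where "mu i \<equiv> loc i 2 mult_word"
abbreviation ins where "ins i x \<equiv> loc i 0 (\<lambda>_. x)"
abbreviation slotP where "slotP i f \<equiv> loc i (Suc 0) (\<lambda>w. on_P f (hd w))"
abbreviation slotC where "slotC i f \<equiv> loc i (Suc 0) (\<lambda>w. on_C f (hd w))"
abbreviation slotV where "slotV i f \<equiv> loc i (Suc 0) (\<lambda>w. on_V f (hd w))"
abbreviation one where "one \<equiv> elP B 1"
abbreviation grp where "grp \<equiv> elC B (grouplike B)"
abbreviation Ps :: "('p, 'c, 'v) letter set" where "Ps \<equiv> range LP"
abbreviation Cs :: "('p, 'c, 'v) letter set" where "Cs \<equiv> range LC"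
abbreviation Vs :: "('p, 'c, 'v) letter set" where "Vs \<equiv> range LV"

lemma tens_set_eq:
  "tens_set B (spP B) (spP B) = shaped [Ps, Ps]" "tens_set B (spP B) (spC B) = shaped [Ps, Cs]"
  "tens_set B (spC B) (spP B) = shaped [Cs, Ps]" "tens_set B (spC B) (spC B) = shaped [Cs, Cs]"
  "tens_set B (spP B) (spV B) = shaped [Ps, Vs]" "tens_set B (spC B) (spV B) = shaped [Cs, Vs]"
  by (rule tens_set_shaped[OF _ _]; rule spP_letters spC_letters spV_letters)+

lemma on_simps [simp]:
  "on_P f (LP p) = f p" "on_P f (LC c) = 0" "on_P f (LV v) = 0"
  "on_C f' (LP p) = 0" "on_C f' (LC c) = f' c" "on_C f' (LV v) = 0"
  "on_V f'' (LP p) = 0" "on_V f'' (LC c) = 0" "on_V f'' (LV v) = f'' v"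
  by (simp_all add: on_P_def on_C_def on_V_def)

lemma psi_word_simps [simp]:
  "psi_word [LC c, LP p] = entwine B c p" "psi_word (LP q # w) = 0" "psi_word (LV v # w) = 0"
  "psi_word [LC c, LC d] = 0" "psi_word [LC c, LV v] = 0"
  by (simp_all add: psi_word_def)

lemma mult_word_simps [simp]:
  "mult_word [LP a, LP b] = elP B (a * b)" "mult_word (LC c # w) = 0" "mult_word (LV v # w) = 0"
  "mult_word [LP a, LC d] = 0" "mult_word [LP a, LV v] = 0"
  by (simp_all add: mult_word_def)

lemma at_slot_loc: "at_slot B i f t = loc i (Suc 0) (\<lambda>w. f (hd w)) t"
  unfolding at_slot_def loc_def
  by (rule lin_ext_eqI) (auto simp: loc_word_def hd_drop_conv_nth take_Suc_conv_app_nth Suc_le_eq hd_conv_nth)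

lemma operator_homog_shaped:
  "operator k m f \<Longrightarrow> length w = k \<Longrightarrow> f w \<in> shaped (replicate m UNIV)"
  using operator_homog unfolding homog_def .

lemma short_list: "length v \<le> 1 \<Longrightarrow> v = [] \<or> (\<exists>l. v = [l])"
  by (cases v) auto

lemma psi_at_loc: "psi_at B i t = psi i t"
  unfolding psi_at_def loc_def
proof (rule lin_ext_eqI)
  fix w :: "('p, 'c, 'v) letter list"
  show "(case drop i w of LC c # LP p # r \<Rightarrow> pure B (take i w) \<otimes>\<^sub>k entwine B c p \<otimes>\<^sub>k pure B r | _ \<Rightarrow> 0) =
      loc_word i 2 psi_word w"
  proof (cases "i + 2 \<le> length w")
    case True
    then obtain u b r where w: "w = u @ b @ r" "length u = i" "length b = 2" by (rule word_split3)
    then obtain x y where b: "b = [x, y]" by (auto simp: length_Suc_conv numeral_2_eq_2)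
    show ?thesis
      unfolding w(1) loc_word_append[OF w(2,3)] using w b
      by (auto simp: split: letter.splits)
  next
    case False
    then have "length (drop i w) \<le> 1" by simp
    then have "drop i w = [] \<or> (\<exists>l. drop i w = [l])" by (rule short_list)
    then show ?thesis using False
      by (auto simp: loc_word_short simp del: drop_eq_Nil split: letter.splits)
  qed
qed

lemma mult_at_loc: "mult_at B i t = mu i t"
  unfolding mult_at_def loc_def
proof (rule lin_ext_eqI)
  fix w :: "('p, 'c, 'v) letter list"
  show "(case drop i w of LP a # LP b # r \<Rightarrow> pure B (take i w @ LP (a * b) # r) | _ \<Rightarrow> 0) =
      loc_word i 2 mult_word w"
  proof (cases "i + 2 \<le> length w")
    case True
    then obtain u b r where w: "w = u @ b @ r" "length u = i" "length b = 2" by (rule word_split3)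
    then obtain x y where b: "b = [x, y]" by (auto simp: length_Suc_conv numeral_2_eq_2)
    show ?thesis
      unfolding w(1) loc_word_append[OF w(2,3)] using w b
      by (auto simp: split: letter.splits)
  next
    case False
    then have "length (drop i w) \<le> 1" by simp
    then have "drop i w = [] \<or> (\<exists>l. drop i w = [l])" by (rule short_list)
    then show ?thesis using False
      by (auto simp: loc_word_short simp del: drop_eq_Nil split: letter.splits)
  qed
qed

lemma multilinear_one:
  assumes "\<And>a l l' l''. letter_comb B a l l' l'' \<Longrightarrow> f l'' = tscale a (f l) + f l'"
  shows "multilinear B (Suc 0) (\<lambda>w. f (hd w))"
  by (rule multilinearI) (use assms in auto)

lemma operator_P:
  assumes "Vector_Spaces.linear (scaleP B) tscale f" "\<And>p. f p \<in> homog m"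
  shows "operator (Suc 0) m (\<lambda>w. on_P f (hd w))"
proof -
  have "multilinear B (Suc 0) (\<lambda>w. on_P f (hd w))"
    by (rule multilinear_one) (erule letter_comb.cases; simp add: linear_addD[OF assms(1)] linear_scaleD[OF assms(1)])
  moreover have "on_P f l \<in> homog m" for l by (cases l) (simp_all add: assms(2))
  ultimately show ?thesis unfolding operator_def by blast
qed

lemma operator_C:
  assumes "Vector_Spaces.linear (scaleC B) tscale f" "\<And>p. f p \<in> homog m"
  shows "operator (Suc 0) m (\<lambda>w. on_C f (hd w))"
proof -
  have "multilinear B (Suc 0) (\<lambda>w. on_C f (hd w))"
    by (rule multilinear_one) (erule letter_comb.cases; simp add: linear_addD[OF assms(1)] linear_scaleD[OF assms(1)])
  moreover have "on_C f l \<in> homog m" for l by (cases l) (simp_all add: assms(2))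
  ultimately show ?thesis unfolding operator_def by blast
qed

lemma operator_V:
  assumes "Vector_Spaces.linear (scaleV B) tscale f" "\<And>p. f p \<in> homog m"
  shows "operator (Suc 0) m (\<lambda>w. on_V f (hd w))"
proof -
  have "multilinear B (Suc 0) (\<lambda>w. on_V f (hd w))"
    by (rule multilinear_one) (erule letter_comb.cases; simp add: linear_addD[OF assms(1)] linear_scaleD[OF assms(1)])
  moreover have "on_V f l \<in> homog m" for l by (cases l) (simp_all add: assms(2))
  ultimately show ?thesis unfolding operator_def by blast
qed

lemma operator_ins: "x \<in> homog m \<Longrightarrow> operator 0 m (\<lambda>_. x)"
  by (auto simp: operator_def multilinear_def)

lemma entwine_linear:
  "Vector_Spaces.linear (scaleC B) tscale (\<lambda>c. entwine B c p)"
  "Vector_Spaces.linear (scaleP B) tscale (entwine B c)"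
  using entw by (simp_all add: entwining_structure_def)

lemma entwine_shaped: "entwine B c p \<in> shaped [Ps, Cs]"
  using entw by (simp add: entwining_structure_def tens_set_eq)

lemma multilinear_two:
  assumes "\<And>a l l' l'' m. letter_comb B a l l' l'' \<Longrightarrow> f [l'', m] = tscale a (f [l, m]) + f [l', m]"
    and "\<And>a l l' l'' m. letter_comb B a l l' l'' \<Longrightarrow> f [m, l''] = tscale a (f [m, l]) + f [m, l']"
  shows "multilinear B 2 f"
proof (rule multilinearI)
  fix u w :: "('p, 'c, 'v) letter list" and a l l' l''
  assume "length u + Suc (length w) = 2" and comb: "letter_comb B a l l' l''"
  then consider m where "u = []" "w = [m]" | m where "u = [m]" "w = []"
    by (cases u; cases w) auto
  then show "f (u @ l'' # w) = tscale a (f (u @ l # w)) + f (u @ l' # w)"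
    using assms comb by cases simp_all
qed

lemma homog2: "x \<in> shaped [L, L'] \<Longrightarrow> x \<in> homog 2"
  by (erule shaped_homog) simp

lemma operator_psi: "operator 2 2 psi_word"
proof -
  have "multilinear B 2 psi_word"
  proof (rule multilinear_two; erule letter_comb.cases)
  qed (auto simp: psi_word_def linear_addD[OF entwine_linear(1)] linear_addD[OF entwine_linear(2)]
      linear_scaleD[OF entwine_linear(1)] linear_scaleD[OF entwine_linear(2)] split: letter.splits)
  moreover have "psi_word w \<in> homog 2" for w
    using homog2[OF entwine_shaped] by (auto simp: psi_word_def split: list.splits letter.splits)
  ultimately show ?thesis unfolding operator_def by blast
qed

lemma operator_mult: "operator 2 (Suc 0) mult_word"
proof -
  have "scaleP B a p * q = scaleP B a (p * q)" "p * scaleP B a q = scaleP B a (p * q)" for a p q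
    using k_alg unfolding k_algebra_def by metis+
  then have "multilinear B 2 mult_word"
  proof (intro multilinear_two; elim letter_comb.cases)
  qed (auto simp: mult_word_def linear_addD[OF linear_elP] linear_scaleD[OF linear_elP] distrib_left distrib_right
      split: letter.splits)
  moreover have "mult_word w \<in> homog (Suc 0)" for w
    by (auto simp: mult_word_def pure_homog split: list.splits letter.splits)
  ultimately show ?thesis unfolding operator_def by blast
qed

lemma comult_linear: "Vector_Spaces.linear (scaleC B) tscale (comult B)"
  and counit_linear: "Vector_Spaces.linear (scaleC B) (*) (counit B)"
  and comult_shaped: "comult B c \<in> shaped [Cs, Cs]"
  using k_coalg by (simp_all add: k_coalgebra_def tens_set_eq)

lemma coact_linear: "Vector_Spaces.linear (scaleV B) tscale (coact B)"
  and coact_shaped: "coact B v \<in> shaped [Cs, Vs]"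
  using comod by (simp_all add: left_comodule_def tens_set_eq)

lemma coactP_linear: "Vector_Spaces.linear (scaleP B) tscale (coactP B)"
  and coactP_shaped: "coactP B p \<in> shaped [Ps, Cs]"
  unfolding coactP_def[abs_def] using entwine_linear(2) entwine_shaped by auto

lemma operator_comult: "operator (Suc 0) 2 (\<lambda>w. on_C (comult B) (hd w))"
  by (rule operator_C[OF comult_linear homog2[OF comult_shaped]])

lemma operator_coact: "operator (Suc 0) 2 (\<lambda>w. on_V (coact B) (hd w))"
  by (rule operator_V[OF coact_linear homog2[OF coact_shaped]])

lemma operator_coactP: "operator (Suc 0) 2 (\<lambda>w. on_P (coactP B) (hd w))"
  by (rule operator_P[OF coactP_linear homog2[OF coactP_shaped]])

lemma linear_tscale_counit: "Vector_Spaces.linear (scaleC B) tscale (\<lambda>c. tscale (counit B c) x)"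
  by (rule linear_tscaleI[OF vsC])
    (simp_all add: linear_addD[OF counit_linear] linear_scaleD[OF counit_linear] tvec.scale_left_distrib)

abbreviation eps where "eps \<equiv> (\<lambda>d. tscale (counit B d) (pure B []))"

lemma operator_eps: "operator (Suc 0) 0 (\<lambda>w. on_C eps (hd w))"
  by (rule operator_C[OF linear_tscale_counit]) (intro homog_scale pure_homog, simp)

lemma operator_one: "operator 0 (Suc 0) (\<lambda>_. one)"
  and operator_grp: "operator 0 (Suc 0) (\<lambda>_. grp)"
  by (intro operator_ins pure_homog, simp)+

lemmas ops = operator_psi operator_mult operator_comult operator_coact operator_coactP operator_eps
  operator_one operator_grp

lemmas ops_multilinear [simp] = ops[THEN operator_multilinear]

lemma slot_comp:
  assumes "multilinear B l g" "j + l \<le> m"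
  shows slotC_comp: "operator (Suc 0) m (\<lambda>w. on_C f (hd w)) \<Longrightarrow>
      slotC i (\<lambda>x. loc j l g (f x)) t = loc (i + j) l g (slotC i f t)"
    and slotV_comp: "operator (Suc 0) m (\<lambda>w. on_V f' (hd w)) \<Longrightarrow>
      slotV i (\<lambda>x. loc j l g (f' x)) t = loc (i + j) l g (slotV i f' t)"
    and slotP_comp: "operator (Suc 0) m (\<lambda>w. on_P f'' (hd w)) \<Longrightarrow>
      slotP i (\<lambda>x. loc j l g (f'' x)) t = loc (i + j) l g (slotP i f'' t)"
proof -
  have "on_C (\<lambda>x. loc j l g (f x)) y = loc j l g (on_C f y)"
    "on_V (\<lambda>x. loc j l g (f' x)) y = loc j l g (on_V f' y)"
    "on_P (\<lambda>x. loc j l g (f'' x)) y = loc j l g (on_P f'' y)" for y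
    by (cases y; simp add: loc_linear)+
  then show
    "operator (Suc 0) m (\<lambda>w. on_C f (hd w)) \<Longrightarrow>
      slotC i (\<lambda>x. loc j l g (f x)) t = loc (i + j) l g (slotC i f t)"
    "operator (Suc 0) m (\<lambda>w. on_V f' (hd w)) \<Longrightarrow>
      slotV i (\<lambda>x. loc j l g (f' x)) t = loc (i + j) l g (slotV i f' t)"
    "operator (Suc 0) m (\<lambda>w. on_P f'' (hd w)) \<Longrightarrow>
      slotP i (\<lambda>x. loc j l g (f'' x)) t = loc (i + j) l g (slotP i f'' t)"
    using loc_comp[OF _ assms] by simp_all
qed

lemma loc_word_zero_short:
  assumes "operator k k f" "multilinear B l g" "length w < j + l"
  shows "loc j l g (loc i k f (word w)) = 0"
proof (cases "length w < i + k")
  case True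
  then show ?thesis by (simp add: loc_word_arg loc_word_short loc_linear)
next
  case False
  then have "loc i k f (word w) \<in> homog (length w)"
    using loc_homog[OF assms(1) pure_homog[of w], of "length w" i]
    by (simp add: loc_word_arg loc_pure operator_multilinear[OF assms(1)])
  then show ?thesis by (rule loc_short[OF assms(2)]) (rule assms(3))
qed

lemma loc_at:
  assumes "multilinear B k f" "length a = i" "x \<in> homog m" "j + k \<le> m"
  shows "loc (i + j) k f (pure B a \<otimes>\<^sub>k x \<otimes>\<^sub>k z) = pure B a \<otimes>\<^sub>k loc j k f x \<otimes>\<^sub>k z"
  by (rule loc_tens_mid[OF assms(1) pure_homog assms(3,4)]) (rule assms(2))

lemmas loc_at_0 = loc_at[where j = 0, simplified]
lemmas loc_at_1 = loc_at[where j = "Suc 0", simplified]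

lemma word_eq_pure:
  "multilinear B k f \<Longrightarrow> loc i k f (word (a @ b @ r)) = loc i k f (pure B a \<otimes>\<^sub>k pure B b \<otimes>\<^sub>k pure B r)"
  by (simp add: loc_word_arg loc_pure)

text \<open>
  The compatibility of \<open>\<psi>\<close> with products, at any position. On words of the wrong kind both
  sides vanish, so the equation holds for every tensor, and the same is true of
  \<open>psi_comult\<close>.
\<close>

lemma psi_mult: "psi i (mu (Suc i) t) = mu i (psi (Suc i) (psi i t))"
proof (rule linear_eq_on_words[of _ _ t], (intro lin_intros)+)
  fix w :: "('p, 'c, 'v) letter list"
  show "psi i (mu (Suc i) (word w)) = mu i (psi (Suc i) (psi i (word w)))"
  proof (cases "i + 3 \<le> length w")
    case True
    then obtain a b r where w: "w = a @ b @ r" "length a = i" "length b = 3" by (rule word_split3)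
    then obtain x y z where b: "b = [x, y, z]" by (auto simp: length_Suc_conv numeral_3_eq_3)
    have base: "psi 0 (mu (Suc 0) (pure B b)) = mu 0 (psi (Suc 0) (psi 0 (pure B b)))"
    proof -
      have mu1: "mu (Suc 0) (pure B b) = elem [x] \<otimes>\<^sub>k mult_word [y, z]" if "elem = pure B" for elem
        using loc_pure_append[OF ops_multilinear(2), of "[x]" "Suc 0" "[y, z]" "[]"] b that
        by (cases y; cases z) (simp_all)
      have psi0: "psi 0 (pure B b) = psi_word [x, y] \<otimes>\<^sub>k pure B [z]"
        using loc_pure_append[OF ops_multilinear(1), of "[]" 0 "[x, y]" "[z]"] b
          tens_Nil(2)[OF operator_homog_shaped[OF operator_psi, of "[x, y]"]] by simp
      show ?thesis
      proof (cases "\<exists>c p. x = LC c \<and> y = LP p")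
        case False
        then have "psi_word [x, y] = 0" by (cases x; cases y) auto
        moreover have "psi 0 (mu (Suc 0) (pure B b)) = 0"
          unfolding mu1[OF refl]
          using False loc_exact[OF operator_psi, of "[x, LP _]"]
          by (cases x; cases y; cases z) (simp_all add: loc_linear)
        ultimately show ?thesis by (simp add: psi0 loc_linear)
      next
        case True
        then obtain c p where xy: "x = LC c" "y = LP p" by blast
        show ?thesis
        proof (cases z)
          case (LP q)
          have "entwine B c (p * q) = mult_at B 0 (psi_at B 1 (psi_at B 0 (pure B [LC c, LP p, LP q])))"
            using entw by (simp add: entwining_structure_def)
          then show ?thesis
            unfolding mu1[OF refl] unfolding b xy LP
            using loc_exact[OF operator_psi, of "[LC c, LP (p * q)]"]
            by (simp add: psi_at_loc mult_at_loc)
        next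
          case (LC d)
          have "psi (Suc 0) (entwine B c p \<otimes>\<^sub>k pure B [LC d]) = 0"
            by (rule shaped_eqI[OF _ _ entwine_shaped], (intro lin_intros)+)
              (use loc_pure_append[OF ops_multilinear(1), of "[_]" "Suc 0" "[_, _]" "[]"] in
                \<open>auto simp: list_all2_Cons2\<close>)
          then show ?thesis
            unfolding mu1[OF refl] psi0 unfolding xy LC by (simp add: loc_linear)
        next
          case (LV d)
          have "psi (Suc 0) (entwine B c p \<otimes>\<^sub>k pure B [LV d]) = 0"
            by (rule shaped_eqI[OF _ _ entwine_shaped], (intro lin_intros)+)
              (use loc_pure_append[OF ops_multilinear(1), of "[_]" "Suc 0" "[_, _]" "[]"] in
                \<open>auto simp: list_all2_Cons2\<close>)
          then show ?thesis
            unfolding mu1[OF refl] psi0 unfolding xy LV by (simp add: loc_linear)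
        qed
      qed
    qed
    have h: "pure B b \<in> homog 3" "psi 0 (pure B b) \<in> homog 3" "psi (Suc 0) (psi 0 (pure B b)) \<in> homog 3"
      "mu (Suc 0) (pure B b) \<in> homog 2"
      by (rule loc_homog[OF operator_psi] loc_homog[OF operator_mult] pure_homog | simp add: w(3))+
    show ?thesis
      unfolding w(1) word_eq_pure[OF ops_multilinear(1)] word_eq_pure[OF ops_multilinear(2)]
      using base h by (simp add: loc_at_0[OF _ w(2)] loc_at_1[OF _ w(2)] del: tens_pure tens_pure_assoc)
  next
    case False
    then have "psi (Suc i) (psi i (word w)) = 0"
      by (intro loc_word_zero_short operator_psi) simp_all
    moreover have "mu (Suc i) (word w) = 0" using False by (simp add: loc_word_arg loc_word_short)
    ultimately show ?thesis by (simp add: loc_linear)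
  qed
qed

lemma psi_comult: "slotC (Suc i) (comult B) (psi i t) = psi i (psi (Suc i) (slotC i (comult B) t))"
proof (rule linear_eq_on_words[of _ _ t], (intro lin_intros)+)
  fix w :: "('p, 'c, 'v) letter list"
  show "slotC (Suc i) (comult B) (psi i (word w)) = psi i (psi (Suc i) (slotC i (comult B) (word w)))"
  proof (cases "i + 2 \<le> length w")
    case True
    then obtain a b r where w: "w = a @ b @ r" "length a = i" "length b = 2" by (rule word_split3)
    then obtain x y where b: "b = [x, y]" by (auto simp: length_Suc_conv numeral_2_eq_2)
    have slot0: "slotC 0 (comult B) (pure B b) = on_C (comult B) x \<otimes>\<^sub>k pure B [y]"
      using loc_pure_append[OF ops_multilinear(3), of "[]" 0 "[x]" "[y]"] b
        tens_Nil(2)[OF operator_homog_shaped[OF operator_comult, of "[x]"]] by simp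
    have base: "slotC (Suc 0) (comult B) (psi 0 (pure B b)) = psi 0 (psi (Suc 0) (slotC 0 (comult B) (pure B b)))"
    proof (cases x)
      case (LC c)
      have zero: "psi (Suc 0) (comult B c \<otimes>\<^sub>k pure B [y]) = 0" if "\<And>p. y \<noteq> LP p"
        by (rule shaped_eqI[OF _ _ comult_shaped], (intro lin_intros)+)
          (use loc_pure_append[OF ops_multilinear(1), of "[_]" "Suc 0" "[_, _]" "[]"] that in
            \<open>cases y; auto simp: list_all2_Cons2\<close>)
      have "at_slot B 1 (on_C (comult B)) (entwine B c p) =
          psi_at B 0 (psi_at B 1 (comult B c \<otimes>\<^sub>k elP B p))" for p
        using entw by (simp add: entwining_structure_def)
      then show ?thesis
        unfolding slot0 loc_exact[OF operator_psi w(3)] using zero b LC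
        by (cases y) (simp_all add: loc_linear at_slot_loc psi_at_loc)
    qed (unfold slot0 loc_exact[OF operator_psi w(3)], use b in \<open>simp_all add: loc_linear\<close>)
    have h: "pure B b \<in> homog 2" "psi 0 (pure B b) \<in> homog 2" "slotC 0 (comult B) (pure B b) \<in> homog 3"
      "psi (Suc 0) (slotC 0 (comult B) (pure B b)) \<in> homog 3"
      by (rule loc_homog[OF operator_psi] loc_homog[OF operator_comult] pure_homog | simp add: w(3))+
    show ?thesis
      unfolding w(1) word_eq_pure[OF ops_multilinear(1)] word_eq_pure[OF ops_multilinear(3)]
      using base h by (simp add: loc_at_0[OF _ w(2)] loc_at_1[OF _ w(2)] del: tens_pure tens_pure_assoc)
  next
    case False
    have "psi (Suc i) (slotC i (comult B) (word w)) = 0"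
    proof (cases "i + 1 \<le> length w")
      case True
      then have "slotC i (comult B) (word w) \<in> homog (length w + 1)"
        using loc_homog[OF operator_comult pure_homog[of w], of "length w" i "length w + 1"]
        by (simp add: loc_word_arg loc_pure)
      then show ?thesis by (rule loc_short[rotated]) (use False in auto)
    qed (simp add: loc_word_arg loc_word_short loc_linear)
    moreover have "psi i (word w) = 0" using False by (simp add: loc_word_arg loc_word_short)
    ultimately show ?thesis by (simp add: loc_linear)
  qed
qed

lemma psi_eps:
  assumes "t \<in> shaped [Cs, Ps]"
  shows "slotC (Suc 0) eps (psi 0 t) = slotC 0 eps t"
proof (rule shaped_eqI[OF _ _ assms], (intro lin_intros)+)
  fix w assume "list_all2 (\<in>) w [Cs, Ps]"
  then obtain c p where w: "w = [LC c, LP p]" by (auto simp: list_all2_Cons2)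
  have "at_slot B 1 (on_C eps) (entwine B c p) = tscale (counit B c) (elP B p)"
    using entw unfolding entwining_structure_def by blast
  then show "slotC (Suc 0) eps (psi 0 (pure B w)) = slotC 0 eps (pure B w)"
    using loc_exact[OF operator_psi, of w] loc_pure_append[OF ops_multilinear(6), of "[]" 0 "[LC c]" "[LP p]"]
    by (simp add: w at_slot_loc tens_linear)
qed

lemma psi_unit:
  assumes "t \<in> shaped (Ls1 @ Cs # Ls3)" "length Ls1 = i"
  shows "psi i (ins (Suc i) one t) = ins i one t"
proof (rule shaped_eqI[OF _ _ assms(1)], (intro lin_intros)+)
  fix w assume "list_all2 (\<in>) w (Ls1 @ Cs # Ls3)"
  then obtain a c r where w: "w = a @ LC c # r" "length a = i"
    using assms(2) by (auto simp: list_all2_append2 list_all2_Cons2 dest: list_all2_lengthD)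
  have "ins (Suc i) one (pure B ((a @ [LC c]) @ [] @ r)) = pure B (a @ [LC c, LP 1] @ r)"
    using w(2) by (subst loc_pure_append) simp_all
  then have "psi i (ins (Suc i) one (pure B w)) = psi i (pure B (a @ [LC c, LP 1] @ r))"
    by (simp add: w(1))
  also have "\<dots> = pure B a \<otimes>\<^sub>k entwine B c 1 \<otimes>\<^sub>k pure B r"
    using w(2) by (subst loc_pure_append) simp_all
  also have "entwine B c 1 = pure B [LP 1, LC c]"
    using entw by (simp add: entwining_structure_def)
  also have "pure B a \<otimes>\<^sub>k \<dots> \<otimes>\<^sub>k pure B r = ins i one (pure B (a @ [] @ (LC c # r)))"
    using w(2) by (subst loc_pure_append) simp_all
  finally show "psi i (ins (Suc i) one (pure B w)) = ins i one (pure B w)"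
    by (simp add: w(1))
qed

text \<open>
  Associativity if \<open>j = i + 1\<close>, and disjointness of the factors otherwise.
\<close>

lemma mu_mu: "i < j \<Longrightarrow> mu i (mu j t) = mu (j - 1) (mu i t)"
proof (cases "j = Suc i")
  case False
  assume "i < j"
  with False show ?thesis by (intro loc_commute[OF operator_mult operator_mult]) simp_all
next
  case True
  have "mu i (mu (Suc i) t) = mu i (mu i t)"
  proof (rule linear_eq_on_words[of _ _ t], (intro lin_intros)+)
    fix w :: "('p, 'c, 'v) letter list"
    show "mu i (mu (Suc i) (word w)) = mu i (mu i (word w))"
    proof (cases "i + 3 \<le> length w")
      case True
      then obtain a b r where w: "w = a @ b @ r" "length a = i" "length b = 3" by (rule word_split3)
      then obtain x y z where b: "b = [x, y, z]" by (auto simp: length_Suc_conv numeral_3_eq_3)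
      have 1: "mu (Suc i) (word w) = pure B (a @ [x]) \<otimes>\<^sub>k mult_word [y, z] \<otimes>\<^sub>k pure B r"
        using loc_pure_append[OF ops_multilinear(2), of "a @ [x]" "Suc i" "[y, z]" r] w b
        by (simp add: loc_word_arg loc_pure)
      have 2: "mu i (word w) = pure B a \<otimes>\<^sub>k mult_word [x, y] \<otimes>\<^sub>k pure B (z # r)"
        using loc_pure_append[OF ops_multilinear(2), of a i "[x, y]" "z # r"] w b
        by (simp add: loc_word_arg loc_pure)
      have 3: "mu i (pure B (a @ l # m # r)) = pure B a \<otimes>\<^sub>k mult_word [l, m] \<otimes>\<^sub>k pure B r" for l m
        using loc_pure_append[OF ops_multilinear(2), of a i "[l, m]" r] w by simp
      show ?thesis
        unfolding 1 2 by (cases x; cases y; cases z) (simp_all add: 3 loc_linear mult.assoc)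
    next
      case False
      have "mu i (mu i (word w)) = 0"
      proof (cases "i + 2 \<le> length w")
        case True
        then have "mu i (word w) \<in> homog (length w - 2 + Suc 0)"
          using loc_homog[OF operator_mult pure_homog[of w], of "length w" i "length w - 2 + Suc 0"]
          by (simp add: loc_word_arg loc_pure)
        then show ?thesis by (rule loc_short[rotated]) (use False True in auto)
      qed (simp add: loc_word_arg loc_word_short loc_linear)
      then show ?thesis using False by (simp add: loc_word_arg loc_word_short loc_linear)
    qed
  qed
  then show ?thesis using True by simp
qed

section \<open>Moving a coalgebra factor through several algebra factors\<close>

text \<open>
  The map \<open>\<psi>\<^sup>n\<close> applied to the factor \<open>i\<close>, which crosses the next \<open>n\<close> factors.
\<close>

fun psis where
  "psis i 0 t = t"
| "psis i (Suc n) t = psi (i + n) (psis i n t)"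

lemma psi_pow_psis: "psi_pow B n t = psis 0 n t"
  by (induction n) (simp_all add: psi_at_loc)

lemma linear_psis: "Vector_Spaces.linear s tscale g \<Longrightarrow> Vector_Spaces.linear s tscale (\<lambda>x. psis i n (g x))"
  by (induction n) (simp_all add: linear_loc)

lemmas linear_psis' = linear_psis[OF linear_id[OF tscale_vector_space]]

lemma psis_add: "psis i (n + m) t = psis (i + n) m (psis i n t)"
  by (induction m) (simp_all add: add.assoc)

lemma psis_below:
  assumes f: "operator k m f" and "j + k \<le> i" "i' + k = i + m"
  shows "loc j k f (psis i n t) = psis i' n (loc j k f t)"
proof (induction n)
  case (Suc n)
  have "loc j k f (psi (i + n) (psis i n t)) = psi (i' + n) (loc j k f (psis i n t))"
    by (rule loc_commute[OF f operator_psi]) (use assms in auto)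
  then show ?case using Suc by simp
qed simp

lemma psis_above:
  assumes f: "operator k m f" and "i + n < j"
  shows "psis i n (loc j k f t) = loc j k f (psis i n t)"
  using assms(2)
proof (induction n)
  case (Suc n)
  then have "psis i (Suc n) (loc j k f t) = psi (i + n) (loc j k f (psis i n t))" by simp
  also have "\<dots> = loc j k f (psi (i + n) (psis i n t))"
    by (rule loc_commute[OF operator_psi f]) (use Suc.prems in auto)
  finally show ?case by simp
qed simp

text \<open>
  Crossing a product amounts to crossing its two factors and then multiplying. The
  crossing at the junction is \<open>psi_mult\<close>, and all other crossings involve disjoint
  factors.
\<close>

lemma psis_mult: "psis 0 (Suc j + m) (mu (Suc j) t) = mu j (psis 0 (Suc (Suc j) + m) t)"
proof (induction m)
  case 0
  have "psis 0 (Suc j) (mu (Suc j) t) = psi j (mu (Suc j) (psis 0 j t))"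
    by (simp add: psis_above[OF operator_mult])
  then show ?case by (simp add: psi_mult)
next
  case (Suc m)
  have "mu j (psi (Suc (Suc j) + m) x) = psi (Suc j + m) (mu j x)" for x
    by (rule loc_commute[OF operator_mult operator_psi]) simp_all
  then show ?case using Suc by simp
qed

lemma psis_homog: "t \<in> homog l \<Longrightarrow> i + n < l \<Longrightarrow> psis i n t \<in> homog l"
  by (induction n) (auto intro!: loc_homog[OF operator_psi])

lemma psis_shaped:
  "t \<in> shaped (Ls1 @ Cs # replicate n Ps @ Ls3) \<Longrightarrow> length Ls1 = i \<Longrightarrow>
    psis i n t \<in> shaped (Ls1 @ replicate n Ps @ Cs # Ls3)"
proof (induction n arbitrary: Ls3)
  case (Suc n)
  have "psis i n t \<in> shaped (Ls1 @ replicate n Ps @ Cs # (Ps # Ls3))"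
    by (rule Suc.IH) (use Suc.prems in \<open>simp_all flip: replicate_append_same\<close>)
  then have "psi (i + n) (psis i n t) \<in> shaped ((Ls1 @ replicate n Ps) @ [Ps, Cs] @ Ls3)"
    by (intro loc_shaped[of _ _ "[Cs, Ps]"])
      (use Suc.prems entwine_shaped in \<open>auto simp: list_all2_Cons2\<close>)
  then show ?case by (simp flip: replicate_append_same)
qed simp

lemma psis_two: "psis i 2 t = psi (Suc i) (psi i t)"
proof -
  have "psis i (Suc (Suc 0)) t = psi (Suc i) (psi i t)" by simp
  then show ?thesis by (simp only: numeral_2_eq_2[symmetric])
qed

lemma psis_tens_right: "x \<in> homog i \<Longrightarrow> psis (i + j) n (x \<otimes>\<^sub>k t) = x \<otimes>\<^sub>k psis j n t"
  by (induction n) (simp_all add: add.assoc loc_tens_right[OF ops_multilinear(1)])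

text \<open>
  Crossing an inserted unit has no effect since \<open>\<psi>(c \<otimes> 1) = 1 \<otimes> c\<close>; the crossings on
  either side of it commute with the insertion.
\<close>

lemma psis_ins_one:
  assumes s: "s \<in> shaped (Cs # replicate m Ps)" and k: "k \<le> m"
  shows "psis 0 (Suc m) (ins (Suc k) one s) = ins k one (psis 0 m s)"
proof -
  obtain r where m: "m = k + r" using k le_Suc_ex by blast
  have "psis 0 k s \<in> shaped (replicate k Ps @ Cs # replicate r Ps)"
    using psis_shaped[of s "[]" k "replicate r Ps" 0] s by (simp add: m replicate_add)
  then have "psis 0 (Suc k) (ins (Suc k) one s) = ins k one (psis 0 k s)"
    by (simp add: psis_above[OF operator_one] psi_unit)
  then have "psis 0 (Suc k + r) (ins (Suc k) one s) = psis (Suc k) r (ins k one (psis 0 k s))"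
    using psis_add[of 0 "Suc k" r] by simp
  also have "\<dots> = ins k one (psis k r (psis 0 k s))"
    by (rule psis_below[OF operator_one, symmetric]) simp_all
  finally show ?thesis using psis_add[of 0 k r] by (simp add: m)
qed

lemma slotV_psis:
  assumes f: "operator (Suc 0) m (\<lambda>w. on_V f (hd w))" and "j + n < m"
  shows "slotV i (\<lambda>x. psis j n (f x)) t = psis (i + j) n (slotV i f t)"
  using assms(2)
proof (induction n)
  case (Suc n)
  have "operator (Suc 0) m (\<lambda>w. psis j n (on_V f (hd w)))"
    unfolding operator_def
    using multilinear_comp[OF operator_multilinear[OF f] linear_psis'] psis_homog[OF operator_homog[OF f]] Suc.prems
    by auto
  moreover have "on_V (\<lambda>x. psis j n (f x)) y = psis j n (on_V f y)" for y :: "('p, 'c, 'v) letter"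
    by (cases y) (simp_all add: linear_zeroD[OF linear_psis'])
  ultimately have "operator (Suc 0) m (\<lambda>w. on_V (\<lambda>x. psis j n (f x)) (hd w))" by (simp only:)
  from slotV_comp[OF _ _ this, of 2 psi_word "j + n"] Suc show ?case
    by (simp add: add.assoc)
qed simp

section \<open>Products, differentials and contractions as operators\<close>

text \<open>
  For prescriptions that distinguish shapes of words, multilinearity need not be checked
  letter by letter: it suffices to recognise them, on words of each length, as
  restrictions of composites of operators.
\<close>

lemma lin_ext_by_length:
  fixes G :: "nat \<Rightarrow> ('k, 'p, 'c, 'v) tensor \<Rightarrow> ('k, 'p, 'c, 'v) tensor"
  assumes "\<And>n. linT (G n)" "\<And>w. F w = G (length w) (pure B w)" "t \<in> homog n"
  shows "lin_ext F t = G n t"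
proof -
  have ml: "multilinear B m F" for m
  proof (rule multilinearI)
    fix u w :: "('p, 'c, 'v) letter list" and a l l' l''
    assume len: "length u + Suc (length w) = m" and comb: "letter_comb B a l l' l''"
    show "F (u @ l'' # w) = tscale a (F (u @ l # w)) + F (u @ l' # w)"
      using multilinearD[OF multilinear_comp[OF multilinear_pure assms(1)[of m]] len comb] len
      by (simp add: assms(2))
  qed
  show ?thesis
    by (rule homog_eqI[OF linear_lin_ext assms(1,3)]) (simp add: lin_ext_pure[OF ml] assms(2))
qed

lemma juxt_word:
  "(case (rev u, w) of (LP a # u', LP b # w') \<Rightarrow> pure B (rev u' @ LP (a * b) # w') | _ \<Rightarrow> 0) =
    (case length u of 0 \<Rightarrow> 0 | Suc n \<Rightarrow> mu n (pure B u \<otimes>\<^sub>k pure B w))"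
proof (cases u rule: rev_cases)
  case (snoc u' l)
  show ?thesis
  proof (cases w)
    case Nil
    have "mu (length u') (pure B u) = 0" by (rule loc_short[OF _ pure_homog]) (use snoc in auto)
    then show ?thesis using Nil snoc by (simp split: letter.splits)
  next
    case (Cons m w')
    have "mu (length u') (pure B (u' @ [l, m] @ w')) = pure B u' \<otimes>\<^sub>k mult_word [l, m] \<otimes>\<^sub>k pure B w'"
      by (rule loc_pure_append) simp_all
    then show ?thesis using snoc Cons by (cases l; cases m) simp_all
  qed
qed simp

lemma linear_case_nat:
  "linT (\<lambda>x. case n of 0 \<Rightarrow> 0 | Suc m \<Rightarrow> h m x)" if "\<And>m. linT (h m)"
  using that by (cases n) (simp_all add: linear_const_zero tscale_vector_space)

lemma juxt_length:
  assumes "x \<in> homog n"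
  shows "x \<star> y = (case n of 0 \<Rightarrow> 0 | Suc m \<Rightarrow> mu m (x \<otimes>\<^sub>k y))"
  unfolding juxt_def
proof (rule lin_ext_by_length[OF _ _ assms])
  show "linT (\<lambda>x. case n of 0 \<Rightarrow> 0 | Suc m \<Rightarrow> mu m (x \<otimes>\<^sub>k y))" for n
    by (intro linear_case_nat lin_intros)
  fix u :: "('p, 'c, 'v) letter list"
  show "lin_ext (\<lambda>w. case (rev u, w) of (LP a # u', LP b # w') \<Rightarrow> pure B (rev u' @ LP (a * b) # w') | _ \<Rightarrow> 0) y
      = (case length u of 0 \<Rightarrow> 0 | Suc m \<Rightarrow> mu m (pure B u \<otimes>\<^sub>k y))"
  proof (rule linear_eq_on_words[OF linear_lin_ext, of _ _ y])
    show "linT (\<lambda>y. case length u of 0 \<Rightarrow> 0 | Suc m \<Rightarrow> mu m (pure B u \<otimes>\<^sub>k y))"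
      by (intro linear_case_nat lin_intros)
  qed (simp only: lin_ext_word juxt_word tens_word_right)
qed

lemma juxt_mu: "x \<in> homog (Suc n) \<Longrightarrow> x \<star> y = mu n (x \<otimes>\<^sub>k y)"
  by (simp add: juxt_length)

lemma linear_juxt_left: "Vector_Spaces.linear s tscale f \<Longrightarrow> Vector_Spaces.linear s tscale (\<lambda>x. f x \<star> y)"
  unfolding juxt_def by (rule linear_lin_ext_comp)

lemma linear_juxt_right: "Vector_Spaces.linear s tscale f \<Longrightarrow> Vector_Spaces.linear s tscale (\<lambda>x. y \<star> f x)"
  unfolding juxt_def
  by (rule linear_lin_ext_param[OF linear_source linear_lin_ext_comp]) auto

lemma linear_dif: "Vector_Spaces.linear s tscale f \<Longrightarrow> Vector_Spaces.linear s tscale (\<lambda>x. dif B (f x))"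
  unfolding dif_def by (rule linear_lin_ext_comp)

lemmas lin_rules = lin_intros linear_juxt_left linear_juxt_right linear_dif linear_psis

lemmas linear_juxt_left' = linear_juxt_left[OF linear_id[OF tscale_vector_space]]
lemmas linear_juxt_right' = linear_juxt_right[OF linear_id[OF tscale_vector_space]]
lemmas linear_dif' = linear_dif[OF linear_id[OF tscale_vector_space]]

lemmas linear_simps = loc_linear tens_linear
  linear_addD[OF linear_juxt_left'] linear_diffD[OF linear_juxt_left'] linear_zeroD[OF linear_juxt_left']
  linear_scaleD[OF linear_juxt_left'] linear_sumD[OF linear_juxt_left']
  linear_addD[OF linear_juxt_right'] linear_diffD[OF linear_juxt_right'] linear_zeroD[OF linear_juxt_right']
  linear_scaleD[OF linear_juxt_right'] linear_sumD[OF linear_juxt_right']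
  linear_addD[OF linear_dif'] linear_diffD[OF linear_dif'] linear_zeroD[OF linear_dif']
  linear_scaleD[OF linear_dif'] linear_sumD[OF linear_dif']
  linear_addD[OF linear_psis'] linear_diffD[OF linear_psis'] linear_zeroD[OF linear_psis']
  linear_scaleD[OF linear_psis'] linear_sumD[OF linear_psis']

lemma dif_homog:
  assumes "t \<in> homog n"
  shows "dif B t = (\<Sum>k\<le>n. tscale ((-1) ^ k) (ins k one t))"
  unfolding dif_def
proof (rule lin_ext_by_length[OF _ _ assms])
  show "linT (\<lambda>t. \<Sum>k\<le>n. tscale ((-1) ^ k) (ins k one t))" for n
    by (intro linear_sum lin_intros)
  fix w :: "('p, 'c, 'v) letter list"
  have "ins k one (pure B w) = pure B (take k w @ LP 1 # drop k w)" if "k \<le> length w" for k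
    using loc_pure_append[OF ops_multilinear(7), of "take k w" k "[]" "drop k w"] that by simp
  then show "(\<Sum>k\<le>length w. tscale ((-1) ^ k) (pure B (take k w @ LP 1 # drop k w))) =
      (\<Sum>k\<le>length w. tscale ((-1) ^ k) (ins k one (pure B w)))"
    by simp
qed

lemma chi_tilde_eq:
  assumes "t \<in> homog 2"
  shows "chi_tilde B t = mu 0 (slotP (Suc 0) (coactP B) t)"
proof -
  let ?G = "\<lambda>(n::nat) t. if n = 2 then mu 0 (slotP (Suc 0) (coactP B) t) else 0"
  have "chi_tilde B t = ?G 2 t"
    unfolding chi_tilde_def
  proof (rule lin_ext_by_length[where G = ?G, OF _ _ assms])
    show "linT (?G n)" for n by (cases "n = 2") (simp_all, (intro lin_intros)+)
    fix w :: "('p, 'c, 'v) letter list"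
    show "(case w of [LP u, LP v] \<Rightarrow> elP B u \<star> coactP B v | _ \<Rightarrow> 0) = ?G (length w) (pure B w)"
    proof (cases "length w = 2")
      case True
      then obtain x y where w: "w = [x, y]" by (auto simp: length_Suc_conv numeral_2_eq_2)
      have "slotP (Suc 0) (coactP B) (pure B ([x] @ [y] @ [])) = pure B [x] \<otimes>\<^sub>k on_P (coactP B) y \<otimes>\<^sub>k pure B []"
        by (subst loc_pure_append) simp_all
      also have "on_P (coactP B) y \<in> homog 2"
        using operator_homog[OF operator_coactP, of "[y]"] by simp
      then have "pure B [x] \<otimes>\<^sub>k on_P (coactP B) y \<otimes>\<^sub>k pure B [] = pure B [x] \<otimes>\<^sub>k on_P (coactP B) y"
        by (simp add: tens_assoc tens_Nil homog_def)
      finally have 1: "slotP (Suc 0) (coactP B) (pure B w) = pure B [x] \<otimes>\<^sub>k on_P (coactP B) y"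
        by (simp add: w)
      show ?thesis
      proof (cases "\<exists>u. x = LP u")
        case True
        then show ?thesis
          using 1 by (cases y) (auto simp: w juxt_mu pure_homog loc_linear)
      next
        case False
        have "mu 0 (pure B [x] \<otimes>\<^sub>k on_P (coactP B) y) = 0"
          by (rule homog_eqI[OF _ _ \<open>on_P (coactP B) y \<in> homog 2\<close>], (intro lin_intros)+)
            (use False loc_pure_append[OF ops_multilinear(2), of "[]" 0 "[x, _]"] in
              \<open>cases x; auto simp: length_Suc_conv numeral_2_eq_2\<close>)
        with False 1 show ?thesis by (cases x) (auto simp: w)
      qed
    next
      case False
      then show ?thesis by (auto split: list.splits letter.splits)
    qed
  qed
  then show ?thesis by simp
qed

lemma slot_at:
  assumes "operator (Suc 0) m (\<lambda>w. f (hd w))" "length u = i"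
  shows "loc i (Suc 0) (\<lambda>w. f (hd w)) (pure B (u @ l # r)) = pure B u \<otimes>\<^sub>k f l \<otimes>\<^sub>k pure B r"
    and "loc i (Suc 0) (\<lambda>w. f (hd w)) (pure B (u @ [l])) = pure B u \<otimes>\<^sub>k f l"
proof -
  show 1: "loc i (Suc 0) (\<lambda>w. f (hd w)) (pure B (u @ l # r)) = pure B u \<otimes>\<^sub>k f l \<otimes>\<^sub>k pure B r" for r
    using loc_pure_append[OF operator_multilinear[OF assms(1)] assms(2), of "[l]" r] by simp
  have "f l \<in> homog m" using operator_homog[OF assms(1), of "[l]"] by simp
  then show "loc i (Suc 0) (\<lambda>w. f (hd w)) (pure B (u @ [l])) = pure B u \<otimes>\<^sub>k f l"
    using 1[of "[]"] by (simp add: tens_assoc tens_Nil homog_def)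
qed

lemma mu_zero_left:
  assumes "y \<in> homog m" "\<And>p. l \<noteq> LP p"
  shows "mu (length u) (pure B (u @ [l]) \<otimes>\<^sub>k y) = 0"
proof (rule homog_eqI[OF _ _ assms(1)], (intro lin_intros)+)
  fix w :: "('p, 'c, 'v) letter list"
  show "mu (length u) (pure B (u @ [l]) \<otimes>\<^sub>k pure B w) = 0"
  proof (cases w)
    case Nil
    then show ?thesis by (simp add: loc_short[OF _ pure_homog])
  next
    case (Cons l' w')
    then show ?thesis
      using loc_pure_append[OF ops_multilinear(2) refl, of "[l, l']" u w'] assms(2)
      by (cases l) auto
  qed
qed

lemma act_form_eq:
  assumes om: "operator (Suc 0) (Suc m) (\<lambda>w. on_C om (hd w))" and t: "t \<in> homog 2"
  shows "lin_ext (\<lambda>w. case w of [LP p, LC c] \<Rightarrow> elP B p \<star> om c | _ \<Rightarrow> 0) t = mu 0 (slotC (Suc 0) om t)"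
proof -
  let ?G = "\<lambda>(n::nat) t. if n = 2 then mu 0 (slotC (Suc 0) om t) else 0"
  have "lin_ext (\<lambda>w. case w of [LP p, LC c] \<Rightarrow> elP B p \<star> om c | _ \<Rightarrow> 0) t = ?G 2 t"
  proof (rule lin_ext_by_length[where G = ?G, OF _ _ t])
    show "linT (?G n)" for n by (cases "n = 2") (simp_all, (intro lin_intros)+)
    fix w :: "('p, 'c, 'v) letter list"
    show "(case w of [LP p, LC c] \<Rightarrow> elP B p \<star> om c | _ \<Rightarrow> 0) = ?G (length w) (pure B w)"
    proof (cases "length w = 2")
      case True
      then obtain x y where w: "w = [x, y]" by (auto simp: length_Suc_conv numeral_2_eq_2)
      have 1: "slotC (Suc 0) om (pure B w) = pure B [x] \<otimes>\<^sub>k on_C om y"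
        using slot_at(2)[OF om, of "[x]" "Suc 0" y] by (simp add: w)
      have h: "on_C om y \<in> homog (Suc m)" using operator_homog[OF om, of "[y]"] by simp
      show ?thesis
      proof (cases "\<exists>u. x = LP u")
        case True
        then show ?thesis
          using 1 by (cases y) (auto simp: w juxt_mu pure_homog loc_linear)
      next
        case False
        then show ?thesis using 1 mu_zero_left[OF h, of x "[]"] by (cases x) (auto simp: w)
      qed
    next
      case False
      then show ?thesis by (auto split: list.splits letter.splits)
    qed
  qed
  then show ?thesis by simp
qed

lemma act_pair_eq:
  assumes om: "operator (Suc 0) (Suc m) (\<lambda>w. on_C om (hd w))"
    and ph: "operator (Suc 0) n (\<lambda>w. on_V ph (hd w))" and t: "t \<in> homog 2"
  shows "lin_ext (\<lambda>w. case w of [LC c, LV x] \<Rightarrow> om c \<star> ph x | _ \<Rightarrow> 0) t =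
    mu m (slotC 0 om (slotV (Suc 0) ph t))"
proof -
  let ?G = "\<lambda>(n::nat) t. if n = 2 then mu m (slotC 0 om (slotV (Suc 0) ph t)) else 0"
  have "lin_ext (\<lambda>w. case w of [LC c, LV x] \<Rightarrow> om c \<star> ph x | _ \<Rightarrow> 0) t = ?G 2 t"
  proof (rule lin_ext_by_length[where G = ?G, OF _ _ t])
    show "linT (?G n)" for n by (cases "n = 2") (simp_all, (intro lin_intros)+)
    fix w :: "('p, 'c, 'v) letter list"
    show "(case w of [LC c, LV x] \<Rightarrow> om c \<star> ph x | _ \<Rightarrow> 0) = ?G (length w) (pure B w)"
    proof (cases "length w = 2")
      case True
      then obtain x y where w: "w = [x, y]" by (auto simp: length_Suc_conv numeral_2_eq_2)
      have "slotV (Suc 0) ph (pure B w) = pure B [x] \<otimes>\<^sub>k on_V ph y"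
        using slot_at(2)[OF ph, of "[x]" "Suc 0" y] by (simp add: w)
      also have "slotC 0 om \<dots> = slotC 0 om (pure B [x]) \<otimes>\<^sub>k on_V ph y"
        by (rule loc_tens_left[OF operator_multilinear[OF om] pure_homog[of "[x]" "Suc 0"]]) simp_all
      also have "slotC 0 om (pure B [x]) = on_C om x"
        using loc_exact[OF om, of "[x]"] by simp
      finally have 1: "slotC 0 om (slotV (Suc 0) ph (pure B w)) = on_C om x \<otimes>\<^sub>k on_V ph y" .
      have h: "on_C om x \<in> homog (Suc m)" using operator_homog[OF om, of "[x]"] by simp
      show ?thesis using 1 h
        by (cases x; cases y) (auto simp: w juxt_mu loc_linear)
    next
      case False
      then show ?thesis by (auto split: list.splits letter.splits)
    qed
  qed
  then show ?thesis by simp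
qed

lemma contract_eq:
  assumes th: "operator (Suc 0) m (\<lambda>w. on_V th (hd w))" and t: "t \<in> homog (Suc (Suc n))"
  shows "contract B th t = mu n (slotV (Suc n) th t)"
proof -
  let ?G = "\<lambda>l t. case l of 0 \<Rightarrow> 0 | Suc l' \<Rightarrow> (case l' of 0 \<Rightarrow> 0 | Suc n \<Rightarrow> mu n (slotV (Suc n) th t))"
  have "contract B th t = ?G (Suc (Suc n)) t"
    unfolding contract_def
  proof (rule lin_ext_by_length[OF _ _ t])
    show "linT (?G n)" for n by (intro linear_case_nat lin_intros)
    fix w :: "('p, 'c, 'v) letter list"
    show "(case rev w of LV v # r \<Rightarrow> pure B (rev r) \<star> th v | _ \<Rightarrow> 0) = ?G (length w) (pure B w)"
    proof (cases w rule: rev_cases)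
      case (snoc u l)
      show ?thesis
      proof (cases "length u")
        case 0
        then show ?thesis using snoc by (simp add: juxt_length[OF pure_homog] split: letter.splits)
      next
        case (Suc n)
        then have "slotV (Suc n) th (pure B w) = pure B u \<otimes>\<^sub>k on_V th l"
          using slot_at(2)[OF th, of u "Suc n" l] by (simp add: snoc)
        then show ?thesis
          using Suc snoc juxt_length[OF pure_homog, OF Suc] by (cases l) (simp_all add: loc_linear)
      qed
    qed simp
  qed
  then show ?thesis by simp
qed

lemma loc_add: "loc i k (\<lambda>w. f w + g w) t = loc i k f t + loc i k g t"
  and loc_diff: "loc i k (\<lambda>w. f w - g w) t = loc i k f t - loc i k g t"
  by (rule linear_eq_on_words[of _ _ t]; (intro lin_intros)?; simp add: loc_word_arg loc_word_def tens_linear)+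

lemma slotC_add: "slotC i (\<lambda>c. f c + g c) t = slotC i f t + slotC i g t"
  and slotC_diff: "slotC i (\<lambda>c. f c - g c) t = slotC i f t - slotC i g t"
proof -
  have "on_C (\<lambda>c. f c + g c) l = on_C f l + on_C g l" "on_C (\<lambda>c. f c - g c) l = on_C f l - on_C g l"
    for l :: "('p, 'c, 'v) letter"
    by (cases l; simp)+
  then show "slotC i (\<lambda>c. f c + g c) t = slotC i f t + slotC i g t"
    "slotC i (\<lambda>c. f c - g c) t = slotC i f t - slotC i g t"
    by (simp_all add: loc_add loc_diff)
qed

lemma slotV_add: "slotV i (\<lambda>c. f c + g c) t = slotV i f t + slotV i g t"
proof -
  have "on_V (\<lambda>c. f c + g c) l = on_V f l + on_V g l" for l :: "('p, 'c, 'v) letter"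
    by (cases l) simp_all
  then show ?thesis by (simp add: loc_add)
qed

lemma slotC_counit_scaled:
  assumes x: "x \<in> homog m"
  shows "slotC i (\<lambda>c. tscale (counit B c) x) t = ins i x (slotC i eps t)"
proof -
  have "ins 0 x (pure B []) = x"
    using loc_pure_append[OF operator_multilinear[OF operator_ins[OF x]], of "[]" 0 "[]" "[]"] x
    by (simp add: tens_Nil homog_def)
  then have "(\<lambda>c. tscale (counit B c) x) = (\<lambda>c. ins 0 x (eps c))"
    by (simp add: loc_linear)
  then show ?thesis
    using slotC_comp[OF operator_multilinear[OF operator_ins[OF x]] _ operator_eps, of 0 i t] by simp
qed

lemma eps_shaped: "eps c \<in> shaped []"
  by (intro shaped_scale pure_shaped) simp

lemma slotP_diff: "slotP i (\<lambda>c. f c - g c) t = slotP i f t - slotP i g t"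
proof -
  have "on_P (\<lambda>c. f c - g c) l = on_P f l - on_P g l" for l :: "('p, 'c, 'v) letter"
    by (cases l) simp_all
  then show ?thesis by (simp add: loc_diff)
qed

lemma slotV_sum:
  "slotV i (\<lambda>x. \<Sum>j\<in>J. tscale (a j) (f j x)) t = (\<Sum>j\<in>J. tscale (a j) (slotV i (f j) t))"
proof -
  have "on_V (\<lambda>x. \<Sum>j\<in>J. tscale (a j) (f j x)) l = (\<Sum>j\<in>J. tscale (a j) (on_V (f j) l))"
    for l :: "('p, 'c, 'v) letter"
    by (cases l) simp_all
  then show ?thesis
    by - (rule linear_eq_on_words[of _ _ t], (intro linear_sum lin_intros)+,
      simp add: loc_word_arg loc_word_def tens_linear)
qed

section \<open>The coaction on the total space and its invariants\<close>

text \<open>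
  The coaction on a factor in the middle of a tensor is \<open>\<psi>\<close> after insertion of the
  group-like element, so that the exchange laws for \<open>\<psi>\<close> apply to it.
\<close>

lemma slotP_coactP: "slotP i (coactP B) t = psi i (ins i grp t)"
proof (rule linear_eq_on_words[of _ _ t], (intro lin_intros)+)
  fix w :: "('p, 'c, 'v) letter list"
  show "slotP i (coactP B) (word w) = psi i (ins i grp (word w))"
  proof (cases "i + 1 \<le> length w")
    case True
    then obtain u b r where w: "w = u @ b @ r" "length u = i" "length b = 1" by (rule word_split3)
    then obtain l where l: "b = [l]" by (auto simp: length_Suc_conv)
    have "slotP i (coactP B) (word w) = pure B u \<otimes>\<^sub>k on_P (coactP B) l \<otimes>\<^sub>k pure B r"
      using loc_word_append[of u i b "Suc 0" _ r] w by (simp add: l loc_word_arg)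
    moreover have "ins i grp (word w) = pure B (u @ [LC (grouplike B), l] @ r)"
      using loc_word_append[of u i "[]" 0 _ "b @ r"] w by (simp add: l loc_word_arg)
    moreover have "psi i (pure B (u @ [LC (grouplike B), l] @ r)) =
        pure B u \<otimes>\<^sub>k psi_word [LC (grouplike B), l] \<otimes>\<^sub>k pure B r"
      using w by (intro loc_pure_append) simp_all
    ultimately show ?thesis by (cases l) (simp_all add: coactP_def)
  next
    case False
    have "psi i (ins i grp (word w)) = 0"
    proof (cases "i \<le> length w")
      case True
      then have "ins i grp (word w) \<in> homog (length w + 1)"
        using loc_homog[OF operator_grp pure_homog[of w], of "length w" i "length w + 1"]
        by (simp add: loc_word_arg loc_pure)
      then show ?thesis by (rule loc_short[rotated]) (use False in auto)
    qed (simp add: loc_word_arg loc_word_short loc_linear)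
    then show ?thesis using False by (simp add: loc_word_arg loc_word_short)
  qed
qed

lemma ins_end: "t \<in> homog n \<Longrightarrow> x \<in> homog m \<Longrightarrow> ins n x t = t \<otimes>\<^sub>k x"
proof (rule homog_eqI[of "ins n x" "\<lambda>t. t \<otimes>\<^sub>k x"], (intro lin_intros)+, assumption)
  fix w :: "('p, 'c, 'v) letter list" assume "x \<in> homog m" "length w = n"
  then show "ins n x (pure B w) = pure B w \<otimes>\<^sub>k x"
    using loc_pure_append[OF operator_multilinear[OF operator_ins], of x m w n "[]" "[]"]
    by (simp add: tens_assoc tens_Nil homog_def)
qed

lemma ins_front: "t \<in> homog n \<Longrightarrow> x \<in> homog m \<Longrightarrow> ins 0 x t = x \<otimes>\<^sub>k t"
proof (rule homog_eqI[of "ins 0 x" "\<lambda>t. x \<otimes>\<^sub>k t"], (intro lin_intros)+, assumption)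
  fix w :: "('p, 'c, 'v) letter list" assume "x \<in> homog m"
  then show "ins 0 x (pure B w) = x \<otimes>\<^sub>k pure B w"
    using loc_pure_append[OF operator_multilinear[OF operator_ins], of x m "[]" 0 "[]" w]
    by (simp add: tens_Nil homog_def)
qed

lemma coactP_mult: "coactP B (p * q) = mu 0 (psi (Suc 0) (coactP B p \<otimes>\<^sub>k elP B q))"
proof -
  have "coactP B (p * q) = mu 0 (psi (Suc 0) (psi 0 (pure B [LC (grouplike B), LP p, LP q])))"
    using entw unfolding coactP_def entwining_structure_def by (simp add: psi_at_loc mult_at_loc)
  also have "psi 0 (pure B [LC (grouplike B), LP p, LP q]) = coactP B p \<otimes>\<^sub>k elP B q"
    using loc_pure_append[OF ops_multilinear(1), of "[]" 0 "[LC (grouplike B), LP p]" "[LP q]"]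
    by (simp add: coactP_def tens_Nil(2)[OF entwine_shaped])
  finally show ?thesis .
qed

lemma base_iff: "m \<in> base_alg B \<longleftrightarrow> coactP B m = pure B [LP m, LC (grouplike B)]"
  by (simp add: base_alg_def)

lemma coactP_base_mult:
  assumes "m \<in> base_alg B"
  shows "coactP B (m * q) = mu 0 (elP B m \<otimes>\<^sub>k coactP B q)"
proof -
  have "coactP B (m * q) = mu 0 (psi (Suc 0) (pure B ([LP m] @ [LC (grouplike B), LP q] @ [])))"
    using assms by (simp add: coactP_mult base_iff)
  also have "psi (Suc 0) (pure B ([LP m] @ [LC (grouplike B), LP q] @ [])) = elP B m \<otimes>\<^sub>k coactP B q"
    by (subst loc_pure_append)
      (simp_all add: coactP_def tens_assoc tens_Nil(1)[OF entwine_shaped])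
  finally show ?thesis .
qed

lemma base_mult: "m \<in> base_alg B \<Longrightarrow> n \<in> base_alg B \<Longrightarrow> m * n \<in> base_alg B"
  using loc_pure_append[OF ops_multilinear(2), of "[]" 0 "[LP m, LP n]" "[LC (grouplike B)]"]
  by (simp add: base_iff coactP_base_mult)

lemma coactP_one: "coactP B 1 = pure B [LP 1, LC (grouplike B)]"
  using entw by (simp add: coactP_def entwining_structure_def)

lemma base_one: "1 \<in> base_alg B"
  by (simp add: base_iff coactP_one)

text \<open>
  The base algebra is the kernel of this linear map, which allows arguments of linear
  algebra about it.
\<close>

definition defect where "defect u = coactP B u - elP B u \<otimes>\<^sub>k grp"

lemma defect_linear: "Vector_Spaces.linear (scaleP B) tscale defect"
  unfolding defect_def[abs_def] by (intro linear_minus coactP_linear lin_intros linear_elP)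

lemma defect_zero: "defect u = 0 \<longleftrightarrow> u \<in> base_alg B"
  by (simp add: defect_def base_iff)

lemma base_subspace: "module.subspace (scaleP B) (base_alg B)"
proof -
  interpret sP: vector_space "scaleP B" by (rule vsP)
  show ?thesis
    unfolding sP.subspace_def
    by (simp add: linear_zeroD[OF defect_linear] linear_addD[OF defect_linear] linear_scaleD[OF defect_linear]
        flip: defect_zero)
qed

lemma base_projection:
  obtains \<pi> where "Vector_Spaces.linear (scaleP B) (scaleP B) \<pi>" "\<And>p. \<pi> p \<in> base_alg B"
    "\<And>m. m \<in> base_alg B \<Longrightarrow> \<pi> m = m"
  using left_inverse_on[OF linear_id[OF vsP] base_subspace, of thesis] by auto

abbreviation Ms :: "('p, 'c, 'v) letter set" where "Ms \<equiv> LP ` base_alg B"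

lemma elP_homog: "elP B p \<in> homog (Suc 0)"
  by (simp add: pure_homog)

lemma elP_shaped: "p \<in> A \<Longrightarrow> elP B p \<in> shaped [LP ` A]"
  by (rule pure_shaped) simp

lemma elP_shaped_P [simp]: "elP B p \<in> shaped [Ps]"
  by (rule elP_shaped) simp

text \<open>
  Let \<open>\<pi>\<close> be a linear projection of \<open>P\<close> onto the base. As the base is the kernel of the
  defect, some linear \<open>g\<close> satisfies \<open>g(defect u) = u - \<pi>(u)\<close>. Applied to the second factor
  of \<open>(id \<otimes> defect)(x) = 0\<close> it yields \<open>x = (id \<otimes> \<pi>)(x)\<close>.
\<close>

lemma invariant_right_factor:
  assumes x: "x \<in> shaped [Ps, Ps]" and inv: "slotP (Suc 0) (coactP B) x = ins 2 grp x"
  shows "x \<in> shaped [Ps, Ms]"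
proof -
  obtain \<pi> where \<pi>: "Vector_Spaces.linear (scaleP B) (scaleP B) \<pi>" "\<And>p. \<pi> p \<in> base_alg B"
    "\<And>m. m \<in> base_alg B \<Longrightarrow> \<pi> m = m"
    by (rule base_projection) blast
  have kerpi: "module.subspace (scaleP B) {u. \<pi> u = 0}"
  proof -
    interpret sP: vector_space "scaleP B" by (rule vsP)
    show ?thesis
      unfolding sP.subspace_def
      by (simp add: linear_zeroD[OF \<pi>(1)] linear_addD[OF \<pi>(1)] linear_scaleD[OF \<pi>(1)])
  qed
  obtain g where g: "Vector_Spaces.linear tscale (scaleP B) g" "\<And>u. \<pi> u = 0 \<Longrightarrow> g (defect u) = u"
  proof (rule left_inverse_on[OF defect_linear kerpi])
    show "u = 0" if "u \<in> {u. \<pi> u = 0}" "defect u = 0" for u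
      using that \<pi>(3)[of u] by (simp add: defect_zero)
  qed blast
  \<comment> \<open>the defect does not see \<open>\<pi>(u)\<close>, and \<open>u - \<pi>(u)\<close> lies where \<open>g\<close> inverts it\<close>
  have g_defect: "g (defect u) = u - \<pi> u" for u
  proof -
    have "\<pi> (u - \<pi> u) = 0" by (simp add: linear_diffD[OF \<pi>(1)] \<pi>(2,3))
    moreover have "defect (u - \<pi> u) = defect u"
      using defect_zero[of "\<pi> u"] \<pi>(2) by (simp add: linear_diffD[OF defect_linear])
    ultimately show ?thesis using g(2)[of "u - \<pi> u"] by simp
  qed
  have G: "linT (\<lambda>t. elP B (g t))" by (rule linear_comp[OF g(1) linear_elP])
  have "defect u \<in> homog 2" for u
    unfolding defect_def using homog2[OF coactP_shaped] by (intro homog_diff) (simp_all add: pure_homog)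
  then have op: "operator (Suc 0) 2 (\<lambda>w. on_P defect (hd w))"
    by (rule operator_P[OF defect_linear])
  have "operator (Suc 0) (Suc 0) (\<lambda>w. on_P (\<lambda>u. elP B (\<pi> u)) (hd w))"
    by (rule operator_P[OF linear_comp[OF \<pi>(1) linear_elP] elP_homog])
  note op_pi = this
  have "slotP (Suc 0) defect x = slotP (Suc 0) (coactP B) x - ins 2 grp x"
  proof (rule shaped_eqI[OF _ _ x], (intro lin_intros)+)
    fix w assume "list_all2 (\<in>) w [Ps, Ps]"
    then obtain a b where w: "w = [LP a, LP b]" by (auto simp: list_all2_Cons2)
    show "slotP (Suc 0) defect (pure B w) = slotP (Suc 0) (coactP B) (pure B w) - ins 2 grp (pure B w)"
      using slot_at(2)[OF op, of "[LP a]" "Suc 0" "LP b"] slot_at(2)[OF operator_coactP, of "[LP a]" "Suc 0" "LP b"]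
        ins_end[OF pure_homog[of "[LP a, LP b]" 2] pure_homog[of "[LC (grouplike B)]" "Suc 0"]]
      by (simp add: w defect_def[of b] tens_linear)
  qed
  then have "0 = loc (Suc 0) 2 (\<lambda>w. elP B (g (pure B w))) (slotP (Suc 0) defect x)"
    using inv by (simp add: loc_linear)
  also have "\<dots> = loc (Suc 0) (Suc 0) (\<lambda>w. elP B (g (on_P defect (hd w)))) x"
    by (rule loc_linear_comp[OF op G, symmetric])
  also have "\<dots> = x - slotP (Suc 0) (\<lambda>u. elP B (\<pi> u)) x"
  proof (rule shaped_eqI[OF _ _ x], (intro lin_intros)+)
    fix w assume "list_all2 (\<in>) w [Ps, Ps]"
    then obtain a b where w: "w = [LP a, LP b]" by (auto simp: list_all2_Cons2)
    have "multilinear B (Suc 0) (\<lambda>w. elP B (g (on_P defect (hd w))))"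
      using multilinear_comp[OF operator_multilinear[OF op] G] .
    from loc_pure_append[OF this, of "[LP a]" "Suc 0" "[LP b]" "[]"]
    show "loc (Suc 0) (Suc 0) (\<lambda>w. elP B (g (on_P defect (hd w)))) (pure B w) =
        pure B w - slotP (Suc 0) (\<lambda>u. elP B (\<pi> u)) (pure B w)"
      using slot_at(2)[OF op_pi, of "[LP a]" "Suc 0" "LP b"]
      by (simp add: w g_defect linear_diffD[OF linear_elP] tens_linear)
  qed
  finally have "x = slotP (Suc 0) (\<lambda>u. elP B (\<pi> u)) x" by simp
  also have "\<dots> \<in> shaped ([Ps] @ [Ms] @ [])"
    by (rule loc_shaped[of _ _ "[Ps]"])
      (use x in \<open>auto simp: operator_multilinear[OF op_pi] list_all2_Cons2 \<pi>(2) intro!: elP_shaped\<close>)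
  finally show ?thesis by simp
qed

text \<open>
  A projection onto the base, applied to the first factor, fixes \<open>x\<close> by the second
  hypothesis and takes it to the claimed space by the first.
\<close>

lemma base_first_factor:
  assumes x: "x \<in> shaped (Ps # Ls)" and x': "x \<in> shaped (Ms # Ls')"
  shows "x \<in> shaped (Ms # Ls)"
proof -
  obtain \<pi> where \<pi>: "Vector_Spaces.linear (scaleP B) (scaleP B) \<pi>" "\<And>p. \<pi> p \<in> base_alg B"
    "\<And>m. m \<in> base_alg B \<Longrightarrow> \<pi> m = m"
    by (rule base_projection) blast
  have op: "operator (Suc 0) (Suc 0) (\<lambda>w. on_P (\<lambda>u. elP B (\<pi> u)) (hd w))"
    by (rule operator_P[OF linear_comp[OF \<pi>(1) linear_elP] elP_homog])
  have "slotP 0 (\<lambda>u. elP B (\<pi> u)) x = x"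
  proof (rule shaped_eqI[OF _ _ x'], (intro lin_intros)+)
    fix w assume "list_all2 (\<in>) w (Ms # Ls')"
    then obtain m r where w: "w = LP m # r" "m \<in> base_alg B" by (auto simp: list_all2_Cons2)
    then show "slotP 0 (\<lambda>u. elP B (\<pi> u)) (pure B w) = pure B w"
      using slot_at(1)[OF op, of "[]" 0 "LP m" r] by (simp add: \<pi>(3))
  qed
  moreover have "slotP 0 (\<lambda>u. elP B (\<pi> u)) x \<in> shaped ([] @ [Ms] @ Ls)"
    by (rule loc_shaped[of _ _ "[Ps]"])
      (use x in \<open>auto simp: operator_multilinear[OF op] list_all2_Cons2 \<pi>(2) intro!: elP_shaped\<close>)
  ultimately show ?thesis by simp
qed

text \<open>
  By definition of the base, \<open>\<psi>(e \<otimes> m) = m \<otimes> e\<close> for each of its elements \<open>m\<close>.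
\<close>

lemma psis_base:
  assumes "x \<in> shaped (replicate n Ms)"
  shows "psis 0 n (grp \<otimes>\<^sub>k x) = x \<otimes>\<^sub>k grp"
proof (rule shaped_eqI[OF _ _ assms], (intro lin_rules)+)
  fix w assume "list_all2 (\<in>) w (replicate n Ms)"
  then show "psis 0 n (grp \<otimes>\<^sub>k pure B w) = pure B w \<otimes>\<^sub>k grp"
  proof (induction w arbitrary: n)
    case (Cons l w)
    then obtain k m where n: "n = Suc k" "l = LP m" "m \<in> base_alg B" "list_all2 (\<in>) w (replicate k Ms)"
      by (cases n) auto
    have "psi 0 (pure B (LC (grouplike B) # LP m # w)) = coactP B m \<otimes>\<^sub>k pure B w"
      using loc_pure_append[OF ops_multilinear(1), of "[]" 0 "[LC (grouplike B), LP m]" w]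
      by (simp add: coactP_def tens_Nil(2)[OF entwine_shaped])
    also have "\<dots> = elP B m \<otimes>\<^sub>k (grp \<otimes>\<^sub>k pure B w)"
      using n(3) by (simp add: base_iff)
    finally have "psis 0 n (grp \<otimes>\<^sub>k pure B (l # w)) = psis (Suc 0) k (elP B m \<otimes>\<^sub>k (grp \<otimes>\<^sub>k pure B w))"
      using psis_add[of 0 "Suc 0" k] by (simp add: n)
    also have "\<dots> = elP B m \<otimes>\<^sub>k psis 0 k (grp \<otimes>\<^sub>k pure B w)"
      using psis_tens_right[OF elP_homog[of m], of 0] by (simp del: tens_pure)
    also have "\<dots> = pure B (l # w) \<otimes>\<^sub>k grp"
      unfolding Cons.IH[OF n(4)] by (simp add: n)
    finally show ?case .
  qed simp
qed

section \<open>Universal forms\<close>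

lemma list_all2_replicate_mem: "list_all2 (\<in>) w (replicate n S) \<longleftrightarrow> length w = n \<and> set w \<subseteq> S"
  by (auto simp: list_all2_conv_all_nth in_set_conv_nth) (meson nth_mem subsetD)

lemma shaped_replicate:
  "shaped (replicate n (LP ` A)) = tspan {pure B (map LP us) | us. length us = n \<and> set us \<subseteq> A}"
proof -
  have "{pure B w | w. list_all2 (\<in>) w (replicate n (LP ` A))} =
      {pure B (map LP us) | us. length us = n \<and> set us \<subseteq> A}" (is "?X = ?Y")
  proof
    show "?X \<subseteq> ?Y"
    proof
      fix x assume "x \<in> ?X"
      then obtain w where w: "x = pure B w" "length w = n" "w \<in> lists (LP ` A)"
        by (auto simp: list_all2_replicate_mem)
      then obtain us where "w = map LP us" "us \<in> lists A" unfolding lists_image by blast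
      with w show "x \<in> ?Y" by auto
    qed
    show "?Y \<subseteq> ?X"
    proof
      fix x assume "x \<in> ?Y"
      then obtain us where us: "x = pure B (map LP us)" "length us = n" "set us \<subseteq> A" by blast
      then have "list_all2 (\<in>) (map LP us) (replicate n (LP ` A))"
        by (auto simp: list_all2_replicate_mem)
      with us(1) show "x \<in> ?X" by blast
    qed
  qed
  then show ?thesis by (simp add: shaped_def)
qed

lemma Omega_P_iff: "x \<in> Omega_P B n \<longleftrightarrow> x \<in> shaped (replicate (Suc n) Ps) \<and> (\<forall>i<n. mu i x = 0)"
  using shaped_replicate[of "Suc n" UNIV] by (simp add: Omega_P_def mult_at_loc)

lemma Omega_M_iff: "x \<in> Omega_M B n \<longleftrightarrow> x \<in> shaped (replicate (Suc n) Ms) \<and> (\<forall>i<n. mu i x = 0)"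
  using shaped_replicate[of "Suc n" "base_alg B"] by (simp add: Omega_M_def mult_at_loc)

lemma mu_pure: "mu 0 (pure B (LP a # LP b # w)) = pure B (LP (a * b) # w)"
  using loc_pure_append[OF ops_multilinear(2), of "[]" 0 "[LP a, LP b]" w] by simp

lemma mu_one: "x \<in> shaped (Ps # Ls) \<Longrightarrow> mu 0 (one \<otimes>\<^sub>k x) = x"
  by (rule shaped_eqI[of "\<lambda>x. mu 0 (one \<otimes>\<^sub>k x)" "\<lambda>x. x"], (intro lin_intros)+, assumption)
    (auto simp: list_all2_Cons2 mu_pure)

lemma dif_pure: "dif B (pure B w) = (\<Sum>k\<le>length w. tscale ((-1) ^ k) (pure B (take k w @ LP 1 # drop k w)))"
proof -
  have "ins k one (pure B w) = pure B (take k w @ LP 1 # drop k w)" if "k \<le> length w" for k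
    using loc_pure_append[OF ops_multilinear(7), of "take k w" k "[]" "drop k w"] that by simp
  then show ?thesis by (simp add: dif_homog[OF pure_homog])
qed

lemma dif_Cons: "dif B (pure B (l # w)) = pure B (LP 1 # l # w) - pure B [l] \<otimes>\<^sub>k dif B (pure B w)"
  by (simp add: dif_pure sum.atMost_Suc_shift tens_linear sum_negf del: sum.atMost_Suc)

lemma dif_elP: "dif B (elP B p) = pure B [LP 1, LP p] - pure B [LP p, LP 1]"
  by (simp add: dif_Cons dif_pure[of "[]", simplified])

section \<open>Products and differentials of forms over the base\<close>

lemma mu_tens_right: "x \<in> homog a \<Longrightarrow> mu (a + i) (x \<otimes>\<^sub>k y) = x \<otimes>\<^sub>k mu i y"
  by (rule loc_tens_right[OF ops_multilinear(2)])

lemma mu_tens_left: "x \<in> homog a \<Longrightarrow> i + 2 \<le> a \<Longrightarrow> mu i (x \<otimes>\<^sub>k y) = mu i x \<otimes>\<^sub>k y"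
  by (rule loc_tens_left[OF ops_multilinear(2)])

lemma juxt_homog:
  assumes "x \<in> homog (Suc a)" "y \<in> homog (Suc b)"
  shows "x \<star> y \<in> homog (Suc (a + b))"
  unfolding juxt_mu[OF assms(1)]
  by (rule loc_homog[OF operator_mult tens_homog[OF assms]]) simp_all

lemma juxt_elP: "elP B p \<star> x = mu 0 (elP B p \<otimes>\<^sub>k x)"
  by (rule juxt_mu[OF elP_homog])

lemma juxt_elP_assoc:
  assumes z: "z \<in> homog (Suc a)"
  shows "(elP B p \<star> z) \<star> x = elP B p \<star> (z \<star> x)"
proof -
  have "(elP B p \<star> z) \<star> x = mu a (mu 0 (elP B p \<otimes>\<^sub>k z) \<otimes>\<^sub>k x)"
    using juxt_mu[of "elP B p \<star> z" a] juxt_homog[OF elP_homog z] by (simp add: juxt_elP)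
  also have "\<dots> = mu a (mu 0 ((elP B p \<otimes>\<^sub>k z) \<otimes>\<^sub>k x))"
    using mu_tens_left[OF tens_homog[OF elP_homog z], of 0] by simp
  also have "\<dots> = mu 0 (mu (Suc a) (elP B p \<otimes>\<^sub>k (z \<otimes>\<^sub>k x)))"
    using mu_mu[of 0 "Suc a"] by (simp add: tens_assoc)
  also have "mu (Suc a) (elP B p \<otimes>\<^sub>k (z \<otimes>\<^sub>k x)) = elP B p \<otimes>\<^sub>k (z \<star> x)"
    using mu_tens_right[OF elP_homog[of p], of a] by (simp add: juxt_mu[OF z])
  finally show ?thesis by (simp add: juxt_elP)
qed

text \<open>
  The products before the junction act on \<open>x\<close>, all others on \<open>y\<close>; the product formed at
  the junction itself is moved out of the way by associativity.
\<close>

lemma mu_juxt_zero: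
  assumes x: "x \<in> homog (Suc a)" "\<And>i. i < a \<Longrightarrow> mu i x = 0"
    and y: "\<And>i. i < b \<Longrightarrow> mu i y = 0" and i: "i < a + b"
  shows "mu i (x \<star> y) = 0"
proof (cases "i < a")
  case True
  then have "mu i (x \<star> y) = mu (a - 1) (mu i (x \<otimes>\<^sub>k y))"
    unfolding juxt_mu[OF x(1)] by (rule mu_mu)
  also have "mu i (x \<otimes>\<^sub>k y) = 0"
    using mu_tens_left[OF x(1), of i] x(2)[OF True] True by simp
  finally show ?thesis by (simp add: loc_linear)
next
  case False
  then have "mu i (x \<star> y) = mu a (mu (Suc i) (x \<otimes>\<^sub>k y))"
    unfolding juxt_mu[OF x(1)] using mu_mu[of a "Suc i"] by simp
  also have "mu (Suc i) (x \<otimes>\<^sub>k y) = 0"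
    using mu_tens_right[OF x(1), of "i - a"] y[of "i - a"] False i by simp
  finally show ?thesis by (simp add: loc_linear)
qed

lemma mult_word_shaped:
  assumes "list_all2 (\<in>) b [Ps, Ps]"
  shows "mult_word b \<in> shaped [Ps]"
  using assms by (auto simp: list_all2_Cons2)

lemma mu_shaped_replicate:
  assumes "x \<in> shaped (Ls1 @ Ps # Ps # Ls3)" "i = length Ls1"
  shows "mu i x \<in> shaped (Ls1 @ Ps # Ls3)"
proof -
  have "mu i x \<in> shaped (Ls1 @ [Ps] @ Ls3)"
    by (rule loc_shaped[of _ _ "[Ps, Ps]"]) (use assms mult_word_shaped in auto)
  then show ?thesis by simp
qed

lemma mult_word_base_shaped:
  assumes "list_all2 (\<in>) b [Ms, Ms]"
  shows "mult_word b \<in> shaped [Ms]"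
  using assms by (auto simp: list_all2_Cons2 base_mult intro!: elP_shaped)

lemma Omega_M_shaped: "x \<in> Omega_M B n \<Longrightarrow> x \<in> shaped (replicate (Suc n) Ms)"
  by (simp add: Omega_M_iff)

lemma Omega_M_homog: "x \<in> Omega_M B n \<Longrightarrow> x \<in> homog (Suc n)"
  by (rule shaped_homog[OF Omega_M_shaped]) simp_all

lemma Omega_M_juxt:
  assumes x: "x \<in> Omega_M B a" and y: "y \<in> Omega_M B b"
  shows "x \<star> y \<in> Omega_M B (a + b)"
proof -
  have "x \<otimes>\<^sub>k y \<in> shaped (replicate a Ms @ [Ms, Ms] @ replicate b Ms)"
    using tens_shaped[OF Omega_M_shaped[OF x] Omega_M_shaped[OF y]]
    by (simp flip: replicate_append_same)
  then have "mu a (x \<otimes>\<^sub>k y) \<in> shaped (replicate a Ms @ [Ms] @ replicate b Ms)"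
    by (rule loc_shaped[rotated 3]) (simp_all add: mult_word_base_shaped)
  then have "x \<star> y \<in> shaped (replicate (Suc (a + b)) Ms)"
    by (simp add: juxt_mu[OF Omega_M_homog[OF x]] replicate_add replicate_app_Cons_same)
  moreover have "mu i (x \<star> y) = 0" if "i < a + b" for i
    by (rule mu_juxt_zero[OF Omega_M_homog[OF x] _ _ that])
      (use x y in \<open>auto simp: Omega_M_iff\<close>)
  ultimately show ?thesis by (simp add: Omega_M_iff)
qed

lemma mu_ins_one:
  assumes "t \<in> shaped (replicate (Suc n) Ps)" "i \<le> n"
  shows "mu i (ins i one t) = t" "mu i (ins (Suc i) one t) = t"
proof -
  have split: "\<exists>u p r. w = u @ LP p # r \<and> length u = i" if w: "list_all2 (\<in>) w (replicate (Suc n) Ps)" for w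
  proof -
    have "length w = Suc n" "set w \<subseteq> Ps" using w unfolding list_all2_replicate_mem by auto
    then have "w = take i w @ w ! i # drop (Suc i) w" "w ! i \<in> Ps"
      using assms(2) by (auto simp: id_take_nth_drop)
    moreover have "length (take i w) = i" using \<open>length w = Suc n\<close> assms(2) by simp
    ultimately show ?thesis by (metis imageE)
  qed
  have 1: "mu i (pure B (u @ LP a # LP b # r)) = pure B (u @ LP (a * b) # r)" if "length u = i" for u a b r
    using loc_pure_append[OF ops_multilinear(2) that, of "[LP a, LP b]" r] by simp
  have "mu i (ins i one (pure B w)) = pure B w" "mu i (ins (Suc i) one (pure B w)) = pure B w"
    if w: "list_all2 (\<in>) w (replicate (Suc n) Ps)" for w
  proof -
    obtain u p r where u: "w = u @ LP p # r" "length u = i" using split[OF w] by blast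
    have "ins i one (pure B w) = pure B (u @ LP 1 # LP p # r)"
      using loc_pure_append[OF ops_multilinear(7) u(2), of "[]" "LP p # r"] by (simp add: u)
    moreover have "ins (Suc i) one (pure B w) = pure B (u @ LP p # LP 1 # r)"
      using loc_pure_append[OF ops_multilinear(7), of "u @ [LP p]" "Suc i" "[]" r] u by simp
    ultimately show "mu i (ins i one (pure B w)) = pure B w" "mu i (ins (Suc i) one (pure B w)) = pure B w"
      by (simp_all add: 1[OF u(2)] u(1))
  qed
  then show "mu i (ins i one t) = t" "mu i (ins (Suc i) one t) = t"
    by - (rule shaped_eqI[OF _ _ assms(1)], (intro lin_intros)+, assumption)+
qed

text \<open>
  Of the units that \<open>d\<close> inserts, only those directly before and after the factor \<open>i\<close>
  survive the \<open>i\<close>-th product. Both give back \<open>t\<close>, with opposite signs.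
\<close>

lemma mu_dif_zero:
  assumes t: "t \<in> shaped (replicate (Suc n) Ps)" and zero: "\<And>i. i < n \<Longrightarrow> mu i t = 0"
    and i: "i \<le> n"
  shows "mu i (dif B t) = 0"
proof -
  have "mu i (ins k one t) = (if k = i then t else 0) + (if k = Suc i then t else 0)" if "k \<le> Suc n" for k
  proof -
    consider "k < i" | "k = i" | "k = Suc i" | "Suc i < k" by linarith
    then show ?thesis
    proof cases
      case 1
      have "ins k one (mu (i - 1) t) = mu i (ins k one t)"
        by (rule loc_commute[OF operator_one operator_mult]) (use 1 in auto)
      then show ?thesis using zero[of "i - 1"] 1 i by (simp add: loc_linear)
    next
      case 4
      have "mu i (ins k one t) = ins (k - 1) one (mu i t)"
        by (rule loc_commute[OF operator_mult operator_one]) (use 4 in auto)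
      then show ?thesis using zero[of i] 4 that by (simp add: loc_linear)
    qed (simp_all add: mu_ins_one[OF t i])
  qed
  then have "mu i (dif B t) = (\<Sum>k\<le>Suc n. (if k = i then tscale ((-1) ^ k) t else 0)
      + (if k = Suc i then tscale ((-1) ^ k) t else 0))"
    unfolding dif_homog[OF shaped_homog[OF t length_replicate[symmetric]]] loc_linear
    by (intro sum.cong) (auto simp: tvec.scale_right_distrib)
  also have "\<dots> = tscale ((-1) ^ i) t + tscale ((-1) ^ Suc i) t"
    unfolding sum.distrib using i by (simp del: sum.atMost_Suc)
  finally show ?thesis by simp
qed

lemma base_letters: "x \<in> shaped (replicate n Ms) \<Longrightarrow> x \<in> shaped (replicate n Ps)"
  by (erule shaped_mono) (auto simp: list_all2_conv_all_nth)

lemma dif_Omega_M: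
  assumes x: "x \<in> Omega_M B n"
  shows "dif B x \<in> Omega_M B (Suc n)"
proof -
  have "ins k one x \<in> shaped (replicate (Suc (Suc n)) Ms)" if "k \<le> Suc n" for k
  proof -
    have "replicate (Suc n) Ms = replicate k Ms @ [] @ replicate (Suc n - k) Ms"
      using that by (simp del: replicate_Suc flip: replicate_add)
    then have "ins k one x \<in> shaped (replicate k Ms @ [Ms] @ replicate (Suc n - k) Ms)"
      using Omega_M_shaped[OF x] by (intro loc_shaped[of _ _ "[]"]) (simp_all add: base_one elP_shaped)
    moreover have "replicate k Ms @ [Ms] @ replicate (Suc n - k) Ms = replicate (k + Suc (Suc n - k)) Ms"
      by (simp only: replicate_add replicate_Suc append_Cons append_Nil)
    ultimately show ?thesis using that by simp
  qed
  then have "dif B x \<in> shaped (replicate (Suc (Suc n)) Ms)"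
    unfolding dif_homog[OF Omega_M_homog[OF x]] by (intro shaped_sum shaped_scale) simp
  moreover have "mu i (dif B x) = 0" if "i < Suc n" for i
    by (rule mu_dif_zero[OF base_letters[OF Omega_M_shaped[OF x]]])
      (use x that in \<open>auto simp: Omega_M_iff\<close>)
  ultimately show ?thesis by (simp add: Omega_M_iff)
qed

lemma dif_leibniz:
  assumes "x \<in> shaped (Ps # Ls)"
  shows "dif B (elP B p \<star> x) = dif B (elP B p) \<star> x + elP B p \<star> dif B x"
proof (rule shaped_eqI[OF _ _ assms], (intro lin_rules)+)
  fix w assume "list_all2 (\<in>) w (Ps # Ls)"
  then obtain q r where w: "w = LP q # r" by (auto simp: list_all2_Cons2)
  have j: "elP B a \<star> pure B (LP b # v) = pure B (LP (a * b) # v)" for a b v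
    by (simp add: juxt_elP mu_pure)
  have j2: "pure B [LP a, LP b] \<star> pure B (LP c # v) = pure B (LP a # LP (b * c) # v)" for a b c v
    using juxt_mu[OF pure_homog[of "[LP a, LP b]"], of "Suc 0"]
      loc_pure_append[OF ops_multilinear(2), of "[LP a]" "Suc 0" "[LP b, LP c]" v] by simp
  have j3: "elP B p \<star> (pure B [LP q] \<otimes>\<^sub>k y) = pure B [LP (p * q)] \<otimes>\<^sub>k y" for y
    using mu_tens_left[OF pure_homog[of "[LP p, LP q]" 2], of 0 y]
    by (simp add: juxt_elP pure_tens_assoc mu_pure)
  show "dif B (elP B p \<star> pure B w) = dif B (elP B p) \<star> pure B w + elP B p \<star> dif B (pure B w)"
    by (simp add: w j dif_Cons[of _ r] dif_elP linear_simps j2 j3)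
qed

lemma P_Omega_M_base: "x \<in> Omega_M B n \<Longrightarrow> elP B p \<star> x \<in> P_Omega_M B n"
  unfolding P_Omega_M_def by (rule tvec.span_base) blast

lemma P_Omega_M_shaped: "P_Omega_M B n \<subseteq> shaped (Ps # replicate n Ms)"
proof -
  have "elP B p \<star> x \<in> shaped ([] @ [Ps] @ replicate n Ms)" if "x \<in> Omega_M B n" for p x
    unfolding juxt_elP
  proof (rule loc_shaped[of _ _ "[Ps, Ps]"])
    have "elP B p \<otimes>\<^sub>k x \<in> shaped ([Ps] @ Ms # replicate n Ms)"
      using tens_shaped[OF elP_shaped_P Omega_M_shaped[OF that]] by simp
    then show "elP B p \<otimes>\<^sub>k x \<in> shaped ([] @ [Ps, Ps] @ replicate n Ms)"
      by (rule shaped_mono) (auto intro!: list_all2_refl)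
  qed (auto simp: list_all2_Cons2)
  then show ?thesis
    unfolding P_Omega_M_def shaped_def[of "Ps # replicate n Ms"]
    by (intro tvec.span_minimal) (auto simp: shaped_def)
qed

lemma P_Omega_M_homog: "x \<in> P_Omega_M B n \<Longrightarrow> x \<in> homog (Suc n)"
  using P_Omega_M_shaped by (intro shaped_homog[of _ "Ps # replicate n Ms"]) auto

lemma P_Omega_M_letters: "x \<in> P_Omega_M B n \<Longrightarrow> x \<in> shaped (replicate (Suc n) Ps)"
proof (rule shaped_mono)
  assume "x \<in> P_Omega_M B n"
  then show "x \<in> shaped (Ps # replicate n Ms)" using P_Omega_M_shaped by blast
  have "list_all2 (\<subseteq>) (replicate n Ms) (replicate n Ps)" by (auto simp: list_all2_conv_all_nth)
  then show "list_all2 (\<subseteq>) (Ps # replicate n Ms) (replicate (Suc n) Ps)" by simp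
qed

lemma P_Omega_M_mu:
  assumes "x \<in> P_Omega_M B n" "i < n"
  shows "mu i x = 0"
proof -
  have "mu i (elP B p \<star> y) = 0" if "y \<in> Omega_M B n" for p y
    using mu_juxt_zero[OF elP_homog, where b = n and y = y and i = i] that assms(2) by (simp add: Omega_M_iff)
  then show ?thesis
    using linear_eq_on_span[OF linear_loc' linear_const_zero[OF tscale_vector_space] _ assms(1)[unfolded P_Omega_M_def], of i 2 mult_word]
    by blast
qed

lemma P_Omega_M_juxt:
  assumes z: "z \<in> P_Omega_M B a" and x: "x \<in> Omega_M B n"
  shows "z \<star> x \<in> P_Omega_M B (a + n)"
proof -
  have "(elP B p \<star> y) \<star> x \<in> P_Omega_M B (a + n)" if "y \<in> Omega_M B a" for p y
    by (simp add: juxt_elP_assoc[OF Omega_M_homog[OF that]] P_Omega_M_base[OF Omega_M_juxt[OF that x]])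
  then show ?thesis
    unfolding P_Omega_M_def[of B "a + n"]
    by (intro linear_span_into[OF linear_juxt_left' _ z[unfolded P_Omega_M_def]]) (auto simp: P_Omega_M_def)
qed

lemma P_Omega_M_left:
  assumes z: "z \<in> P_Omega_M B n"
  shows "elP B p \<star> z \<in> P_Omega_M B n"
proof -
  have "elP B p \<star> (elP B q \<star> y) \<in> P_Omega_M B n" if "y \<in> Omega_M B n" for q y
  proof -
    have "elP B p \<star> (elP B q \<star> y) = elP B (p * q) \<star> y"
      using juxt_elP_assoc[OF elP_homog, of p q y] by (simp add: juxt_elP[of p "elP B q"] mu_pure)
    then show ?thesis using that by (simp add: P_Omega_M_base)
  qed
  then show ?thesis
    unfolding P_Omega_M_def[of B n]
    by (intro linear_span_into[OF linear_juxt_right' _ z[unfolded P_Omega_M_def]]) (auto simp: P_Omega_M_def)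
qed

text \<open>
  If \<open>\<Sum> a\<^sub>i m\<^sub>i = 0\<close> with all \<open>m\<^sub>i\<close> in the base, then
  \<open>\<Sum> a\<^sub>i \<otimes> m\<^sub>i = \<Sum> a\<^sub>i (1 \<otimes> m\<^sub>i - m\<^sub>i \<otimes> 1) = \<Sum> a\<^sub>i dm\<^sub>i\<close>.
\<close>

lemma P_Omega_M_one:
  assumes x: "x \<in> shaped [Ps, Ms]" and "mu 0 x = 0"
  shows "x \<in> P_Omega_M B 1"
proof -
  have "x - mu 0 x \<otimes>\<^sub>k one \<in> P_Omega_M B 1"
    unfolding P_Omega_M_def
  proof (rule shaped_into[OF _ x], (intro lin_intros)+)
    fix w assume "list_all2 (\<in>) w [Ps, Ms]"
    then obtain a m where w: "w = [LP a, LP m]" "m \<in> base_alg B" by (auto simp: list_all2_Cons2)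
    have "elP B m \<in> Omega_M B 0"
      using w(2) by (simp add: Omega_M_iff elP_shaped)
    from P_Omega_M_base[OF dif_Omega_M[OF this], of a]
    have "elP B a \<star> dif B (elP B m) \<in> tspan {elP B p \<star> x |p x. x \<in> Omega_M B 1}"
      by (simp add: P_Omega_M_def)
    moreover have "elP B a \<star> dif B (elP B m) = pure B w - mu 0 (pure B w) \<otimes>\<^sub>k one"
      by (simp add: w dif_elP linear_simps juxt_elP mu_pure)
    ultimately show "pure B w - mu 0 (pure B w) \<otimes>\<^sub>k one \<in> tspan {elP B p \<star> x |p x. x \<in> Omega_M B 1}"
      by simp
  qed
  then show ?thesis using assms(2) by simp
qed

end

locale strong_bundle =
  fixes B :: "('k::field, 'p::{ring,monoid_mult}, 'c::ab_group_add, 'v::ab_group_add) bundle_data"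
    (structure)
    and Pr :: "('k, 'p, 'c, 'v) tensor \<Rightarrow> ('k, 'p, 'c, 'v) tensor"
    and \<omega> :: "'c \<Rightarrow> ('k, 'p, 'c, 'v) tensor"
  assumes copointed: "copointed_coalgebra_bundle B"
    and bij: "psi_bijective B"
    and strong: "strong_connection B Pr"
    and form: "connection_form B Pr \<omega>"
    and comodule: "left_comodule B"
begin

sublocale entwined B
  using copointed comodule by unfold_locales (simp_all add: copointed_coalgebra_bundle_def)

lemma grp_comult: "comult B (grouplike B) = pure B [LC (grouplike B), LC (grouplike B)]"
  and grp_counit: "counit B (grouplike B) = 1"
  using copointed by (simp_all add: copointed_coalgebra_bundle_def)

lemma coactP_coassoc: "slotC (Suc 0) (comult B) (coactP B u) = slotP 0 (coactP B) (coactP B u)"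
proof -
  let ?e = "LC (grouplike B)"
  have psi0: "psi 0 (pure B [?e, LP u]) = coactP B u"
    using loc_exact[OF operator_psi, of "[?e, LP u]"] by (simp add: coactP_def)
  have "slotC (Suc 0) (comult B) (coactP B u) = psi 0 (psi (Suc 0) (slotC 0 (comult B) (pure B [?e, LP u])))"
    unfolding psi0[symmetric] by (rule psi_comult)
  also have "slotC 0 (comult B) (pure B [?e, LP u]) = pure B [?e] \<otimes>\<^sub>k pure B [?e, LP u]"
    using slot_at(1)[OF operator_comult, of "[]" 0 ?e "[LP u]"] by (simp add: grp_comult)
  also have "psi (Suc 0) \<dots> = pure B [?e] \<otimes>\<^sub>k coactP B u"
    using loc_tens_right[OF ops_multilinear(1) pure_homog[of "[?e]"], of "Suc 0" 0 "pure B [?e, LP u]"]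
    by (simp add: psi0 del: tens_pure)
  also have "\<dots> = ins 0 grp (coactP B u)"
    by (rule ins_front[symmetric, OF homog2[OF coactP_shaped] pure_homog]) simp
  finally show ?thesis by (simp add: slotP_coactP)
qed

lemma coactP_counit: "slotC (Suc 0) eps (coactP B u) = elP B u"
proof -
  have "slotC (Suc 0) eps (psi 0 (pure B [LC (grouplike B), LP u])) = slotC 0 eps (pure B [LC (grouplike B), LP u])"
    by (intro psi_eps pure_shaped) simp
  also have "\<dots> = elP B u"
    using slot_at(1)[OF operator_eps, of "[]" 0 "LC (grouplike B)" "[LP u]"]
    by (simp add: grp_counit)
  finally show ?thesis
    using loc_exact[OF operator_psi, of "[LC (grouplike B), LP u]"] by (simp add: coactP_def)
qed

section \<open>The strong connection as a lift of the canonical map\<close>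

lemma omega_linear: "Vector_Spaces.linear (scaleC B) tscale \<omega>"
  and omega_Omega: "\<omega> c \<in> Omega_P B (Suc 0)"
  and omega_chi: "chi_tilde B (\<omega> c) = pure B [LP 1, LC c] - tscale (counit B c) (pure B [LP 1, LC (grouplike B)])"
  using form by (simp_all add: connection_form_def)

lemma omega_shaped: "\<omega> c \<in> shaped [Ps, Ps]" and omega_mu: "mu 0 (\<omega> c) = 0"
  using omega_Omega[of c] by (simp_all add: Omega_P_iff)

lemma operator_omega: "operator (Suc 0) 2 (\<lambda>w. on_C \<omega> (hd w))"
  by (rule operator_C[OF omega_linear homog2[OF omega_shaped]])

text \<open>
  The values of \<open>\<omega>\<close> under the canonical map carry a correction by the group-like element.
  Adding \<open>\<epsilon>(c) 1 \<otimes> 1\<close> removes it, so that this map lifts \<open>c \<mapsto> 1 \<otimes> c\<close> through the canonical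
  map.
\<close>

definition lift where "lift c = \<omega> c + tscale (counit B c) (pure B [LP 1, LP 1])"

lemma lift_linear: "Vector_Spaces.linear (scaleC B) tscale lift"
  unfolding lift_def[abs_def] by (intro linear_plus omega_linear linear_tscale_counit)

lemma lift_shaped: "lift c \<in> shaped [Ps, Ps]"
  unfolding lift_def by (intro shaped_add omega_shaped shaped_scale pure_shaped) simp

lemma operator_lift: "operator (Suc 0) 2 (\<lambda>w. on_C lift (hd w))"
  by (rule operator_C[OF lift_linear homog2[OF lift_shaped]])

lemma slotC_lift: "slotC i lift t = slotC i \<omega> t + ins i (pure B [LP 1, LP 1]) (slotC i eps t)"
  unfolding lift_def[abs_def] slotC_add
  using slotC_counit_scaled[of "pure B [LP 1, LP 1]" 2 i t] by (simp add: pure_homog)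

lemma lift_chi: "chi_tilde B (lift c) = pure B [LP 1, LC c]"
proof -
  have lin: "linT (chi_tilde B)"
    unfolding chi_tilde_def[abs_def] by (rule linear_lin_ext)
  have "chi_tilde B (pure B [LP 1, LP 1]) = mu 0 (pure B [LP 1] \<otimes>\<^sub>k coactP B 1)"
    using slot_at(2)[OF operator_coactP, of "[LP 1]" "Suc 0" "LP 1"] by (simp add: chi_tilde_eq pure_homog)
  then have "chi_tilde B (pure B [LP 1, LP 1]) = pure B [LP 1, LC (grouplike B)]"
    by (simp add: coactP_one mu_pure)
  then show ?thesis
    by (simp add: lift_def linear_addD[OF lin] linear_scaleD[OF lin] omega_chi)
qed

lemma mu_slotC_lift:
  assumes "t \<in> shaped [Ps, Cs]"
  shows "mu 0 (slotC (Suc 0) lift t) = mu 0 (slotC (Suc 0) \<omega> t) + slotC (Suc 0) eps t \<otimes>\<^sub>k one"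
proof -
  have "mu 0 (ins (Suc 0) (pure B [LP 1, LP 1]) s) = s \<otimes>\<^sub>k one" if "s \<in> shaped [Ps]" for s
  proof (rule shaped_eqI[OF _ _ that], (intro lin_intros)+)
    fix w assume "list_all2 (\<in>) w [Ps]"
    then obtain p where w: "w = [LP p]" by (auto simp: list_all2_Cons2)
    show "mu 0 (ins (Suc 0) (pure B [LP 1, LP 1]) (pure B w)) = pure B w \<otimes>\<^sub>k one"
      using ins_end[OF pure_homog[of w "Suc 0"] pure_homog[of "[LP 1, LP 1]"]] by (simp add: w mu_pure)
  qed
  moreover have "slotC (Suc 0) eps t \<in> shaped ([Ps] @ [] @ [])"
    by (rule loc_shaped[of _ _ "[Cs]"]) (use assms in \<open>auto simp: list_all2_Cons2 eps_shaped\<close>)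
  ultimately show ?thesis by (simp add: slotC_lift loc_linear)
qed

lemma projection_dif: "Pr (dif B (elP B u)) = mu 0 (slotC (Suc 0) \<omega> (coactP B u))"
proof -
  have Pr: "Pr (elP B v \<star> dif B (elP B u)) =
      elP B v \<star> lin_ext (\<lambda>w. case w of [LP p, LC c] \<Rightarrow> elP B p \<star> \<omega> c | _ \<Rightarrow> 0) (coactP B u)" for v
    using form by (simp add: connection_form_def)
  have act: "lin_ext (\<lambda>w. case w of [LP p, LC c] \<Rightarrow> elP B p \<star> \<omega> c | _ \<Rightarrow> 0) (coactP B u) =
      mu 0 (slotC (Suc 0) \<omega> (coactP B u))"
    using act_form_eq[of "Suc 0" \<omega> "coactP B u"] operator_omega homog2[OF coactP_shaped]
    by (simp add: numeral_2_eq_2)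
  have "slotC (Suc 0) \<omega> (coactP B u) \<in> shaped ([Ps] @ [Ps, Ps] @ [])"
    by (rule loc_shaped[of _ _ "[Cs]"])
      (use omega_shaped coactP_shaped in \<open>auto simp: operator_multilinear[OF operator_omega] list_all2_Cons2\<close>)
  then have sh: "mu 0 (slotC (Suc 0) \<omega> (coactP B u)) \<in> shaped ([] @ [Ps] @ [Ps])"
    by - (rule loc_shaped[of _ _ "[Ps, Ps]"], auto simp: list_all2_Cons2 intro: pure_shaped)
  have "dif B (elP B u) \<in> shaped [Ps, Ps]"
    unfolding dif_elP by (intro shaped_diff pure_shaped) simp_all
  then have "one \<star> dif B (elP B u) = dif B (elP B u)"
    by (simp add: juxt_mu[OF elP_homog] mu_one)
  with Pr[of 1] show ?thesis
    using sh by (simp add: act juxt_mu[OF elP_homog] mu_one)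
qed

lemma covP_eq: "covP B Pr u = dif B (elP B u) - mu 0 (slotC (Suc 0) \<omega> (coactP B u))"
  by (simp add: covP_def projection_dif)

lemma covP_shaped: "covP B Pr u \<in> shaped [Ms, Ps]"
proof -
  have "x \<star> elP B p \<in> shaped [Ms, Ps]" if "x \<in> Omega_M B 1" for x p
  proof -
    have x: "x \<in> shaped [Ms, Ms]" using that by (simp add: Omega_M_iff)
    then have "x \<star> elP B p = mu (Suc 0) (x \<otimes>\<^sub>k elP B p)"
      by (intro juxt_mu shaped_homog[OF x]) simp
    moreover have "mu (Suc 0) (x \<otimes>\<^sub>k elP B p) \<in> shaped ([Ms] @ [Ps] @ [])"
      by (rule loc_shaped[of _ _ "[Ms, Ps]"])
        (use tens_shaped[OF x elP_shaped, of p UNIV] in \<open>auto simp: list_all2_Cons2 intro: pure_shaped\<close>)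
    ultimately show ?thesis by simp
  qed
  then have "Omega1_M_P B \<subseteq> shaped [Ms, Ps]"
    unfolding Omega1_M_P_def shaped_def[of "[Ms, Ps]"]
    by (intro tvec.span_minimal) (auto simp: shaped_def)
  moreover have "covP B Pr u \<in> Omega1_M_P B"
    using strong by (simp add: strong_connection_def)
  ultimately show ?thesis by blast
qed

text \<open>
  Strongness in terms of the lift: \<open>u\<^sub>0 lift(u\<^sub>1) = 1 \<otimes> u - Du\<close>, and both terms have their
  first factor in the base.
\<close>

lemma strong_lift: "mu 0 (slotC (Suc 0) lift (coactP B u)) \<in> shaped [Ms, Ps]"
proof -
  have "mu 0 (slotC (Suc 0) lift (coactP B u)) = pure B [LP 1, LP u] - covP B Pr u"
    by (simp add: mu_slotC_lift[OF coactP_shaped] coactP_counit covP_eq dif_elP)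
  moreover have "pure B [LP 1, LP u] \<in> shaped [Ms, Ps]"
    by (rule pure_shaped) (simp add: base_one)
  ultimately show ?thesis
    using covP_shaped by (simp add: shaped_diff)
qed

lemma psi_grp_base:
  assumes "x \<in> shaped (Ms # Ls)"
  shows "psi 0 (ins 0 grp x) = ins (Suc 0) grp x"
proof (rule shaped_eqI[OF _ _ assms], (intro lin_intros)+)
  fix w assume "list_all2 (\<in>) w (Ms # Ls)"
  then obtain m r where w: "w = LP m # r" "m \<in> base_alg B" by (auto simp: list_all2_Cons2)
  have "psi 0 (ins 0 grp (pure B w)) = psi 0 (pure B (LC (grouplike B) # LP m # r))"
    using ins_front[OF pure_homog[OF refl] pure_homog, of "[LC (grouplike B)]" "Suc 0" w] by (simp add: w)
  also have "\<dots> = coactP B m \<otimes>\<^sub>k pure B r"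
    using loc_pure_append[OF ops_multilinear(1), of "[]" 0 "[LC (grouplike B), LP m]" r]
    by (simp add: coactP_def tens_Nil(2)[OF entwine_shaped])
  also have "\<dots> = ins (Suc 0) grp (pure B w)"
    using loc_pure_append[OF ops_multilinear(8), of "[LP m]" "Suc 0" "[]" r] w
    by (simp add: base_iff)
  finally show "psi 0 (ins 0 grp (pure B w)) = ins (Suc 0) grp (pure B w)" .
qed

text \<open>
  The first factor of \<open>u\<^sub>0 lift(u\<^sub>1)\<close> is invariant. As \<open>\<psi>\<close> is multiplicative and the
  coaction is coassociative, this says \<open>u\<^sub>0 \<psi>(u\<^sub>1 \<otimes> lift(u\<^sub>2)) = u\<^sub>0 lift(u\<^sub>1)\<close> up to an
  inserted \<open>e\<close>. The factor \<open>u\<^sub>0\<close> cancels: multiplying from the left by elements of \<open>P\<close>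
  produces the image of the canonical map, which contains \<open>1 \<otimes> c\<close>, the image of \<open>lift(c)\<close>.
\<close>

lemma comult_lift_left: "psi 0 (slotC (Suc 0) lift (comult B c)) = ins (Suc 0) grp (lift c)"
proof -
  \<comment> \<open>the discrepancy to be shown to vanish, and its extension \<open>u \<otimes> c \<mapsto> u Z(c)\<close>, called \<open>Zt\<close> below\<close>
  define Z where "Z c = psi 0 (slotC (Suc 0) lift (comult B c)) - ins (Suc 0) grp (lift c)" for c
  have Z_lin: "Vector_Spaces.linear (scaleC B) tscale Z"
    unfolding Z_def[abs_def] by (intro lin_intros comult_linear lift_linear)
  have h3: "slotC (Suc 0) lift (comult B c) \<in> homog 3" for c
    by (rule loc_homog[OF operator_lift homog2[OF comult_shaped]]) simp_all
  have sh: "slotC (Suc 0) lift (comult B c) \<in> shaped ([Cs] @ [Ps, Ps] @ [])" for c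
    by (rule loc_shaped[of _ _ "[Cs]"])
      (use comult_shaped lift_shaped in \<open>auto simp: operator_multilinear[OF operator_lift] list_all2_Cons2\<close>)
  have "psi 0 (slotC (Suc 0) lift (comult B c)) \<in> shaped ([] @ [Ps, Cs] @ [Ps])" for c
    by (rule loc_shaped[of _ _ "[Cs, Ps]"]) (use sh entwine_shaped in \<open>auto simp: list_all2_Cons2\<close>)
  moreover have "ins (Suc 0) grp (lift c) \<in> shaped ([Ps] @ [Cs] @ [Ps])" for c
    by (rule loc_shaped[of _ _ "[]"]) (use lift_shaped in \<open>auto intro: pure_shaped\<close>)
  ultimately have Z_shaped: "Z c \<in> shaped [Ps, Cs, Ps]" for c
    unfolding Z_def by (intro shaped_diff) simp_all
  have Z_op: "operator (Suc 0) 3 (\<lambda>w. on_C Z (hd w))"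
    by (rule operator_C[OF Z_lin]) (rule shaped_homog[OF Z_shaped], simp)
  have Z_slot: "slotC (Suc 0) Z t =
      psi (Suc 0) (slotC 2 lift (slotC (Suc 0) (comult B) t)) - ins 2 grp (slotC (Suc 0) lift t)" for t
  proof -
    have op: "operator (Suc 0) 3 (\<lambda>w. on_C (\<lambda>c. slotC (Suc 0) lift (comult B c)) (hd w))"
      by (rule operator_C[OF _ h3]) (intro lin_intros comult_linear)
    show ?thesis
      unfolding Z_def[abs_def] slotC_diff
      using slotC_comp[OF ops_multilinear(1) _ op, of 0 "Suc 0" t]
        slotC_comp[OF operator_multilinear[OF operator_lift] _ operator_comult, of "Suc 0" "Suc 0" t]
        slotC_comp[OF ops_multilinear(8) _ operator_lift, of "Suc 0" "Suc 0" t]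
      by (simp add: numeral_2_eq_2)
  qed
  define Zt where "Zt t = mu 0 (slotC (Suc 0) Z t)" for t
  have Zt_coact: "Zt (coactP B u) = 0" for u
  proof -
    define S where "S = slotC (Suc 0) lift (coactP B u)"
    have "slotC 2 lift (slotC (Suc 0) (comult B) (coactP B u)) = slotC 2 lift (psi 0 (ins 0 grp (coactP B u)))"
      by (simp only: coactP_coassoc slotP_coactP)
    also have "\<dots> = psi 0 (slotC 2 lift (ins 0 grp (coactP B u)))"
      by (rule loc_commute[OF operator_psi operator_lift, symmetric]) simp_all
    also have "slotC 2 lift (ins 0 grp (coactP B u)) = ins 0 grp S"
      unfolding S_def by (rule loc_commute[OF operator_grp operator_lift, symmetric]) simp_all
    finally have "Zt (coactP B u) = mu 0 (psi (Suc 0) (psi 0 (ins 0 grp S))) - mu 0 (ins 2 grp S)"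
      unfolding Zt_def Z_slot S_def[symmetric] by (simp add: loc_linear)
    also have "mu 0 (psi (Suc 0) (psi 0 (ins 0 grp S))) = psi 0 (mu (Suc 0) (ins 0 grp S))"
      by (rule psi_mult[symmetric])
    also have "mu (Suc 0) (ins 0 grp S) = ins 0 grp (mu 0 S)"
      by (rule loc_commute[OF operator_grp operator_mult, symmetric]) simp_all
    also have "psi 0 (ins 0 grp (mu 0 S)) = ins (Suc 0) grp (mu 0 S)"
      by (rule psi_grp_base) (use strong_lift in \<open>simp add: S_def\<close>)
    also have "mu 0 (ins 2 grp S) = ins (Suc 0) grp (mu 0 S)"
      by (rule loc_commute[OF operator_mult operator_grp]) simp_all
    finally show ?thesis by simp
  qed
  \<comment> \<open>left linearity of \<open>Zt\<close> extends \<open>Zt_coact\<close> to the image of the canonical map\<close>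
  have Zt_chi: "Zt (chi_tilde B y) = 0" if "y \<in> shaped [Ps, Ps]" for y
  proof -
    have "Zt (mu 0 (slotP (Suc 0) (coactP B) y)) = 0"
      unfolding Zt_def
    proof (rule shaped_eqI[OF _ _ that], (intro lin_intros)+)
      fix w assume "list_all2 (\<in>) w [Ps, Ps]"
      then obtain a b where w: "w = [LP a, LP b]" by (auto simp: list_all2_Cons2)
      have "slotC (Suc 0) Z (mu 0 (slotP (Suc 0) (coactP B) (pure B w))) =
          slotC (Suc 0) Z (mu 0 (elP B a \<otimes>\<^sub>k coactP B b))"
        using slot_at(2)[OF operator_coactP, of "[LP a]" "Suc 0" "LP b"] by (simp add: w)
      also have "\<dots> = mu 0 (slotC 2 Z (elP B a \<otimes>\<^sub>k coactP B b))"
        by (rule loc_commute[OF operator_mult Z_op, symmetric]) simp_all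
      also have "slotC 2 Z (elP B a \<otimes>\<^sub>k coactP B b) = elP B a \<otimes>\<^sub>k slotC (Suc 0) Z (coactP B b)"
        using loc_tens_right[OF operator_multilinear[OF Z_op] elP_homog[of a], where j = "Suc 0" and y = "coactP B b"]
        by (simp add: numeral_2_eq_2)
      finally have "mu 0 (slotC (Suc 0) Z (mu 0 (slotP (Suc 0) (coactP B) (pure B w)))) =
          mu 0 (mu 0 (elP B a \<otimes>\<^sub>k slotC (Suc 0) Z (coactP B b)))" by simp
      also have "\<dots> = mu 0 (mu (Suc 0) (elP B a \<otimes>\<^sub>k slotC (Suc 0) Z (coactP B b)))"
        using mu_mu[of 0 "Suc 0"] by simp
      also have "mu (Suc 0) (elP B a \<otimes>\<^sub>k slotC (Suc 0) Z (coactP B b)) = elP B a \<otimes>\<^sub>k Zt (coactP B b)"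
        unfolding Zt_def
        using loc_tens_right[OF ops_multilinear(2) elP_homog[of a], where j = 0 and y = "slotC (Suc 0) Z (coactP B b)"] by simp
      finally show "mu 0 (slotC (Suc 0) Z (mu 0 (slotP (Suc 0) (coactP B) (pure B w)))) = 0"
        by (simp add: Zt_coact loc_linear)
    qed
    then show ?thesis using that by (simp add: chi_tilde_eq homog2)
  qed
  have "Zt (pure B [LP 1, LC c]) = 0"
    using Zt_chi[OF lift_shaped, of c] by (simp add: lift_chi)
  moreover have "slotC (Suc 0) Z (pure B [LP 1, LC c]) = one \<otimes>\<^sub>k Z c"
    using slot_at(2)[OF Z_op, of "[LP 1]" "Suc 0" "LC c"] by simp
  ultimately have "Z c = 0"
    using mu_one[OF Z_shaped] by (simp add: Zt_def)
  then show ?thesis by (simp add: Z_def)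
qed

lemma lift_equivariant: "psi (Suc 0) (psi 0 (slotC (Suc 0) lift (comult B c))) = slotC 0 lift (comult B c)"
proof -
  have om: "psi (Suc 0) (psi 0 (slotC (Suc 0) \<omega> (comult B c))) = slotC 0 \<omega> (comult B c)"
    using form by (simp add: connection_form_def psi_pow_psis psis_two at_slot_loc)
  have eps: "slotC (Suc 0) eps (comult B c) = elC B c" "slotC 0 eps (comult B c) = elC B c"
    using k_coalg by (simp_all add: k_coalgebra_def at_slot_loc)
  have 1: "ins (Suc 0) (pure B [LP 1, LP 1]) (elC B c) = pure B [LC c, LP 1, LP 1]"
    using ins_end[OF pure_homog[of "[LC c]"] pure_homog[of "[LP 1, LP 1]"]] by simp
  have 2: "ins 0 (pure B [LP 1, LP 1]) (elC B c) = pure B [LP 1, LP 1, LC c]"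
    using ins_front[OF pure_homog[of "[LC c]"] pure_homog[of "[LP 1, LP 1]"]] by simp
  have ent: "entwine B c 1 = pure B [LP 1, LC c]"
    using entw by (simp add: entwining_structure_def)
  have "psi 0 (pure B [LC c, LP 1, LP 1]) = pure B [LP 1, LC c, LP 1]"
    using loc_pure_append[OF ops_multilinear(1), of "[]" 0 "[LC c, LP 1]" "[LP 1]"] by (simp add: ent)
  moreover have "psi (Suc 0) (pure B [LP 1, LC c, LP 1]) = pure B [LP 1, LP 1, LC c]"
    using loc_pure_append[OF ops_multilinear(1), of "[LP 1]" "Suc 0" "[LC c, LP 1]" "[]"] by (simp add: ent)
  ultimately show ?thesis
    by (simp add: slotC_lift loc_linear om eps 1 2)
qed

text \<open>
  Equivariance of the lift under \<open>\<psi>\<^sup>2\<close> and the behaviour of its first factor determine the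
  coaction on its second factor.
\<close>

lemma lift_coaction_right: "slotP (Suc 0) (coactP B) (lift c) = slotC 0 lift (comult B c)"
  unfolding slotP_coactP comult_lift_left[symmetric] lift_equivariant ..

section \<open>The left coaction on the total space\<close>

text \<open>
  Bijectivity of \<open>\<psi>\<close> on \<open>C \<otimes> P\<close> provides a left inverse, and this undoes \<open>\<psi>\<close> in the middle
  of a longer tensor.
\<close>

lemma psi_injective:
  assumes t: "t \<in> shaped (Ls1 @ Cs # Ps # Ls3)" and i: "length Ls1 = i" and zero: "psi i t = 0"
  shows "t = 0"
proof -
  have "inj_on (psi 0) (shaped [Cs, Ps])"
    using bij unfolding psi_bijective_def bij_betw_def tens_set_eq psi_at_loc[abs_def] by blast
  then have inj: "y = 0" if "y \<in> shaped [Cs, Ps]" "psi 0 y = 0" for y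
    using that by (auto simp: inj_on_def loc_linear)
  obtain g where g: "linT g" "\<And>y. y \<in> shaped [Cs, Ps] \<Longrightarrow> g (psi 0 y) = y"
  proof (rule left_inverse_on)
    show "linT (psi 0)" by (rule linear_loc')
    show "tvec.subspace (shaped [Cs, Ps])" unfolding shaped_def by (rule tvec.subspace_span)
  qed (use inj in blast)+
  have "t = loc i 2 (pure B) t"
    by (rule loc_pure_id[symmetric, OF shaped_homog[OF t refl]]) (simp add: i)
  also have "\<dots> = loc i 2 (\<lambda>w. g (psi_word w)) t"
  proof (rule loc_eq_on_shape[of _ _ _ _ Ls1 "[Cs, Ps]" Ls3])
    fix b assume "list_all2 (\<in>) b [Cs, Ps]"
    then show "pure B b = g (psi_word b)"
      using g(2)[OF pure_shaped] loc_exact[OF operator_psi] by (metis list_all2_lengthD length_Cons list.size(3) numeral_2_eq_2)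
  qed (use t i in \<open>simp_all add: multilinear_pure multilinear_comp[OF _ g(1)]\<close>)
  also have "\<dots> = loc i 2 (\<lambda>w. g (pure B w)) (psi i t)"
    by (rule loc_linear_comp[OF operator_psi g(1)])
  finally show ?thesis using zero by (simp add: loc_linear)
qed

lemma psis_injective: "t \<in> shaped (Cs # replicate n Ps @ Ls3) \<Longrightarrow> psis 0 n t = 0 \<Longrightarrow> t = 0"
proof (induction n arbitrary: Ls3)
  case (Suc n)
  have t: "t \<in> shaped (Cs # replicate n Ps @ Ps # Ls3)"
    using Suc.prems(1) by (simp flip: replicate_append_same)
  have "psis 0 n t \<in> shaped (replicate n Ps @ Cs # Ps # Ls3)"
    using psis_shaped[of t "[]" n "Ps # Ls3" 0] t by simp
  then have "psis 0 n t = 0"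
    by (rule psi_injective[of _ _ _ n]) (use Suc.prems(2) in simp_all)
  with t show ?case by (rule Suc.IH)
qed simp

text \<open>
  The element \<open>y\<close> is \<open>\<psi>\<^sup>-\<^sup>1(p \<otimes> e)\<close>, the left coaction \<open>p\<^sub>1 \<otimes> p\<^sub>\<infinity>\<close> of \<open>p\<close>. The claim is
  its coassociativity with one inverse of \<open>\<psi>\<close> cleared; \<open>\<psi>\<close> maps both sides to \<open>p \<otimes> e \<otimes> e\<close>
  because \<open>\<psi>\<close> respects the coproduct.
\<close>

lemma left_coaction_comult:
  assumes y: "y \<in> shaped [Cs, Ps]" and psi: "psi 0 y = pure B [LP p, LC (grouplike B)]"
  shows "psi (Suc 0) (slotC 0 (comult B) y) = ins 2 grp y"
proof -
  have "slotC 0 (comult B) y \<in> shaped ([] @ [Cs, Cs] @ [Ps])"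
    by (rule loc_shaped[of _ _ "[Cs]"]) (use y comult_shaped in \<open>auto simp: list_all2_Cons2\<close>)
  then have 1: "psi (Suc 0) (slotC 0 (comult B) y) \<in> shaped ([Cs] @ [Ps, Cs] @ [])"
    by - (rule loc_shaped[of _ _ "[Cs, Ps]"], auto simp: list_all2_Cons2 entwine_shaped)
  have 2: "ins 2 grp y \<in> shaped ([Cs, Ps] @ [Cs] @ [])"
    by (rule loc_shaped[of _ _ "[]"]) (use y in \<open>auto intro: pure_shaped\<close>)
  have "psi 0 (psi (Suc 0) (slotC 0 (comult B) y)) = slotC (Suc 0) (comult B) (psi 0 y)"
    by (rule psi_comult[symmetric])
  also have "\<dots> = ins 2 grp (psi 0 y)"
    using slot_at(2)[OF operator_comult, of "[LP p]" "Suc 0" "LC (grouplike B)"]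
      ins_end[OF pure_homog[of "[LP p, LC (grouplike B)]" 2] pure_homog[of "[LC (grouplike B)]" "Suc 0"]]
    by (simp add: psi grp_comult)
  also have "\<dots> = psi 0 (ins 2 grp y)"
    by (rule loc_commute[OF operator_psi operator_grp, symmetric]) simp_all
  finally have zero: "psi 0 (psi (Suc 0) (slotC 0 (comult B) y) - ins 2 grp y) = 0"
    by (simp add: loc_linear)
  have "psi (Suc 0) (slotC 0 (comult B) y) - ins 2 grp y \<in> shaped [Cs, Ps, Cs]"
    by (rule shaped_diff) (use 1 2 in simp_all)
  then have "psi (Suc 0) (slotC 0 (comult B) y) - ins 2 grp y = 0"
    using psi_injective[of _ "[]" "[Cs]" 0, simplified] zero by blast
  then show ?thesis by simp
qed

text \<open>
  The coaction on the last factor of \<open>lift(p\<^sub>1) p\<^sub>\<infinity>\<close> is \<open>lift(p\<^sub>1) \<psi>(p\<^sub>2 \<otimes> p\<^sub>\<infinity>)\<close> by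
  multiplicativity and \<open>lift_coaction_right\<close>. By coassociativity of the left coaction this
  is \<open>lift(p\<^sub>1) p\<^sub>\<infinity> \<otimes> e\<close>.
\<close>

lemma lift_left_coaction_invariant:
  assumes y: "y \<in> shaped [Cs, Ps]" and psi: "psi 0 y = pure B [LP p, LC (grouplike B)]"
  shows "mu (Suc 0) (slotC 0 lift y) \<in> shaped [Ps, Ms]"
proof (rule invariant_right_factor)
  let ?z = "slotC 0 lift y"
  have z: "?z \<in> shaped ([] @ [Ps, Ps] @ [Ps])"
    by (rule loc_shaped[of _ _ "[Cs]"])
      (use y lift_shaped in \<open>auto simp: operator_multilinear[OF operator_lift] list_all2_Cons2\<close>)
  then have "mu (Suc 0) ?z \<in> shaped ([Ps] @ [Ps] @ [])"
    by - (rule loc_shaped[of _ _ "[Ps, Ps]"], auto simp: mult_word_shaped)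
  then show "mu (Suc 0) ?z \<in> shaped [Ps, Ps]" by simp
  have "slotP (Suc 0) (coactP B) (mu (Suc 0) ?z) = psi (Suc 0) (ins (Suc 0) grp (mu (Suc 0) ?z))"
    by (rule slotP_coactP)
  also have "ins (Suc 0) grp (mu (Suc 0) ?z) = mu 2 (ins (Suc 0) grp ?z)"
    by (rule loc_commute[OF operator_grp operator_mult]) simp_all
  also have "psi (Suc 0) (mu 2 (ins (Suc 0) grp ?z)) = mu (Suc 0) (psi 2 (psi (Suc 0) (ins (Suc 0) grp ?z)))"
    using psi_mult[of "Suc 0"] by (simp add: numeral_2_eq_2)
  also have "psi (Suc 0) (ins (Suc 0) grp ?z) = slotP (Suc 0) (coactP B) ?z"
    by (rule slotP_coactP[symmetric])
  also have "\<dots> = slotC 0 (\<lambda>c. slotP (Suc 0) (coactP B) (lift c)) y"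
    using slotC_comp[OF ops_multilinear(5) _ operator_lift, of "Suc 0" 0 y] by simp
  also have "\<dots> = slotC 0 (\<lambda>c. slotC 0 lift (comult B c)) y"
    by (simp add: lift_coaction_right)
  also have "\<dots> = slotC 0 lift (slotC 0 (comult B) y)"
    using slotC_comp[OF operator_multilinear[OF operator_lift] _ operator_comult, of 0 0 y] by simp
  also have "psi 2 (slotC 0 lift (slotC 0 (comult B) y)) = slotC 0 lift (psi (Suc 0) (slotC 0 (comult B) y))"
    by (rule loc_commute[OF operator_lift operator_psi, symmetric]) simp_all
  also have "\<dots> = slotC 0 lift (ins 2 grp y)"
    by (simp only: left_coaction_comult[OF y psi])
  also have "\<dots> = ins 3 grp ?z"
    by (rule loc_commute[OF operator_lift operator_grp]) simp_all
  also have "mu (Suc 0) (ins 3 grp ?z) = ins 2 grp (mu (Suc 0) ?z)"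
    by (rule loc_commute[OF operator_mult operator_grp]) simp_all
  finally show "slotP (Suc 0) (coactP B) (mu (Suc 0) ?z) = ins 2 grp (mu (Suc 0) ?z)" .
qed

text \<open>
  The key point: \<open>dp + \<omega>(p\<^sub>1) p\<^sub>\<infinity> = lift(p\<^sub>1) p\<^sub>\<infinity> - p \<otimes> 1\<close> lies in \<open>P(\<Omega>\<^sup>1M)\<close>, where
  strongness only places \<open>dp - p\<^sub>0 \<omega>(p\<^sub>1)\<close> in \<open>(\<Omega>\<^sup>1M)P\<close>.
\<close>

lemma dif_plus_form:
  assumes y: "y \<in> shaped [Cs, Ps]" and psi: "psi 0 y = pure B [LP p, LC (grouplike B)]"
  shows "dif B (elP B p) + mu (Suc 0) (slotC 0 \<omega> y) \<in> P_Omega_M B 1"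
proof (rule P_Omega_M_one)
  have "slotC 0 eps y = slotC (Suc 0) eps (psi 0 y)"
    by (rule psi_eps[OF y, symmetric])
  also have "\<dots> = elP B p"
    using slot_at(2)[OF operator_eps, of "[LP p]" "Suc 0" "LC (grouplike B)"] by (simp add: psi grp_counit)
  finally have "mu (Suc 0) (slotC 0 lift y) = mu (Suc 0) (slotC 0 \<omega> y) + pure B [LP 1, LP p]"
    using ins_front[OF elP_homog[of p] pure_homog[of "[LP 1, LP 1]" 2]]
      loc_pure_append[OF ops_multilinear(2), of "[LP 1]" "Suc 0" "[LP 1, LP p]" "[]"]
    by (simp add: slotC_lift loc_linear)
  then have "dif B (elP B p) + mu (Suc 0) (slotC 0 \<omega> y) = mu (Suc 0) (slotC 0 lift y) - pure B [LP p, LP 1]"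
    by (simp add: dif_elP)
  moreover have "pure B [LP p, LP 1] \<in> shaped [Ps, Ms]"
    by (rule pure_shaped) (simp add: base_one)
  ultimately show "dif B (elP B p) + mu (Suc 0) (slotC 0 \<omega> y) \<in> shaped [Ps, Ms]"
    using lift_left_coaction_invariant[OF y psi] by (simp add: shaped_diff)
  have "mu 0 (mu (Suc 0) (slotC 0 \<omega> y)) = mu 0 (slotC 0 (\<lambda>c. mu 0 (\<omega> c)) y)"
    using mu_mu[of 0 "Suc 0"] slotC_comp[OF ops_multilinear(2) _ operator_omega, of 0 0 y] by simp
  also have "slotC 0 (\<lambda>c. mu 0 (\<omega> c)) y = 0"
    using slotC_diff[of 0 \<omega> \<omega> y] by (simp add: omega_mu)
  finally show "mu 0 (dif B (elP B p) + mu (Suc 0) (slotC 0 \<omega> y)) = 0"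
    by (simp add: dif_elP loc_linear mu_pure)
qed

section \<open>The covariant derivative\<close>

text \<open>
  The left coaction of \<open>px\<close> is \<open>p\<^sub>1 \<otimes> p\<^sub>\<infinity> x\<close> since \<open>e\<close> passes through \<open>x\<close>. By the Leibniz
  rule, \<open>d(px) + \<omega>(p\<^sub>1) p\<^sub>\<infinity> x = (dp + \<omega>(p\<^sub>1) p\<^sub>\<infinity>) x + p dx\<close>, and \<open>dif_plus_form\<close> applies.
\<close>

lemma transport_generator:
  assumes x: "x \<in> Omega_M B n"
  obtains y where "y \<in> shaped (Cs # replicate (Suc n) Ps)"
    "psis 0 (Suc n) y = ins (Suc n) grp (elP B p \<star> x)"
    "dif B (elP B p \<star> x) + mu (Suc 0) (slotC 0 \<omega> y) \<in> P_Omega_M B (Suc n)"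
proof -
  have "psi 0 ` shaped [Cs, Ps] = shaped [Ps, Cs]"
    using bij unfolding psi_bijective_def bij_betw_def tens_set_eq psi_at_loc[abs_def] by blast
  moreover have "pure B [LP p, LC (grouplike B)] \<in> shaped [Ps, Cs]"
    by (rule pure_shaped) simp
  ultimately have "pure B [LP p, LC (grouplike B)] \<in> psi 0 ` shaped [Cs, Ps]"
    by (simp only:)
  then obtain y where "pure B [LP p, LC (grouplike B)] = psi 0 y" "y \<in> shaped [Cs, Ps]"
    by (rule imageE)
  then have y: "y \<in> shaped [Cs, Ps]" "psi 0 y = pure B [LP p, LC (grouplike B)]"
    by simp_all
  \<comment> \<open>\<open>y\<close> is \<open>p\<^sub>1 \<otimes> p\<^sub>\<infinity>\<close>, and \<open>?y\<close> is \<open>p\<^sub>1 \<otimes> p\<^sub>\<infinity> x\<close>\<close>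
  let ?y = "mu (Suc 0) (y \<otimes>\<^sub>k x)"
  have "y \<otimes>\<^sub>k x \<in> shaped ([Cs, Ps] @ replicate (Suc n) Ps)"
    by (rule tens_shaped[OF y(1) base_letters[OF Omega_M_shaped[OF x]]])
  then have 1: "?y \<in> shaped (Cs # replicate (Suc n) Ps)"
    using mu_shaped_replicate[of "y \<otimes>\<^sub>k x" "[Cs]" "replicate n Ps" "Suc 0"] by simp
  have "psis 0 (Suc n) ?y = mu 0 (psis 0 (Suc (Suc 0) + n) (y \<otimes>\<^sub>k x))"
    using psis_mult[of 0 n] by simp
  also have "psis 0 (Suc (Suc 0) + n) (y \<otimes>\<^sub>k x) = psis (Suc 0) (Suc n) (psi 0 (y \<otimes>\<^sub>k x))"
    using psis_add[of 0 "Suc 0" "Suc n" "y \<otimes>\<^sub>k x"] by simp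
  also have "psi 0 (y \<otimes>\<^sub>k x) = elP B p \<otimes>\<^sub>k (grp \<otimes>\<^sub>k x)"
    using loc_tens_left[OF ops_multilinear(1) homog2[OF y(1)], of 0 x] by (simp add: y(2) flip: tens_assoc)
  also have "psis (Suc 0) (Suc n) \<dots> = elP B p \<otimes>\<^sub>k (x \<otimes>\<^sub>k grp)"
    using psis_tens_right[OF elP_homog[of p], of 0 "Suc n"] psis_base[OF Omega_M_shaped[OF x]]
    by (simp del: psis.simps)
  also have "mu 0 \<dots> = (elP B p \<star> x) \<otimes>\<^sub>k grp"
    using mu_tens_left[OF tens_homog[OF elP_homog[of p] Omega_M_homog[OF x]], of 0 grp]
    by (simp add: juxt_elP tens_assoc)
  also have "\<dots> = ins (Suc n) grp (elP B p \<star> x)"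
    by (rule ins_end[symmetric, OF P_Omega_M_homog[OF P_Omega_M_base[OF x]] pure_homog]) simp
  finally have 2: "psis 0 (Suc n) ?y = ins (Suc n) grp (elP B p \<star> x)" .
  let ?K = "mu (Suc 0) (slotC 0 \<omega> y)"
  have om3: "slotC 0 \<omega> y \<in> homog 3"
    by (rule loc_homog[OF operator_omega homog2[OF y(1)]]) simp_all
  have K: "?K \<in> homog 2"
    by (rule loc_homog[OF operator_mult om3]) simp_all
  have "mu (Suc 0) (slotC 0 \<omega> ?y) = mu (Suc 0) (mu 2 (slotC 0 \<omega> (y \<otimes>\<^sub>k x)))"
    by (rule arg_cong[of _ _ "mu (Suc 0)"], rule loc_commute[OF operator_omega operator_mult]) simp_all
  also have "\<dots> = mu (Suc 0) (mu (Suc 0) (slotC 0 \<omega> (y \<otimes>\<^sub>k x)))"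
    using mu_mu[of "Suc 0" 2] by simp
  also have "slotC 0 \<omega> (y \<otimes>\<^sub>k x) = slotC 0 \<omega> y \<otimes>\<^sub>k x"
    by (rule loc_tens_left[OF operator_multilinear[OF operator_omega] homog2[OF y(1)]]) simp
  also have "mu (Suc 0) (slotC 0 \<omega> y \<otimes>\<^sub>k x) = ?K \<otimes>\<^sub>k x"
    by (rule mu_tens_left[OF om3]) simp
  also have "mu (Suc 0) (?K \<otimes>\<^sub>k x) = ?K \<star> x"
    using juxt_mu[of ?K "Suc 0" x] K by (simp add: numeral_2_eq_2)
  finally have "dif B (elP B p \<star> x) + mu (Suc 0) (slotC 0 \<omega> ?y) =
      (dif B (elP B p) + ?K) \<star> x + elP B p \<star> dif B x"
    using dif_leibniz[of x "replicate n Ps" p] base_letters[OF Omega_M_shaped[OF x]]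
    by (simp add: linear_simps)
  moreover have "(dif B (elP B p) + ?K) \<star> x \<in> P_Omega_M B (Suc n)"
    using P_Omega_M_juxt[OF dif_plus_form[OF y] x] by simp
  moreover have "elP B p \<star> dif B x \<in> P_Omega_M B (Suc n)"
    by (rule P_Omega_M_base[OF dif_Omega_M[OF x]])
  ultimately have "dif B (elP B p \<star> x) + mu (Suc 0) (slotC 0 \<omega> ?y) \<in> P_Omega_M B (Suc n)"
    unfolding P_Omega_M_def by (simp add: tvec.span_add)
  with 1 2 that show ?thesis by blast
qed

lemma transport:
  assumes "z \<in> P_Omega_M B n"
  shows "\<exists>y \<in> shaped (Cs # replicate (Suc n) Ps). psis 0 (Suc n) y = ins (Suc n) grp z \<and>
    dif B z + mu (Suc 0) (slotC 0 \<omega> y) \<in> P_Omega_M B (Suc n)"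
  using assms[unfolded P_Omega_M_def]
proof (induction rule: tvec.span_induct_alt)
  case base
  show ?case
    by (rule bexI[of _ 0]) (simp_all add: linear_simps P_Omega_M_def tvec.span_zero del: psis.simps)
next
  case (step a z z')
  then obtain p x where x: "z = elP B p \<star> x" "x \<in> Omega_M B n" by blast
  obtain y where y: "y \<in> shaped (Cs # replicate (Suc n) Ps)" "psis 0 (Suc n) y = ins (Suc n) grp z"
    "dif B z + mu (Suc 0) (slotC 0 \<omega> y) \<in> P_Omega_M B (Suc n)"
    using transport_generator[OF x(2), of p] unfolding x(1) by blast
  obtain y' where y': "y' \<in> shaped (Cs # replicate (Suc n) Ps)" "psis 0 (Suc n) y' = ins (Suc n) grp z'"
    "dif B z' + mu (Suc 0) (slotC 0 \<omega> y') \<in> P_Omega_M B (Suc n)"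
    using step.IH by blast
  have "tscale a y + y' \<in> shaped (Cs # replicate (Suc n) Ps)"
    by (intro shaped_add shaped_scale y y')
  moreover have "psis 0 (Suc n) (tscale a y + y') = ins (Suc n) grp (tscale a z + z')"
    using y(2) y'(2) by (simp add: linear_simps del: psis.simps)
  moreover have "dif B (tscale a z + z') + mu (Suc 0) (slotC 0 \<omega> (tscale a y + y')) =
      tscale a (dif B z + mu (Suc 0) (slotC 0 \<omega> y)) + (dif B z' + mu (Suc 0) (slotC 0 \<omega> y'))"
    by (simp add: linear_simps tvec.scale_right_distrib)
  then have "dif B (tscale a z + z') + mu (Suc 0) (slotC 0 \<omega> (tscale a y + y')) \<in> P_Omega_M B (Suc n)"
    using y(3) y'(3) unfolding P_Omega_M_def by (simp add: tvec.span_add tvec.span_scale)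
  ultimately show ?case by blast
qed

context
  fixes n \<phi>
  assumes hom: "\<phi> \<in> Hom0 B n"
begin

lemma Hom0_linear: "Vector_Spaces.linear (scaleV B) tscale \<phi>"
  and Hom0_mem: "\<phi> v \<in> P_Omega_M B n"
  and Hom0_equivariant: "psis 0 (Suc n) (slotV (Suc 0) \<phi> (coact B v)) = \<phi> v \<otimes>\<^sub>k grp"
  using hom by (simp_all add: Hom0_def psi_pow_psis at_slot_loc del: psis.simps psi_pow.simps)

lemma operator_Hom0: "operator (Suc 0) (Suc n) (\<lambda>w. on_V \<phi> (hd w))"
  by (rule operator_V[OF Hom0_linear P_Omega_M_homog[OF Hom0_mem]])

lemma Dbar_eq: "Dbar B \<omega> \<phi> v = dif B (\<phi> v) + mu (Suc 0) (slotC 0 \<omega> (slotV (Suc 0) \<phi> (coact B v)))"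
  unfolding Dbar_def
  using act_pair_eq[OF _ operator_Hom0 homog2[OF coact_shaped], of "Suc 0" \<omega>] operator_omega
  by (simp add: numeral_2_eq_2)

lemma Hom0_coact_shaped: "slotV (Suc 0) \<phi> (coact B v) \<in> shaped (Cs # replicate (Suc n) Ps)"
proof -
  have "slotV (Suc 0) \<phi> (coact B v) \<in> shaped ([Cs] @ replicate (Suc n) Ps @ [])"
    by (rule loc_shaped[of _ _ "[Vs]"])
      (use coact_shaped P_Omega_M_letters[OF Hom0_mem] in
        \<open>auto simp: operator_multilinear[OF operator_Hom0] list_all2_Cons2 simp del: replicate_Suc\<close>)
  then show ?thesis by simp
qed

text \<open>
  By \<open>transport\<close> the claim holds with some left coaction of \<open>\<phi>(v)\<close> in place of
  \<open>v\<^sub>1 \<otimes> \<phi>(v\<^sub>\<infinity>)\<close>. Both are mapped to \<open>\<phi>(v) \<otimes> e\<close> by the injective power of \<open>\<psi>\<close>, the latter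
  because \<open>\<phi>\<close> is equivariant.
\<close>

lemma Dbar_mem: "Dbar B \<omega> \<phi> v \<in> P_Omega_M B (Suc n)"
proof -
  obtain y where y: "y \<in> shaped (Cs # replicate (Suc n) Ps)" "psis 0 (Suc n) y = ins (Suc n) grp (\<phi> v)"
    "dif B (\<phi> v) + mu (Suc 0) (slotC 0 \<omega> y) \<in> P_Omega_M B (Suc n)"
    using transport[OF Hom0_mem] by blast
  have "ins (Suc n) grp (\<phi> v) = \<phi> v \<otimes>\<^sub>k grp"
    by (rule ins_end[OF P_Omega_M_homog[OF Hom0_mem] pure_homog]) simp
  then have "psis 0 (Suc n) (slotV (Suc 0) \<phi> (coact B v) - y) = 0"
    using Hom0_equivariant y(2) by (simp add: linear_simps del: psis.simps)
  then have "slotV (Suc 0) \<phi> (coact B v) - y = 0"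
    using psis_injective[of _ "Suc n" "[]", unfolded append_Nil2] shaped_diff[OF Hom0_coact_shaped y(1)]
    by blast
  then show ?thesis using y(3) by (simp add: Dbar_eq)
qed

lemma Dbar_linear: "Vector_Spaces.linear (scaleV B) tscale (Dbar B \<omega> \<phi>)"
  unfolding Dbar_def[abs_def] by (intro lin_rules linear_lin_ext_comp Hom0_linear coact_linear)

lemma Hom0_coact_homog: "slotV (Suc 0) \<phi> (coact B v) \<in> homog (Suc (Suc n))"
  by (rule shaped_homog[OF Hom0_coact_shaped]) simp

lemma operator_Hom0_coact: "operator (Suc 0) (Suc (Suc n)) (\<lambda>w. on_V (\<lambda>x. slotV (Suc 0) \<phi> (coact B x)) (hd w))"
  by (rule operator_V[OF _ Hom0_coact_homog]) (intro lin_rules coact_linear)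

lemma slotV_Hom0_coact:
  "slotV (Suc 0) (\<lambda>x. slotV (Suc 0) \<phi> (coact B x)) t = slotV 2 \<phi> (slotV (Suc 0) (coact B) t)"
  using slotV_comp[OF operator_multilinear[OF operator_Hom0] _ operator_coact, of "Suc 0" "Suc 0" t]
  by (simp add: numeral_2_eq_2)

lemma slotV_connection_term:
  "slotV (Suc 0) (\<lambda>x. mu (Suc 0) (slotC 0 \<omega> (slotV (Suc 0) \<phi> (coact B x)))) t =
    mu 2 (slotC (Suc 0) \<omega> (slotV 2 \<phi> (slotV (Suc 0) (coact B) t)))"
proof -
  have "operator (Suc 0) (Suc (Suc (Suc n))) (\<lambda>w. on_V (\<lambda>x. slotC 0 \<omega> (slotV (Suc 0) \<phi> (coact B x))) (hd w))"
    by (rule operator_V, (intro lin_rules coact_linear)[1],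
        rule loc_homog[OF operator_omega Hom0_coact_homog]) simp_all
  from slotV_comp[OF ops_multilinear(2) _ this, of "Suc 0" "Suc 0" t]
    slotV_comp[OF operator_multilinear[OF operator_omega] _ operator_Hom0_coact, of 0 "Suc 0" t]
  show ?thesis by (simp add: slotV_Hom0_coact numeral_2_eq_2)
qed

text \<open>
  Inserting units commutes with all crossings.
\<close>

lemma dif_equivariant:
  "psis 0 (Suc (Suc n)) (slotV (Suc 0) (\<lambda>x. dif B (\<phi> x)) (coact B v)) = dif B (\<phi> v) \<otimes>\<^sub>k grp"
proof -
  have "slotV (Suc 0) (\<lambda>x. dif B (\<phi> x)) (coact B v) =
      (\<Sum>k\<le>Suc n. tscale ((-1) ^ k) (slotV (Suc 0) (\<lambda>x. ins k one (\<phi> x)) (coact B v)))"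
    unfolding dif_homog[OF P_Omega_M_homog[OF Hom0_mem]] by (rule slotV_sum)
  also have "\<dots> = (\<Sum>k\<le>Suc n. tscale ((-1) ^ k) (ins (Suc k) one (slotV (Suc 0) \<phi> (coact B v))))"
  proof (rule sum.cong[OF refl])
    fix k assume "k \<in> {..Suc n}"
    then show "tscale ((-1) ^ k) (slotV (Suc 0) (\<lambda>x. ins k one (\<phi> x)) (coact B v)) =
        tscale ((-1) ^ k) (ins (Suc k) one (slotV (Suc 0) \<phi> (coact B v)))"
      using slotV_comp[OF ops_multilinear(7) _ operator_Hom0, of k "Suc 0"] by simp
  qed
  finally have "psis 0 (Suc (Suc n)) (slotV (Suc 0) (\<lambda>x. dif B (\<phi> x)) (coact B v)) =
      (\<Sum>k\<le>Suc n. tscale ((-1) ^ k) (psis 0 (Suc (Suc n)) (ins (Suc k) one (slotV (Suc 0) \<phi> (coact B v)))))"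
    by (simp add: linear_simps del: psis.simps sum.atMost_Suc)
  also have "\<dots> = (\<Sum>k\<le>Suc n. tscale ((-1) ^ k) (ins k one (\<phi> v) \<otimes>\<^sub>k grp))"
  proof (rule sum.cong[OF refl])
    fix k assume "k \<in> {..Suc n}"
    then have k: "k \<le> Suc n" by simp
    have "psis 0 (Suc (Suc n)) (ins (Suc k) one (slotV (Suc 0) \<phi> (coact B v))) = ins k one (\<phi> v \<otimes>\<^sub>k grp)"
      unfolding psis_ins_one[OF Hom0_coact_shaped k] Hom0_equivariant ..
    also have "\<dots> = ins k one (\<phi> v) \<otimes>\<^sub>k grp"
      by (rule loc_tens_left[OF ops_multilinear(7) P_Omega_M_homog[OF Hom0_mem]]) (use k in simp)
    finally show "tscale ((-1) ^ k) (psis 0 (Suc (Suc n)) (ins (Suc k) one (slotV (Suc 0) \<phi> (coact B v)))) =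
      tscale ((-1) ^ k) (ins k one (\<phi> v) \<otimes>\<^sub>k grp)" by simp
  qed
  also have "\<dots> = dif B (\<phi> v) \<otimes>\<^sub>k grp"
    unfolding dif_homog[OF P_Omega_M_homog[OF Hom0_mem]] by (simp add: linear_simps del: sum.atMost_Suc)
  finally show ?thesis .
qed

text \<open>
  The element \<open>v\<^sub>1 \<otimes> \<omega>(v\<^sub>2) \<phi>(v\<^sub>\<infinity>)\<close> crosses in two stages: first \<open>\<omega>\<close>, which takes it to
  \<open>\<omega>(v\<^sub>1) \<otimes> v\<^sub>2 \<otimes> \<phi>(v\<^sub>\<infinity>)\<close> by equivariance of \<open>\<omega>\<close>, then \<open>\<phi>\<close>, by equivariance of \<open>\<phi>\<close>.
  Coassociativity of the comodule matches the stages.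
\<close>

lemma form_equivariant:
  "psis 0 (Suc (Suc n)) (slotV (Suc 0) (\<lambda>x. mu (Suc 0) (slotC 0 \<omega> (slotV (Suc 0) \<phi> (coact B x)))) (coact B v)) =
    mu (Suc 0) (slotC 0 \<omega> (slotV (Suc 0) \<phi> (coact B v))) \<otimes>\<^sub>k grp"
proof -
  let ?t = "coact B v"
  let ?s = "slotC 0 (comult B) ?t"
  have coassoc: "slotV (Suc 0) (coact B) ?t = ?s"
    using comod by (simp add: left_comodule_def at_slot_loc)
  have om: "psi (Suc 0) (psi 0 (slotC (Suc 0) \<omega> (comult B c))) = slotC 0 \<omega> (comult B c)" for c
    using form by (simp add: connection_form_def psi_pow_psis psis_two at_slot_loc)
  let ?y = "slotC (Suc 0) \<omega> (slotV 2 \<phi> ?s)"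
  have y: "?y = slotV 3 \<phi> (slotC (Suc 0) \<omega> ?s)"
    by (rule loc_commute[OF operator_omega operator_Hom0]) simp_all
  have "psis 0 2 ?y = psi (Suc 0) (psi 0 (slotV 3 \<phi> (slotC (Suc 0) \<omega> ?s)))"
    by (simp only: psis_two y)
  also have "\<dots> = psi (Suc 0) (slotV 3 \<phi> (psi 0 (slotC (Suc 0) \<omega> ?s)))"
    by (rule arg_cong[of _ _ "psi (Suc 0)"], rule loc_commute[OF operator_psi operator_Hom0]) simp_all
  also have "\<dots> = slotV 3 \<phi> (psi (Suc 0) (psi 0 (slotC (Suc 0) \<omega> ?s)))"
    by (rule loc_commute[OF operator_psi operator_Hom0]) simp_all
  also have "psi (Suc 0) (psi 0 (slotC (Suc 0) \<omega> ?s)) =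
      slotC 0 (\<lambda>c. psi (Suc 0) (psi 0 (slotC (Suc 0) \<omega> (comult B c)))) ?t"
  proof -
    have h: "slotC (Suc 0) \<omega> (comult B c) \<in> homog 3" for c
      by (rule loc_homog[OF operator_omega homog2[OF comult_shaped]]) simp_all
    have h': "psi 0 (slotC (Suc 0) \<omega> (comult B c)) \<in> homog 3" for c
      by (rule loc_homog[OF operator_psi h]) simp_all
    have "operator (Suc 0) 3 (\<lambda>w. on_C (\<lambda>c. slotC (Suc 0) \<omega> (comult B c)) (hd w))"
      "operator (Suc 0) 3 (\<lambda>w. on_C (\<lambda>c. psi 0 (slotC (Suc 0) \<omega> (comult B c))) (hd w))"
      by (rule operator_C[OF _ h] operator_C[OF _ h'], intro lin_rules comult_linear)+
    note ops3 = this
    show ?thesis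
      using slotC_comp[OF operator_multilinear[OF operator_omega] _ operator_comult, of "Suc 0" 0 ?t]
        slotC_comp[OF ops_multilinear(1) _ ops3(1), of 0 0 ?t]
        slotC_comp[OF ops_multilinear(1) _ ops3(2), of "Suc 0" 0 ?t]
      by simp
  qed
  also have "\<dots> = slotC 0 \<omega> ?s"
    unfolding om using slotC_comp[OF operator_multilinear[OF operator_omega] _ operator_comult, of 0 0 ?t] by simp
  also have "slotV 3 \<phi> (slotC 0 \<omega> ?s) = slotC 0 \<omega> (slotV 2 \<phi> ?s)"
    by (rule loc_commute[OF operator_omega operator_Hom0, symmetric]) simp_all
  finally have y2: "psis 0 2 ?y = slotC 0 \<omega> (slotV (Suc 0) (\<lambda>x. slotV (Suc 0) \<phi> (coact B x)) ?t)"
    unfolding slotV_Hom0_coact coassoc .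
  have "psis (Suc 0) (Suc n) (slotV (Suc 0) (\<lambda>x. slotV (Suc 0) \<phi> (coact B x)) ?t) =
      slotV (Suc 0) (\<lambda>x. psis 0 (Suc n) (slotV (Suc 0) \<phi> (coact B x))) ?t"
    using slotV_psis[OF operator_Hom0_coact, of 0 "Suc n" "Suc 0" ?t] by (simp del: psis.simps)
  also have "\<dots> = slotV (Suc 0) (\<lambda>x. ins (Suc n) grp (\<phi> x)) ?t"
    using ins_end[OF P_Omega_M_homog[OF Hom0_mem] pure_homog[of "[LC (grouplike B)]" "Suc 0"]]
    by (simp add: Hom0_equivariant del: psis.simps)
  also have "\<dots> = ins (Suc (Suc n)) grp (slotV (Suc 0) \<phi> ?t)"
    using slotV_comp[OF ops_multilinear(8) _ operator_Hom0, of "Suc n" "Suc 0" ?t] by simp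
  finally have inner: "psis (Suc 0) (Suc n) (slotV (Suc 0) (\<lambda>x. slotV (Suc 0) \<phi> (coact B x)) ?t) =
      ins (Suc (Suc n)) grp (slotV (Suc 0) \<phi> ?t)" .
  have "psis 0 (Suc (Suc n)) (slotV (Suc 0) (\<lambda>x. mu (Suc 0) (slotC 0 \<omega> (slotV (Suc 0) \<phi> (coact B x)))) ?t) =
      psis 0 (Suc (Suc 0) + n) (mu (Suc (Suc 0)) ?y)"
    unfolding slotV_connection_term coassoc by (simp add: numeral_2_eq_2)
  also have "\<dots> = mu (Suc 0) (psis 0 (2 + Suc n) ?y)"
    unfolding psis_mult by (simp del: psis.simps)
  also have "psis 0 (2 + Suc n) ?y = psis 2 (Suc n) (psis 0 2 ?y)"
    by (simp only: psis_add add_0)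
  also have "\<dots> = slotC 0 \<omega> (ins (Suc (Suc n)) grp (slotV (Suc 0) \<phi> ?t))"
    unfolding y2 inner[symmetric]
    by (rule psis_below[OF operator_omega, symmetric]) simp_all
  also have "\<dots> = ins (Suc (Suc (Suc n))) grp (slotC 0 \<omega> (slotV (Suc 0) \<phi> ?t))"
    by (rule loc_commute[OF operator_omega operator_grp]) simp_all
  also have "mu (Suc 0) \<dots> = ins (Suc (Suc n)) grp (mu (Suc 0) (slotC 0 \<omega> (slotV (Suc 0) \<phi> ?t)))"
    by (rule loc_commute[OF operator_mult operator_grp]) simp_all
  also have "\<dots> = mu (Suc 0) (slotC 0 \<omega> (slotV (Suc 0) \<phi> ?t)) \<otimes>\<^sub>k grp"
  proof (rule ins_end[OF _ pure_homog])
    have "slotC 0 \<omega> (slotV (Suc 0) \<phi> ?t) \<in> homog (Suc (Suc (Suc n)))"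
      by (rule loc_homog[OF operator_omega Hom0_coact_homog]) simp_all
    from loc_homog[OF operator_mult this]
    show "mu (Suc 0) (slotC 0 \<omega> (slotV (Suc 0) \<phi> ?t)) \<in> homog (Suc (Suc n))"
      by simp
  qed simp
  finally show ?thesis .
qed

lemma Dbar_Hom0: "Dbar B \<omega> \<phi> \<in> Hom0 B (Suc n)"
proof -
  have "psis 0 (Suc (Suc n)) (slotV (Suc 0) (Dbar B \<omega> \<phi>) (coact B v)) = Dbar B \<omega> \<phi> v \<otimes>\<^sub>k grp" for v
  proof -
    have "Dbar B \<omega> \<phi> = (\<lambda>v. dif B (\<phi> v) + mu (Suc 0) (slotC 0 \<omega> (slotV (Suc 0) \<phi> (coact B v))))"
      by (rule ext) (rule Dbar_eq)
    then show ?thesis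
      by (simp add: slotV_add dif_equivariant form_equivariant linear_simps del: psis.simps)
  qed
  then show ?thesis
    unfolding Hom0_def psi_pow_psis at_slot_loc
    using Dbar_linear Dbar_mem by (simp del: psis.simps)
qed

lemma operator_Dbar: "operator (Suc 0) (Suc (Suc n)) (\<lambda>w. on_V (Dbar B \<omega> \<phi>) (hd w))"
  by (rule operator_V[OF Dbar_linear P_Omega_M_homog[OF Dbar_mem]])

end

section \<open>The torsion of a frame resolution\<close>

context
  fixes \<theta>
  assumes theta: "\<theta> \<in> Hom0 B (Suc 0)"
begin

lemma operator_theta: "operator (Suc 0) 2 (\<lambda>w. on_V \<theta> (hd w))"
  using operator_Hom0[OF theta] by (simp add: numeral_2_eq_2)

lemma operator_Dbar_theta: "operator (Suc 0) 3 (\<lambda>w. on_V (Dbar B \<omega> \<theta>) (hd w))"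
  using operator_Dbar[OF theta] by (simp add: numeral_3_eq_3)

lemma theta_shaped: "\<theta> v \<in> shaped [Ps, Ms]"
  using Hom0_mem[OF theta, of v] P_Omega_M_shaped[of "Suc 0"] by auto

lemma contract_theta: "t \<in> shaped [Ps, Vs] \<Longrightarrow> contract B \<theta> t = mu 0 (slotV (Suc 0) \<theta> t)"
  by (rule contract_eq[OF operator_theta]) (simp add: shaped_homog)

lemma covP_linear: "Vector_Spaces.linear (scaleP B) tscale (covP B Pr)"
  unfolding covP_eq[abs_def] by (intro lin_rules linear_elP coactP_linear)

lemma operator_covP: "operator (Suc 0) 2 (\<lambda>w. on_P (covP B Pr) (hd w))"
  by (rule operator_P[OF covP_linear homog2[OF covP_shaped]])

lemma covP_slot_shaped:
  assumes "t \<in> shaped [Ps, Vs]"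
  shows "slotP 0 (covP B Pr) t \<in> shaped [Ms, Ps, Vs]"
proof -
  have "slotP 0 (covP B Pr) t \<in> shaped ([] @ [Ms, Ps] @ [Vs])"
    by (rule loc_shaped[of _ _ "[Ps]"])
      (use assms covP_shaped in \<open>auto simp: operator_multilinear[OF operator_covP] list_all2_Cons2\<close>)
  then show ?thesis by simp
qed

lemma contract_covP:
  "t \<in> shaped [Ps, Vs] \<Longrightarrow> contract B \<theta> (slotP 0 (covP B Pr) t) = mu (Suc 0) (slotV 2 \<theta> (slotP 0 (covP B Pr) t))"
  using contract_eq[OF operator_theta, of "slotP 0 (covP B Pr) t" "Suc 0"]
    shaped_homog[OF covP_slot_shaped, of t 3]
  by (simp add: numeral_2_eq_2 numeral_3_eq_3)

text \<open>
  The Leibniz rule for \<open>d(u \<theta>(v))\<close>, summed over a tensor in \<open>P \<otimes> V\<close>.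
\<close>

lemma dif_contract:
  assumes t: "t \<in> shaped [Ps, Vs]"
  shows "dif B (mu 0 (slotV (Suc 0) \<theta> t)) =
    mu (Suc 0) (slotV 2 \<theta> (slotP 0 (\<lambda>u. dif B (elP B u)) t)) + mu 0 (slotV (Suc 0) (\<lambda>v. dif B (\<theta> v)) t)"
proof (rule shaped_eqI[OF _ _ t], (intro lin_rules)+)
  fix w assume "list_all2 (\<in>) w [Ps, Vs]"
  then obtain u v where w: "w = [LP u, LV v]" by (auto simp: list_all2_Cons2)
  have d2: "dif B (elP B u) \<in> homog 2" for u
    unfolding dif_elP by (intro homog_diff pure_homog) simp_all
  have op_d: "operator (Suc 0) 2 (\<lambda>w. on_P (\<lambda>u. dif B (elP B u)) (hd w))"
    by (rule operator_P[OF _ d2]) (intro lin_rules linear_elP)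
  have dt: "dif B (\<theta> v) \<in> homog 3" for v
    unfolding dif_homog[OF homog2[OF theta_shaped]]
    by (intro homog_sum homog_scale loc_homog[OF operator_one homog2[OF theta_shaped]]) auto
  have op_dt: "operator (Suc 0) 3 (\<lambda>w. on_V (\<lambda>v. dif B (\<theta> v)) (hd w))"
    by (rule operator_V[OF _ dt]) (intro lin_rules Hom0_linear[OF theta])
  have 1: "slotV (Suc 0) \<theta> (pure B w) = elP B u \<otimes>\<^sub>k \<theta> v"
    using slot_at(2)[OF operator_theta, of "[LP u]" "Suc 0" "LV v"] by (simp add: w)
  have 2: "slotV (Suc 0) (\<lambda>v. dif B (\<theta> v)) (pure B w) = elP B u \<otimes>\<^sub>k dif B (\<theta> v)"
    using slot_at(2)[OF op_dt, of "[LP u]" "Suc 0" "LV v"] by (simp add: w)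
  have "slotP 0 (\<lambda>u. dif B (elP B u)) (pure B w) = dif B (elP B u) \<otimes>\<^sub>k pure B [LV v]"
    using slot_at(1)[OF op_d, of "[]" 0 "LP u" "[LV v]"] d2[of u] by (simp add: w tens_Nil homog_def)
  also have "slotV (2 + 0) \<theta> \<dots> = dif B (elP B u) \<otimes>\<^sub>k slotV 0 \<theta> (pure B [LV v])"
    by (rule loc_tens_right[OF operator_multilinear[OF operator_theta] d2])
  also have "slotV 0 \<theta> (pure B [LV v]) = \<theta> v"
    using loc_exact[OF operator_theta, of "[LV v]"] by simp
  finally have 3: "slotV 2 \<theta> (slotP 0 (\<lambda>u. dif B (elP B u)) (pure B w)) = dif B (elP B u) \<otimes>\<^sub>k \<theta> v"
    by simp
  have "mu (Suc 0) (dif B (elP B u) \<otimes>\<^sub>k \<theta> v) = dif B (elP B u) \<star> \<theta> v"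
    using juxt_mu[of "dif B (elP B u)" "Suc 0"] d2[of u] by (simp add: numeral_2_eq_2)
  then show "dif B (mu 0 (slotV (Suc 0) \<theta> (pure B w))) =
      mu (Suc 0) (slotV 2 \<theta> (slotP 0 (\<lambda>u. dif B (elP B u)) (pure B w))) + mu 0 (slotV (Suc 0) (\<lambda>v. dif B (\<theta> v)) (pure B w))"
    unfolding 1 2 3 using dif_leibniz[OF theta_shaped, of u v] by (simp add: juxt_elP)
qed

text \<open>
  In the cotensor product the coaction may be moved from the left factor to the right one.  This
  turns the connection part of \<open>Du\<close> into the connection term of the covariant derivative.
\<close>

lemma form_contract:
  assumes cotensor: "slotP 0 (coactP B) t = slotV (Suc 0) (coact B) t"
  shows "mu (Suc 0) (slotV 2 \<theta> (slotP 0 (\<lambda>u. mu 0 (slotC (Suc 0) \<omega> (coactP B u))) t)) =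
    mu 0 (slotV (Suc 0) (\<lambda>x. mu (Suc 0) (slotC 0 \<omega> (slotV (Suc 0) \<theta> (coact B x)))) t)"
proof -
  let ?q = "slotV (Suc 0) (coact B) t"
  have h: "slotC (Suc 0) \<omega> (coactP B u) \<in> homog 3" for u
    by (rule loc_homog[OF operator_omega homog2[OF coactP_shaped]]) simp_all
  have op: "operator (Suc 0) 3 (\<lambda>w. on_P (\<lambda>u. slotC (Suc 0) \<omega> (coactP B u)) (hd w))"
    by (rule operator_P[OF _ h]) (intro lin_rules coactP_linear)
  have "slotP 0 (\<lambda>u. mu 0 (slotC (Suc 0) \<omega> (coactP B u))) t = mu 0 (slotC (Suc 0) \<omega> ?q)"
    using slotP_comp[OF ops_multilinear(2) _ op, of 0 0 t]
      slotP_comp[OF operator_multilinear[OF operator_omega] _ operator_coactP, of "Suc 0" 0 t]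
    by (simp add: cotensor)
  also have "slotV 2 \<theta> \<dots> = mu 0 (slotV 3 \<theta> (slotC (Suc 0) \<omega> ?q))"
    by (rule loc_commute[OF operator_mult operator_theta, symmetric]) simp_all
  also have "slotV 3 \<theta> (slotC (Suc 0) \<omega> ?q) = slotC (Suc 0) \<omega> (slotV 2 \<theta> ?q)"
    by (rule loc_commute[OF operator_omega operator_theta, symmetric]) simp_all
  also have "mu (Suc 0) (mu 0 (slotC (Suc 0) \<omega> (slotV 2 \<theta> ?q))) =
      mu 0 (mu 2 (slotC (Suc 0) \<omega> (slotV 2 \<theta> ?q)))"
    using mu_mu[of 0 2] by simp
  also have "mu 2 (slotC (Suc 0) \<omega> (slotV 2 \<theta> ?q)) =
      slotV (Suc 0) (\<lambda>x. mu (Suc 0) (slotC 0 \<omega> (slotV (Suc 0) \<theta> (coact B x)))) t"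
    by (rule slotV_connection_term[OF theta, symmetric])
  finally show ?thesis .
qed

lemma assoc_bundle_iff:
  "t \<in> assoc_bundle B \<longleftrightarrow> t \<in> shaped [Ps, Vs] \<and> slotP 0 (coactP B) t = slotV (Suc 0) (coact B) t"
  by (simp add: assoc_bundle_def tens_set_eq at_slot_loc)

lemma torsion_formula:
  assumes t: "t \<in> assoc_bundle B"
  shows "dif B (contract B \<theta> t) - contract B \<theta> (slotP 0 (covP B Pr) t) = mu 0 (slotV (Suc 0) (Dbar B \<omega> \<theta>) t)"
proof -
  have t': "t \<in> shaped [Ps, Vs]" "slotP 0 (coactP B) t = slotV (Suc 0) (coact B) t"
    using t by (simp_all add: assoc_bundle_iff)
  have "Dbar B \<omega> \<theta> = (\<lambda>v. dif B (\<theta> v) + mu (Suc 0) (slotC 0 \<omega> (slotV (Suc 0) \<theta> (coact B v))))"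
    by (rule ext) (rule Dbar_eq[OF theta])
  then have "mu 0 (slotV (Suc 0) (Dbar B \<omega> \<theta>) t) = mu 0 (slotV (Suc 0) (\<lambda>v. dif B (\<theta> v)) t) +
      mu (Suc 0) (slotV 2 \<theta> (slotP 0 (\<lambda>u. mu 0 (slotC (Suc 0) \<omega> (coactP B u))) t))"
    by (simp add: slotV_add loc_linear form_contract[OF t'(2)])
  moreover have "slotP 0 (covP B Pr) t = slotP 0 (\<lambda>u. dif B (elP B u)) t -
      slotP 0 (\<lambda>u. mu 0 (slotC (Suc 0) \<omega> (coactP B u))) t"
    unfolding covP_eq[abs_def] by (rule slotP_diff)
  ultimately show ?thesis
    unfolding contract_covP[OF t'(1)] contract_theta[OF t'(1)] dif_contract[OF t'(1)]
    by (simp add: loc_linear)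
qed

lemma contract_Dbar_pure:
  "mu 0 (slotV (Suc 0) (Dbar B \<omega> \<theta>) (pure B [LP u, LV v])) = elP B u \<star> Dbar B \<omega> \<theta> v"
  using slot_at(2)[OF operator_Dbar_theta, of "[LP u]" "Suc 0" "LV v"] by (simp add: juxt_elP)

lemma contract_Dbar_mem:
  assumes t: "t \<in> shaped [Ps, Vs]"
  shows "mu 0 (slotV (Suc 0) (Dbar B \<omega> \<theta>) t) \<in> P_Omega_M B 2"
  unfolding P_Omega_M_def
proof (rule shaped_into[OF _ t], (intro lin_rules)+)
  fix w assume "list_all2 (\<in>) w [Ps, Vs]"
  then obtain u v where w: "w = [LP u, LV v]" by (auto simp: list_all2_Cons2)
  have "elP B u \<star> Dbar B \<omega> \<theta> v \<in> P_Omega_M B (Suc (Suc 0))"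
    by (rule P_Omega_M_left[OF Dbar_mem[OF theta]])
  then show "mu 0 (slotV (Suc 0) (Dbar B \<omega> \<theta>) (pure B w)) \<in> tspan {elP B p \<star> x |p x. x \<in> Omega_M B 2}"
    unfolding w contract_Dbar_pure P_Omega_M_def by (simp add: numeral_2_eq_2)
qed

text \<open>
  The torsion form lies in \<open>P \<otimes> M \<otimes> M\<close> because the covariant derivative of \<open>\<theta>\<close> has values
  in \<open>P(\<Omega>\<^sup>2M)\<close>. It lies in \<open>M \<otimes> P \<otimes> M\<close> because \<open>d\<close> preserves forms over the base and
  \<open>Du \<theta>(v)\<close> is in \<open>M \<otimes> P \<otimes> M\<close> by strongness.
\<close>

lemma torsion_form_mem:
  assumes t: "t \<in> assoc_bundle B" and x: "contract B \<theta> t \<in> Omega_M B 1"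
  shows "mu 0 (slotV (Suc 0) (Dbar B \<omega> \<theta>) t) \<in> Omega_M B 2" (is "?T \<in> _")
proof -
  have t': "t \<in> shaped [Ps, Vs]" using t by (simp add: assoc_bundle_iff)
  have "?T \<in> P_Omega_M B 2" by (rule contract_Dbar_mem[OF t'])
  then have T: "?T \<in> shaped (Ps # replicate 2 Ms)" "\<And>i. i < 2 \<Longrightarrow> mu i ?T = 0"
    using P_Omega_M_shaped P_Omega_M_mu by blast+
  have "slotV 2 \<theta> (slotP 0 (covP B Pr) t) \<in> shaped ([Ms, Ps] @ [Ps, Ms] @ [])"
    by (rule loc_shaped[of _ _ "[Vs]"])
      (use covP_slot_shaped[OF t'] theta_shaped in
        \<open>auto simp: operator_multilinear[OF operator_theta] list_all2_Cons2\<close>)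
  then have "contract B \<theta> (slotP 0 (covP B Pr) t) \<in> shaped [Ms, Ps, Ms]"
    using mu_shaped_replicate[of _ "[Ms]" "[Ms]" "Suc 0"] by (simp add: contract_covP[OF t'])
  moreover have "dif B (contract B \<theta> t) \<in> shaped [Ms, Ms, Ms]"
    using Omega_M_shaped[OF dif_Omega_M[OF x]] by simp
  then have "dif B (contract B \<theta> t) \<in> shaped [Ms, Ps, Ms]"
    by (rule shaped_mono) auto
  ultimately have "?T \<in> shaped [Ms, Ps, Ms]"
    unfolding torsion_formula[OF t, symmetric] by (rule shaped_diff[rotated])
  with T(1) have "?T \<in> shaped (Ms # replicate 2 Ms)"
    by (rule base_first_factor)
  then show ?thesis using T(2) by (simp only: Omega_M_iff replicate_Suc) blast
qed

end

lemma torsion_frame: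
  assumes frame: "frame_resolution B \<theta>"
  shows "t \<in> assoc_bundle B \<Longrightarrow> torsion B Pr \<theta> (contract B \<theta> t) = mu 0 (slotV (Suc 0) (Dbar B \<omega> \<theta>) t)"
    and "torsion B Pr \<theta> \<in> Omega_M B 1 \<rightarrow> Omega_M B 2"
proof -
  have theta: "\<theta> \<in> Hom0 B (Suc 0)"
    and bij: "bij_betw (contract B \<theta>) (assoc_bundle B) (Omega_M B 1)"
    using frame by (simp_all add: frame_resolution_def)
  show formula: "torsion B Pr \<theta> (contract B \<theta> t) = mu 0 (slotV (Suc 0) (Dbar B \<omega> \<theta>) t)"
    if t: "t \<in> assoc_bundle B" for t
  proof -
    have "inv_into (assoc_bundle B) (contract B \<theta>) (contract B \<theta> t) = t"
      using bij t by (simp add: bij_betw_def inv_into_f_f)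
    then show ?thesis
      using torsion_formula[OF theta t] by (simp add: torsion_def nabla_def at_slot_loc)
  qed
  show "torsion B Pr \<theta> \<in> Omega_M B 1 \<rightarrow> Omega_M B 2"
  proof
    fix x assume x: "x \<in> Omega_M B 1"
    then obtain t where t: "t \<in> assoc_bundle B" "x = contract B \<theta> t"
      using bij unfolding bij_betw_def by blast
    then show "torsion B Pr \<theta> x \<in> Omega_M B 2"
      using formula[OF t(1)] torsion_form_mem[OF theta t(1)] x by simp
  qed
qed

end

theorem proposition5p6:
  fixes B :: "('k::field, 'p::{ring,monoid_mult}, 'c::ab_group_add, 'v::ab_group_add) bundle_data"
    and Pr :: "('k, 'p, 'c, 'v) tensor \<Rightarrow> ('k, 'p, 'c, 'v) tensor"
    and \<omega> :: "'c \<Rightarrow> ('k, 'p, 'c, 'v) tensor"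
  assumes "copointed_coalgebra_bundle B"
    and "psi_bijective B"
    and "strong_connection B Pr"
    and "connection_form B Pr \<omega>"
    and "left_comodule B"
  shows "(\<forall>n. \<forall>\<phi>\<in>Hom0 B n. Dbar B \<omega> \<phi> \<in> Hom0 B (Suc n)) \<and>
    (\<forall>\<theta>. frame_resolution B \<theta> \<and> flat_right (base_alg B) \<longrightarrow>
       torsion B Pr \<theta> \<in> Omega_M B 1 \<rightarrow> Omega_M B 2 \<and>
       (\<forall>(N::nat) u v. (\<Sum>i<N. pure B [LP (u i), LV (v i)]) \<in> assoc_bundle B \<longrightarrow>
          torsion B Pr \<theta> (contract B \<theta> (\<Sum>i<N. pure B [LP (u i), LV (v i)])) =
            (\<Sum>i<N. elP B (u i) \<star>\<^bsub>B\<^esub> Dbar B \<omega> \<theta> (v i))))"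
proof -
  interpret strong_bundle B Pr \<omega>
    using assms by (rule strong_bundle.intro)
  show ?thesis
  proof (intro conjI allI impI ballI)
    show "Dbar B \<omega> \<phi> \<in> Hom0 B (Suc n)" if "\<phi> \<in> Hom0 B n" for n \<phi>
      using that by (rule Dbar_Hom0)
  next
    fix \<theta> assume "frame_resolution B \<theta> \<and> flat_right (base_alg B)"
    then have frame: "frame_resolution B \<theta>" ..
    then have theta: "\<theta> \<in> Hom0 B (Suc 0)" by (simp add: frame_resolution_def)
    show "torsion B Pr \<theta> \<in> Omega_M B 1 \<rightarrow> Omega_M B 2"
      by (rule torsion_frame(2)[OF frame])
    fix N :: nat and u v
    assume "(\<Sum>i<N. pure B [LP (u i), LV (v i)]) \<in> assoc_bundle B"
    then show "torsion B Pr \<theta> (contract B \<theta> (\<Sum>i<N. pure B [LP (u i), LV (v i)])) =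
        (\<Sum>i<N. elP B (u i) \<star>\<^bsub>B\<^esub> Dbar B \<omega> \<theta> (v i))"
      by (simp add: torsion_frame(1)[OF frame] loc_linear contract_Dbar_pure[OF theta])
  qed
qed

end
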